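(* Let $n\ge1$, $\tau_1<\dots<\tau_n$ real, and for each $j$ let $J_j=[a_j^{(1)},a_j^{(2)}]\cup[a_j^{(3)},a_j^{(4)}]\cup\dots\cup[a_j^{(2k_j-1)},a_j^{(2k_j)}]$ with $a_j^{(1)}<\dots<a_j^{(2k_j)}$. Let $P$ be the $n\times n$ matrix (multi-time) Pearcey kernel and $\chi_{\vec J}$ the corresponding multiplication operator (see context). Then $$\det(\mathrm{Id}-\chi_{\vec J}P)=\det(\mathrm{Id}-K_P),$$ where $K_P$ is the integrable operator on $V:=L^2(i\mathbb R,\mathbb C^n)\oplus L^2(\gamma_L\cup\gamma_R,\mathbb C^n)$ with $n\times n$ matrix kernel $$K_P(\lambda,\mu)=\frac{\mathbf f_P^T(\lambda)\mathbf g_P(\mu)}{\lambda-\mu},\qquad \mathbf f_P:=\frac1{2\pi i}(\vec f_{P,1},\dots,\vec f_{P,n}),\quad \mathbf g_P:=(\vec g_{P,1},\dots,\vec g_{P,n}),$$ the column vectors of length $1+\sum_m2k_m$, in blocks of sizes $1,2k_1,\dots,2k_n$, being: - $\vec f_{P,i}(\lambda)$: first entry $e^{\frac12\Theta_i(0,\lambda)}\chi_{\gamma_L\cup\gamma_R}(\lambda)$; $i$-th block $\big(e^{a_i^{(s)}\lambda}\chi_{i\mathbb R}(\lambda)\big)_{s=1}^{2k_i}$; other blocks zero. - $\vec g_{P,j}(\mu)$: first entry $e^{-\Theta_j(0,\mu)}\chi_{i\mathbb R}(\mu)$; for $m<j$ the $m$-th block $\epsilon_{2k_m}\big(e^{-a_m^{(t)}\mu+(\tau_j-\tau_m)\mu^2/2}\chi_{i\mathbb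 R}(\mu)\big)_{t=1}^{2k_m}$; the $j$-th block $\epsilon_{2k_j}\big(e^{\frac12\Theta_j(0,\mu)-a_j^{(t)}\mu}\chi_{\gamma_L\cup\gamma_R}(\mu)\big)_{t=1}^{2k_j}$; blocks $m>j$ zero. Both determinants are understood as Fredholm series.
   Context: Notation: $\Theta_i(x,\mu):=\frac{\mu^4}{4}-\frac{\tau_i}{2}\mu^2-x\mu$; $\epsilon_k:=\mathrm{diag}(1,-1,\dots,(-1)^{k+1})$; $\chi_S$ the indicator of $S$; $i\mathbb R$ oriented upward. The contours $\gamma_R,\gamma_L$ are the usual Pearcey contours: $\gamma_R$ lies in the right half-plane and consists of a ray from $\infty e^{i\pi/4}$ to a point $c>0$ and a ray from $c$ to $\infty e^{-i\pi/4}$; $\gamma_L$ lies in the left half-plane and consists of a ray from $\infty e^{3i\pi/4}$ to $-c$ and a ray from $-c$ to $\infty e^{-3i\pi/4}$ (so that $e^{\Theta_i(x,\mu)}$ decays along them and they do not meet $i\mathbb R$). Pearcey kernel on $L^2(\mathbb R,\mathbb C^n)$: $P_{ij}(x,y)=\widetilde P_{ij}(x,y)-Q_{ij}(x,y)$ with $\widetilde P_{ij}(x,y)=\frac{1}{(2\pi i)^2}\int_{\gamma_L\cup\gamma_R}d\mu\int_{i\mathbb R}d\lambda\,\frac{e^{\Theta_i(x,\mu)-\Theta_j(y,\lambda)}}{\lambda-\mu}$ and $Q_{ij}(x,y)=\chi_{\tau_i<\tau_j}\frac{1}{\sqrt{2\pi(\tau_j-\tau_i)}}e^{-\frac{(x-y)^2}{2(\tau_j-\tau_i)}}$.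 $\chi_{\vec J}$ multiplies the $i$-th component by $\chi_{J_i}$. "$\det(\mathrm{Id}-G)$" denotes the Fredholm series $1+\sum_{k\ge1}\frac1{k!}\int_{X^k}\det[G(\xi_a,\xi_b)]_{a,b\le k}\prod d\xi_a$ (matrix index treated as a discrete variable); for $P$ this equals $e^{-\mathrm{Tr}(\chi_{\vec J}\widetilde P)}\det_2(\mathrm{Id}-\chi_{\vec J}P)$ with $\det_2$ the Carleman regularized determinant.
   Formalization: The Fredholm series of det(Id−G) is taken with the standard factor (−1)^k/k!, where the notation section's display omits the sign (without it the identity fails already for n=1). *)

theory Defs
  imports "HOL-Analysis.Analysis"
begin

definition ldet :: "nat \<Rightarrow> (nat \<Rightarrow> nat \<Rightarrow> complex) \<Rightarrow> complex" where
  "ldet k A = (\<Sum>p | p permutes {..<k}. of_int (sign p) * (\<Prod>i<k. A i (p i)))"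

text \<open>k-th term of the Fredholm series of det(Id - G) on the space I x X, where the
  finite (matrix/piece) index set I carries counting measure and X carries the measure M:
  (-1)^k/k! * integral over (I x X)^k of det[G(xi_a, xi_b)].\<close>
definition fredholm_term ::
  "'i set \<Rightarrow> 'x measure \<Rightarrow> ('i \<Rightarrow> 'x \<Rightarrow> 'i \<Rightarrow> 'x \<Rightarrow> complex) \<Rightarrow> nat \<Rightarrow> complex" where
  "fredholm_term I M G k =
     ((-1) ^ k / of_nat (fact k)) *
     (\<Sum>\<iota>\<in>PiE {..<k} (\<lambda>_. I).
        integral\<^sup>L (PiM {..<k} (\<lambda>_. M)) (\<lambda>\<xi>. ldet k (\<lambda>a b. G (\<iota> a) (\<xi> a) (\<iota> b) (\<xi> b))))"

definition Theta :: "(nat \<Rightarrow> real) \<Rightarrow> nat \<Rightarrow> real \<Rightarrow> complex \<Rightarrow> complex" where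
  "Theta \<tau> i x \<mu> = \<mu> ^ 4 / 4 - of_real (\<tau> i) / 2 * \<mu> ^ 2 - of_real x * \<mu>"

definition bray :: "complex \<Rightarrow> complex \<Rightarrow> complex \<Rightarrow> real \<Rightarrow> complex" where
  "bray v d1 d2 s = (if s \<le> 0 then v + of_real (- s) * d1 else v + of_real s * d2)"

definition bray_dz :: "complex \<Rightarrow> complex \<Rightarrow> real \<Rightarrow> complex" where
  "bray_dz d1 d2 s = (if s \<le> 0 then - d1 else d2)"

text \<open>Parametrisation (by s in R) of the three contour pieces: r = 0 is iR (upward),
  r = 1 is gamma_L, r = 2 is gamma_R; cdz is the derivative d(point)/ds.\<close>
definition cpt :: "real \<Rightarrow> nat \<Rightarrow> real \<Rightarrow> complex" where
  "cpt c r s =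
     (if r = 0 then \<i> * of_real s
      else if r = 1 then bray (- of_real c) (cis (3 * pi / 4)) (cis (- 3 * pi / 4)) s
      else bray (of_real c) (cis (pi / 4)) (cis (- pi / 4)) s)"

definition cdz :: "nat \<Rightarrow> real \<Rightarrow> complex" where
  "cdz r s =
     (if r = 0 then \<i>
      else if r = 1 then bray_dz (cis (3 * pi / 4)) (cis (- 3 * pi / 4)) s
      else bray_dz (cis (pi / 4)) (cis (- pi / 4)) s)"

definition iR_set :: "complex set" where
  "iR_set = {z. Re z = 0}"

definition gammaLR_set :: "real \<Rightarrow> complex set" where
  "gammaLR_set c = range (cpt c 1) \<union> range (cpt c 2)"

definition iR_integral :: "(complex \<Rightarrow> complex) \<Rightarrow> complex" where
  "iR_integral f = integral\<^sup>L lborel (\<lambda>t. f (cpt 0 0 t) * cdz 0 t)"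

definition gammaLR_integral :: "real \<Rightarrow> (complex \<Rightarrow> complex) \<Rightarrow> complex" where
  "gammaLR_integral c f = (\<Sum>r\<in>{1, 2}. integral\<^sup>L lborel (\<lambda>s. f (cpt c r s) * cdz r s))"

definition Ptilde :: "(nat \<Rightarrow> real) \<Rightarrow> real \<Rightarrow> nat \<Rightarrow> nat \<Rightarrow> real \<Rightarrow> real \<Rightarrow> complex" where
  "Ptilde \<tau> c i j x y =
     1 / (2 * pi * \<i>) ^ 2 *
     gammaLR_integral c (\<lambda>\<mu>. iR_integral (\<lambda>la.
        exp (Theta \<tau> i x \<mu> - Theta \<tau> j y la) / (la - \<mu>)))"

definition Qker :: "(nat \<Rightarrow> real) \<Rightarrow> nat \<Rightarrow> nat \<Rightarrow> real \<Rightarrow> real \<Rightarrow> complex" where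
  "Qker \<tau> i j x y =
     (if \<tau> i < \<tau> j
      then of_real (1 / sqrt (2 * pi * (\<tau> j - \<tau> i)) * exp (- ((x - y) ^ 2) / (2 * (\<tau> j - \<tau> i))))
      else 0)"

definition Pearcey :: "(nat \<Rightarrow> real) \<Rightarrow> real \<Rightarrow> nat \<Rightarrow> nat \<Rightarrow> real \<Rightarrow> real \<Rightarrow> complex" where
  "Pearcey \<tau> c i j x y = Ptilde \<tau> c i j x y - Qker \<tau> i j x y"

definition Jset :: "(nat \<Rightarrow> nat \<Rightarrow> real) \<Rightarrow> (nat \<Rightarrow> nat) \<Rightarrow> nat \<Rightarrow> real set" where
  "Jset a k j = (\<Union>l\<in>{1..k j}. {a j (2 * l - 1) .. a j (2 * l)})"

text \<open>0-based position of the first entry of block m (blocks of sizes 1, 2k_1, ..., 2k_n).\<close>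
definition boff :: "(nat \<Rightarrow> nat) \<Rightarrow> nat \<Rightarrow> nat" where
  "boff k m = 1 + (\<Sum>l\<in>{1..<m}. 2 * k l)"

definition vlen :: "nat \<Rightarrow> (nat \<Rightarrow> nat) \<Rightarrow> nat" where
  "vlen n k = 1 + (\<Sum>m\<in>{1..n}. 2 * k m)"

text \<open>Column vector of length vlen n k with first entry v0 and entry s (1 \<le> s \<le> 2k_m) of
  block m equal to blk m s.\<close>
definition blockvec :: "nat \<Rightarrow> (nat \<Rightarrow> nat) \<Rightarrow> complex \<Rightarrow> (nat \<Rightarrow> nat \<Rightarrow> complex) \<Rightarrow> nat \<Rightarrow> complex" where
  "blockvec n k v0 blk p =
     (if p = 0 then v0
      else (\<Sum>m\<in>{1..n}. \<Sum>s\<in>{1..2 * k m}. if p = boff k m + s - 1 then blk m s else 0))"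

definition fP :: "(nat \<Rightarrow> real) \<Rightarrow> (nat \<Rightarrow> nat \<Rightarrow> real) \<Rightarrow> (nat \<Rightarrow> nat) \<Rightarrow> nat \<Rightarrow> real
                   \<Rightarrow> nat \<Rightarrow> complex \<Rightarrow> nat \<Rightarrow> complex" where
  "fP \<tau> a k n c i la =
     blockvec n k
       (exp (Theta \<tau> i 0 la / 2) * indicator (gammaLR_set c) la)
       (\<lambda>m s. if m = i then exp (of_real (a i s) * la) * indicator iR_set la else 0)"

definition gP :: "(nat \<Rightarrow> real) \<Rightarrow> (nat \<Rightarrow> nat \<Rightarrow> real) \<Rightarrow> (nat \<Rightarrow> nat) \<Rightarrow> nat \<Rightarrow> real
                   \<Rightarrow> nat \<Rightarrow> complex \<Rightarrow> nat \<Rightarrow> complex" where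
  "gP \<tau> a k n c j \<mu> =
     blockvec n k
       (exp (- Theta \<tau> j 0 \<mu>) * indicator iR_set \<mu>)
       (\<lambda>m t. if m < j then (-1) ^ (t + 1) *
                  exp (- of_real (a m t) * \<mu> + of_real (\<tau> j - \<tau> m) * \<mu> ^ 2 / 2)
                  * indicator iR_set \<mu>
              else if m = j then (-1) ^ (t + 1) *
                  exp (Theta \<tau> j 0 \<mu> / 2 - of_real (a j t) * \<mu>)
                  * indicator (gammaLR_set c) \<mu>
              else 0)"

definition KP :: "(nat \<Rightarrow> real) \<Rightarrow> (nat \<Rightarrow> nat \<Rightarrow> real) \<Rightarrow> (nat \<Rightarrow> nat) \<Rightarrow> nat \<Rightarrow> real
                   \<Rightarrow> nat \<Rightarrow> nat \<Rightarrow> complex \<Rightarrow> complex \<Rightarrow> complex" where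
  "KP \<tau> a k n c i j la \<mu> =
     (1 / (2 * pi * \<i>) * (\<Sum>p<vlen n k. fP \<tau> a k n c i la p * gP \<tau> a k n c j \<mu> p)) / (la - \<mu>)"

text \<open>K_P as a kernel on {1..n} x {pieces 0,1,2} x R (parametrised contour), including the
  oriented line element d\<mu> = cdz r' s' ds'.\<close>
definition KP_param :: "(nat \<Rightarrow> real) \<Rightarrow> (nat \<Rightarrow> nat \<Rightarrow> real) \<Rightarrow> (nat \<Rightarrow> nat) \<Rightarrow> nat \<Rightarrow> real
                   \<Rightarrow> nat \<times> nat \<Rightarrow> real \<Rightarrow> nat \<times> nat \<Rightarrow> real \<Rightarrow> complex" where
  "KP_param \<tau> a k n c ir s jr' s' =
     KP \<tau> a k n c (fst ir) (fst jr') (cpt c (snd ir) s) (cpt c (snd jr') s') * cdz (snd jr') s'"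

end

theory Submission
  imports Defs "HOL-Probability.Characteristic_Functions" "Jordan_Normal_Form.Determinant"
begin

text \<open>
  Both operators are Schur complements of one kernel on the disjoint union of \<open>J\<close>, \<open>i\<real>\<close> and
  \<open>\<gamma>\<close>. Since \<open>\<Sum>\<^sub>s (-1)\<^bsup>s+1\<^esup> e\<^bsup>a\<^sub>s z\<^esup> / z = - \<integral>\<^sub>J e\<^bsup>xz\<^esup> dx\<close>, every entry of \<open>K\<^sub>P\<close> with row in
  \<open>i\<real>\<close> factors through \<open>L\<^sup>2(J)\<close> by the Laplace kernel \<open>F(\<lambda>, x) = e\<^bsup>x\<lambda>\<^esup>\<close>. In the block kernel with rows
  \<open>J: (0, N, B)\<close>, \<open>i\<real>: (F, 0, 0)\<close>, \<open>\<gamma>: (0, C, 0)\<close>, eliminating \<open>J\<close> leaves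
  \<open>(FN, FB; C, 0) = K\<^sub>P\<close>, while eliminating \<open>i\<real>\<close> and then \<open>\<gamma>\<close> leaves \<open>NF + BCF\<close>, which is
  \<open>\<chi>\<^sub>J P \<chi>\<^sub>J\<close>: \<open>BCF\<close> is the double contour integral and \<open>NF = - Q\<close> is a Gaussian Fourier integral.

  The elimination rule \<open>det(1 - (A, B; C, 0)) = det(1 - A - BC)\<close> is proved on the Fredholm series.
  Expanding in the rows turns both sides into sums over one array \<open>t(p, q)\<close>, where \<open>p\<close>
  counts the remaining variables and \<open>q\<close> the factors \<open>BC\<close>: the term of degree \<open>m\<close> is \<open>\<Sum>\<^sub>q t(m - q, q)\<close> on
  the left and \<open>\<Sum>\<^sub>q t(m, q)\<close> on the right. Hadamard's inequality makes the array absolutely summable.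
\<close>

section \<open>Determinants and Hadamard's inequality\<close>

lemma permutes_lessThan_iff: "p permutes {..<k} \<Longrightarrow> p i < k \<longleftrightarrow> i < (k::nat)"
  using permutes_in_image[of p "{..<k}" i] by simp

lemma ldet_cong:
  assumes "\<And>a b. a < k \<Longrightarrow> b < k \<Longrightarrow> A a b = B a b"
  shows "ldet k A = ldet k B"
  unfolding ldet_def
  by (intro sum.cong refl arg_cong2[where f="(*)"] prod.cong) (auto simp: assms permutes_lessThan_iff)

lemma ldet_eq_det: "ldet k A = Determinant.det (Matrix.mat k k (\<lambda>(i, j). A i j))"
proof -
  have "(\<Prod>i<k. A i (p i)) = (\<Prod>i = 0..<k. Matrix.mat k k (\<lambda>(i, j). A i j) $$ (i, p i))"
    if "p permutes {..<k}" for p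
    using that by (intro prod.cong) (auto simp: permutes_lessThan_iff)
  then show ?thesis
    unfolding ldet_def Determinant.det_def by (auto simp: lessThan_atLeast0 intro!: sum.cong)
qed

lemma ldet_transpose: "ldet k (\<lambda>i j. A j i) = ldet k A"
proof -
  have "Matrix.mat k k (\<lambda>(i, j). A j i) = transpose_mat (Matrix.mat k k (\<lambda>(i, j). A i j))"
    by (intro eq_matI) auto
  then show ?thesis
    unfolding ldet_eq_det by (simp add: Determinant.det_transpose[of _ k])
qed

lemma ldet_permute_rows:
  assumes "\<sigma> permutes {..<k}"
  shows "ldet k (\<lambda>i. A (\<sigma> i)) = of_int (sign \<sigma>) * ldet k A"
proof -
  have "Matrix.mat k k (\<lambda>(i, j). A (\<sigma> i) j)
      = Matrix.mat k k (\<lambda>(i, j). Matrix.mat k k (\<lambda>(i, j). A i j) $$ (\<sigma> i, j))"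
    using assms by (intro eq_matI) (auto simp: permutes_lessThan_iff)
  then show ?thesis
    using assms unfolding ldet_eq_det
    by (simp add: Determinant.det_permute_rows[of _ k] lessThan_atLeast0)
qed

lemma ldet_permute_rows_and_columns:
  assumes "\<sigma> permutes {..<k}"
  shows "ldet k (\<lambda>i j. A (\<sigma> i) (\<sigma> j)) = ldet k A"
proof -
  have "ldet k (\<lambda>i j. A (\<sigma> i) (\<sigma> j)) = of_int (sign \<sigma>) * ldet k (\<lambda>i j. A i (\<sigma> j))"
    by (rule ldet_permute_rows[OF assms, where A="\<lambda>i j. A i (\<sigma> j)"])
  also have "ldet k (\<lambda>i j. A i (\<sigma> j)) = ldet k (\<lambda>i j. A j (\<sigma> i))"
    by (rule ldet_transpose[symmetric])
  also have "\<dots> = of_int (sign \<sigma>) * ldet k (\<lambda>i j. A j i)"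
    by (rule ldet_permute_rows[OF assms, where A="\<lambda>i j. A j i"])
  also have "ldet k (\<lambda>i j. A j i) = ldet k A"
    by (rule ldet_transpose)
  finally show ?thesis by (simp add: sign_def)
qed

lemma ldet_equal_rows:
  assumes "r < k" "s < k" "r \<noteq> s" "A r = A s"
  shows "ldet k A = 0"
  unfolding ldet_eq_det
  by (rule det_identical_rows[of _ k r s]) (use assms in \<open>auto intro!: eq_vecI\<close>)

lemma ldet_row_expand:
  assumes "r < k"
  shows "ldet k (A(r := v)) = (\<Sum>b<k. v b * ldet k (A(r := \<lambda>j. of_bool (j = b))))"
proof -
  have split: "(\<Prod>i<k. (A(r := w)) i (p i)) = w (p r) * (\<Prod>i\<in>{..<k} - {r}. A i (p i))" for w p
    using assms by (subst prod.remove[of _ r]) (auto intro!: prod.cong)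
  have "(\<Sum>b<k. v b * ldet k (A(r := \<lambda>j. of_bool (j = b))))
      = (\<Sum>p | p permutes {..<k}. of_int (sign p) *
          ((\<Sum>b<k. v b * of_bool (p r = b)) * (\<Prod>i\<in>{..<k} - {r}. A i (p i))))"
    unfolding ldet_def split sum_distrib_left sum_distrib_right
    by (subst sum.swap) (simp add: mult_ac)
  also have "\<dots> = (\<Sum>p | p permutes {..<k}. of_int (sign p) * (v (p r) * (\<Prod>i\<in>{..<k} - {r}. A i (p i))))"
    using assms by (intro sum.cong refl)
      (auto simp: permutes_lessThan_iff of_bool_def if_distrib cong: if_cong)
  finally show ?thesis
    unfolding ldet_def split by simp
qed

lemma ldet_row_sum:
  assumes "r < k"
  shows "ldet k (A(r := \<lambda>j. \<Sum>s\<in>S. c s * u s j)) = (\<Sum>s\<in>S. c s * ldet k (A(r := u s)))"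
  unfolding ldet_row_expand[OF assms, of A "\<lambda>j. \<Sum>s\<in>S. c s * u s j"] ldet_row_expand[OF assms, of A "u _"]
    sum_distrib_left sum_distrib_right
  by (subst sum.swap) (simp add: mult.assoc)

lemma ldet_row_scale:
  assumes "r < k"
  shows "ldet k (A(r := \<lambda>j. c * u j)) = c * ldet k (A(r := u))"
  using ldet_row_sum[OF assms, where S="{()}" and c="\<lambda>_. c" and u="\<lambda>_. u"] by simp

lemma ldet_zero_row:
  assumes "r < k" "\<And>j. j < k \<Longrightarrow> A r j = 0"
  shows "ldet k A = 0"
proof -
  have "ldet k A = ldet k (A(r := \<lambda>j. 0))"
    using assms(2) by (intro ldet_cong) auto
  then show ?thesis
    by (simp add: ldet_row_expand[OF assms(1), of A "\<lambda>_. 0"])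
qed

lemma has_bochner_integral_ldet_row:
  assumes "r < k" "\<And>j. j < k \<Longrightarrow> integrable M (\<lambda>z. v z j)"
  shows "has_bochner_integral M (\<lambda>z. ldet k (A(r := v z))) (ldet k (A(r := \<lambda>j. \<integral>z. v z j \<partial>M)))"
  unfolding ldet_row_expand[OF assms(1), of A "v _"] ldet_row_expand[OF assms(1), of A "\<lambda>j. \<integral>z. v z j \<partial>M"]
  using assms(2)
  by (intro has_bochner_integral_sum has_bochner_integral_mult_left)
     (auto intro: has_bochner_integral_integrable)

lemma ldet_subtract_other_rows:
  assumes "r < k" "S \<subseteq> {..<k} - {r}"
  shows "ldet k (A(r := \<lambda>j. A r j - (\<Sum>s\<in>S. c s * A s j))) = ldet k A"
proof -
  have "ldet k (A(r := A s)) = 0" if "s \<in> S" for s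
    using that assms by (intro ldet_equal_rows[of r k s]) auto
  then have "ldet k (A(r := \<lambda>j. \<Sum>s\<in>S. c s * A s j)) = 0"
    unfolding ldet_row_sum[OF assms(1)] by simp
  moreover have "ldet k (A(r := \<lambda>j. A r j - (\<Sum>s\<in>S. c s * A s j)))
      = ldet k (A(r := A r)) - ldet k (A(r := \<lambda>j. \<Sum>s\<in>S. c s * A s j))"
    unfolding ldet_row_expand[OF assms(1), of A "\<lambda>j. A r j - _ j"] ldet_row_expand[OF assms(1), of A "A r"]
      ldet_row_expand[OF assms(1), of A "\<lambda>j. \<Sum>s\<in>S. c s * A s j"] left_diff_distrib sum_subtractf ..
  ultimately show ?thesis by simp
qed

lemma ldet_add:
  "ldet k (\<lambda>i j. A i j + B i j) = (\<Sum>S\<in>Pow {..<k}. ldet k (\<lambda>i. if i \<in> S then A i else B i))"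
proof -
  have "(\<Prod>i<k. (if i \<in> S then A i else B i) (p i)) = (\<Prod>i\<in>S. A i (p i)) * (\<Prod>i\<in>{..<k} - S. B i (p i))"
    if "S \<in> Pow {..<k}" for S p
  proof -
    have "{..<k} \<inter> S = S" "{..<k} \<inter> - S = {..<k} - S" using that by auto
    then show ?thesis by (simp add: if_distribR prod.If_cases)
  qed
  then have "(\<Sum>S\<in>Pow {..<k}. ldet k (\<lambda>i. if i \<in> S then A i else B i))
     = (\<Sum>S\<in>Pow {..<k}. \<Sum>p | p permutes {..<k}. of_int (sign p) *
          ((\<Prod>i\<in>S. A i (p i)) * (\<Prod>i\<in>{..<k} - S. B i (p i))))"
    unfolding ldet_def by (intro sum.cong refl) simp
  also have "\<dots> = (\<Sum>p | p permutes {..<k}. of_int (sign p) * (\<Prod>i<k. A i (p i) + B i (p i)))"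
    by (subst sum.swap) (simp add: prod_add sum_distrib_left)
  finally show ?thesis by (simp add: ldet_def)
qed

lemma sign_transpose_comp:
  assumes "finite S" "q permutes S" "a \<noteq> b"
  shows "sign (Transposition.transpose a b \<circ> q) = - sign q"
proof -
  have "permutation q" using assms permutation_permutes by blast
  then show ?thesis using assms(3) by (simp add: sign_compose permutation_swap_id sign_swap_id)
qed

lemma prod_transpose_comp:
  fixes k :: nat
  assumes "q permutes {..<k}"
  shows "(\<Prod>i<k. A ((Transposition.transpose k a \<circ> q) i) i) = (\<Prod>i<k. (A(a := A k)) (q i) i)"
proof (intro prod.cong refl)
  fix i assume "i \<in> {..<k}"
  then have "q i \<noteq> k" using permutes_lessThan_iff[OF assms, of i] by auto
  then show "A ((Transposition.transpose k a \<circ> q) i) i = (A(a := A k)) (q i) i"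
    by (auto simp: Transposition.transpose_def)
qed

lemma ldet_bordered:
  "ldet (Suc k) A = A k k * ldet k A - (\<Sum>a<k. A a k * ldet k (A(a := A k)))"
proof -
  let ?swap = "Transposition.transpose k"
  let ?term = "\<lambda>\<sigma>. of_int (sign \<sigma>) * (\<Prod>i<Suc k. A (\<sigma> i) i)"
  have corner: "(\<Sum>q | q permutes {..<k}. ?term (?swap k \<circ> q)) = A k k * ldet k A"
  proof -
    have term_eq: "?term (?swap k \<circ> q) = A k k * (of_int (sign q) * (\<Prod>i<k. A (q i) i))"
      if "q permutes {..<k}" for q
      using permutes_not_in[OF that, of k] by (simp add: mult_ac)
    then have "(\<Sum>q | q permutes {..<k}. ?term (?swap k \<circ> q)) = A k k * ldet k (\<lambda>i j. A j i)"
      unfolding ldet_def sum_distrib_left by (intro sum.cong refl term_eq) simp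
    then show ?thesis by (simp only: ldet_transpose[of k A])
  qed
  have border: "(\<Sum>q | q permutes {..<k}. ?term (?swap a \<circ> q)) = - (A a k * ldet k (A(a := A k)))"
    if "a < k" for a
  proof -
    have term_eq: "?term (?swap a \<circ> q) = - (A a k * (of_int (sign q) * (\<Prod>i<k. (A(a := A k)) (q i) i)))"
      if q: "q permutes {..<k}" for q
    proof -
      have "A ((?swap a \<circ> q) k) k = A a k"
        using permutes_not_in[OF q, of k] by simp
      moreover have "sign (?swap a \<circ> q) = - sign q"
        using \<open>a < k\<close> by (intro sign_transpose_comp[OF _ q]) auto
      ultimately show ?thesis
        by (simp only: prod.lessThan_Suc of_int_minus prod_transpose_comp[OF q]) (simp add: mult_ac)
    qed
    then have "(\<Sum>q | q permutes {..<k}. ?term (?swap a \<circ> q)) = - (A a k * ldet k (\<lambda>i j. (A(a := A k)) j i))"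
      unfolding ldet_def sum_distrib_left sum_negf[symmetric] by (intro sum.cong refl term_eq) simp
    then show ?thesis by (simp only: ldet_transpose[of k "A(a := A k)"])
  qed
  have "ldet (Suc k) A = ldet (Suc k) (\<lambda>i j. A j i)"
    by (rule ldet_transpose[symmetric])
  also have "\<dots> = (\<Sum>a\<in>insert k {..<k}. \<Sum>q | q permutes {..<k}. ?term (?swap a \<circ> q))"
    unfolding ldet_def lessThan_Suc[of k] by (subst sum_over_permutations_insert) auto
  also have "\<dots> = A k k * ldet k A + (\<Sum>a<k. - (A a k * ldet k (A(a := A k))))"
    by (subst sum.insert) (simp_all add: corner border del: prod.lessThan_Suc transpose_same comp_apply)
  finally show ?thesis by (simp add: sum_negf)
qed

definition row_inner :: "nat \<Rightarrow> (nat \<Rightarrow> complex) \<Rightarrow> (nat \<Rightarrow> complex) \<Rightarrow> complex" where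
  "row_inner k u v = (\<Sum>b<k. u b * cnj (v b))"

lemma row_inner_self: "row_inner k u u = of_real (\<Sum>b<k. (cmod (u b))\<^sup>2)"
  by (simp add: row_inner_def complex_norm_square del: of_real_power)

lemma row_inner_commute: "row_inner k v u = cnj (row_inner k u v)"
  by (simp add: row_inner_def mult.commute)

lemma row_inner_diff_left: "row_inner k (\<lambda>b. u b - v b) w = row_inner k u w - row_inner k v w"
  by (simp add: row_inner_def algebra_simps sum_subtractf)

lemma row_inner_sum_left:
  "row_inner k (\<lambda>b. \<Sum>s\<in>S. c s * u s b) w = (\<Sum>s\<in>S. c s * row_inner k (u s) w)"
  unfolding row_inner_def sum_distrib_right sum_distrib_left by (subst sum.swap) (simp add: mult_ac)

lemma row_inner_eq_0_if_self_eq_0: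
  assumes "row_inner k u u = 0" shows "row_inner k u v = 0"
proof -
  have "(\<Sum>b<k. (cmod (u b))\<^sup>2) = 0" using assms unfolding row_inner_self of_real_eq_0_iff .
  then have "\<forall>b\<in>{..<k}. (cmod (u b))\<^sup>2 = 0" by (subst (asm) sum_nonneg_eq_0_iff) auto
  then show ?thesis by (simp add: row_inner_def)
qed

lemma row_inner_pythagoras:
  assumes "row_inner k u v = 0"
  shows "(\<Sum>b<k. (cmod (u b + v b))\<^sup>2) = (\<Sum>b<k. (cmod (u b))\<^sup>2) + (\<Sum>b<k. (cmod (v b))\<^sup>2)"
proof -
  have "row_inner k (\<lambda>b. u b + v b) (\<lambda>b. u b + v b)
      = row_inner k u u + row_inner k v v + (row_inner k u v + row_inner k v u)"
    by (simp add: row_inner_def algebra_simps sum.distrib)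
  also have "\<dots> = row_inner k u u + row_inner k v v"
    using assms row_inner_commute[of k v u] by simp
  finally have "complex_of_real (\<Sum>b<k. (cmod (u b + v b))\<^sup>2)
      = of_real ((\<Sum>b<k. (cmod (u b))\<^sup>2) + (\<Sum>b<k. (cmod (v b))\<^sup>2))"
    unfolding row_inner_self by simp
  then show ?thesis by (simp only: of_real_eq_iff)
qed

lemma orthogonal_remainder:
  assumes "finite S" and orthogonal: "\<And>s t. s \<in> S \<Longrightarrow> t \<in> S \<Longrightarrow> s \<noteq> t \<Longrightarrow> row_inner k (u s) (u t) = 0"
  obtains c where "\<And>t. t \<in> S \<Longrightarrow> row_inner k (\<lambda>b. v b - (\<Sum>s\<in>S. c s * u s b)) (u t) = 0"
    and "(\<Sum>b<k. (cmod (v b - (\<Sum>s\<in>S. c s * u s b)))\<^sup>2) \<le> (\<Sum>b<k. (cmod (v b))\<^sup>2)"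
proof
  define c where "c s = row_inner k v (u s) / row_inner k (u s) (u s)" for s
  define proj where "proj b = (\<Sum>s\<in>S. c s * u s b)" for b
  define rest where "rest b = v b - proj b" for b
  have "row_inner k proj (u t) = row_inner k v (u t)" if "t \<in> S" for t
  proof -
    have "row_inner k proj (u t) = (\<Sum>s\<in>S. c s * row_inner k (u s) (u t))"
      unfolding proj_def by (rule row_inner_sum_left)
    also have "\<dots> = (\<Sum>s\<in>{t}. c s * row_inner k (u s) (u t))"
      using that assms by (intro sum.mono_neutral_right) auto
    also have "\<dots> = row_inner k v (u t)"
      using row_inner_eq_0_if_self_eq_0[of k "u t" v] row_inner_commute[of k v "u t"]
      by (auto simp: c_def)
    finally show ?thesis .
  qed
  then have rest_orthogonal: "row_inner k rest (u t) = 0" if "t \<in> S" for t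
    using that unfolding rest_def row_inner_diff_left by simp
  then show "row_inner k (\<lambda>b. v b - (\<Sum>s\<in>S. c s * u s b)) (u t) = 0" if "t \<in> S" for t
    using that unfolding rest_def proj_def .
  have "row_inner k proj rest = 0"
    unfolding proj_def row_inner_sum_left using rest_orthogonal row_inner_commute[of k rest] by simp
  from row_inner_pythagoras[OF this]
  show "(\<Sum>b<k. (cmod (v b - (\<Sum>s\<in>S. c s * u s b)))\<^sup>2) \<le> (\<Sum>b<k. (cmod (v b))\<^sup>2)"
    by (simp add: rest_def sum_nonneg flip: proj_def)
qed

lemma ldet_gram: "ldet k (\<lambda>i j. row_inner k (A i) (A j)) = ldet k A * cnj (ldet k A)"
proof -
  define M where "M = Matrix.mat k k (\<lambda>(i, j). A i j)"
  define N where "N = Matrix.mat k k (\<lambda>(i, j). cnj (A j i))"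
  have "M * N = Matrix.mat k k (\<lambda>(i, j). row_inner k (A i) (A j))"
    unfolding M_def N_def row_inner_def
    by (intro eq_matI) (auto simp: scalar_prod_def lessThan_atLeast0)
  then have "ldet k (\<lambda>i j. row_inner k (A i) (A j)) = Determinant.det M * Determinant.det N"
    unfolding ldet_eq_det by (subst Determinant.det_mult[symmetric, where n=k]) (auto simp: M_def N_def)
  also have "Determinant.det N = ldet k (\<lambda>i j. cnj (A j i))" by (simp add: ldet_eq_det N_def)
  also have "\<dots> = ldet k (\<lambda>i j. cnj (A i j))" by (rule ldet_transpose)
  also have "\<dots> = cnj (ldet k A)" by (simp add: ldet_def)
  finally show ?thesis by (simp add: M_def ldet_eq_det)
qed

lemma ldet_diagonal:
  assumes "\<And>i j. i < k \<Longrightarrow> j < k \<Longrightarrow> i \<noteq> j \<Longrightarrow> A i j = 0"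
  shows "ldet k A = (\<Prod>i<k. A i i)"
proof -
  have "ldet k A = Determinant.det (Matrix.mat k k (\<lambda>(i, j). A i j))" by (rule ldet_eq_det)
  also have "\<dots> = prod_list (diag_mat (Matrix.mat k k (\<lambda>(i, j). A i j)))"
    by (rule det_upper_triangular[of _ k]) (use assms in \<open>auto simp: upper_triangular_def\<close>)
  also have "\<dots> = (\<Prod>i<k. A i i)"
    by (simp add: prod_list_diag_prod lessThan_atLeast0)
  finally show ?thesis .
qed

lemma hadamard_equality_if_orthogonal_rows:
  assumes "\<And>a b. a < k \<Longrightarrow> b < k \<Longrightarrow> a \<noteq> b \<Longrightarrow> row_inner k (A a) (A b) = 0"
  shows "(cmod (ldet k A))\<^sup>2 = (\<Prod>a<k. \<Sum>b<k. (cmod (A a b))\<^sup>2)"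
proof -
  have "ldet k A * cnj (ldet k A) = (\<Prod>a<k. row_inner k (A a) (A a))"
    unfolding ldet_gram[symmetric] by (rule ldet_diagonal) (rule assms)
  then have "complex_of_real ((cmod (ldet k A))\<^sup>2) = of_real (\<Prod>a<k. \<Sum>b<k. (cmod (A a b))\<^sup>2)"
    by (simp add: complex_norm_square row_inner_self del: of_real_power of_real_sum)
  then show ?thesis by (simp only: of_real_eq_iff)
qed

text \<open>Gram--Schmidt one row at a time: \<open>m\<close> counts the rows already orthogonalised.\<close>

lemma hadamard_inequality_partially_orthogonal:
  assumes "m \<le> k" "\<And>a b. a < m \<Longrightarrow> b < m \<Longrightarrow> a \<noteq> b \<Longrightarrow> row_inner k (A a) (A b) = 0"
  shows "(cmod (ldet k A))\<^sup>2 \<le> (\<Prod>a<k. \<Sum>b<k. (cmod (A a b))\<^sup>2)"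
  using assms
proof (induction "k - m" arbitrary: m A)
  case 0
  then have "m = k" by simp
  then show ?case using hadamard_equality_if_orthogonal_rows[of k A] 0 by simp
next
  case (Suc d)
  then have "m < k" by simp
  obtain c where orthogonal: "\<And>t. t < m \<Longrightarrow> row_inner k (\<lambda>b. A m b - (\<Sum>s<m. c s * A s b)) (A t) = 0"
    and shorter: "(\<Sum>b<k. (cmod (A m b - (\<Sum>s<m. c s * A s b)))\<^sup>2) \<le> (\<Sum>b<k. (cmod (A m b))\<^sup>2)"
    using orthogonal_remainder[of "{..<m}" k A "A m"] Suc.prems(2) by auto
  have subset: "{..<m} \<subseteq> {..<k} - {m}" using \<open>m < k\<close> by auto
  let ?B = "A(m := \<lambda>b. A m b - (\<Sum>s<m. c s * A s b))"
  have "(cmod (ldet k ?B))\<^sup>2 \<le> (\<Prod>a<k. \<Sum>b<k. (cmod (?B a b))\<^sup>2)"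
  proof (rule Suc.hyps(1))
    show "d = k - Suc m" "Suc m \<le> k" using Suc.hyps(2) \<open>m < k\<close> by auto
    show "row_inner k (?B a) (?B b) = 0" if "a < Suc m" "b < Suc m" "a \<noteq> b" for a b
      using that Suc.prems(2)[of a b] orthogonal[of a] orthogonal[of b]
        row_inner_commute[of k "?B m" "A a"]
      by (auto simp: less_Suc_eq)
  qed
  also have "\<dots> \<le> (\<Prod>a<k. \<Sum>b<k. (cmod (A a b))\<^sup>2)"
    using shorter by (intro prod_mono) (auto simp: sum_nonneg)
  finally show ?case
    unfolding ldet_subtract_other_rows[OF \<open>m < k\<close> subset] .
qed

lemma cmod_ldet_le_hadamard:
  assumes "\<And>a b. a < k \<Longrightarrow> b < k \<Longrightarrow> cmod (A a b) \<le> R b" "\<And>b. b < k \<Longrightarrow> 0 \<le> R b"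
  shows "cmod (ldet k A) \<le> sqrt (real k ^ k) * (\<Prod>b<k. R b)"
proof (rule power2_le_imp_le)
  have "(cmod (ldet k A))\<^sup>2 = (cmod (ldet k (\<lambda>i j. A j i)))\<^sup>2"
    by (simp only: ldet_transpose[of k A])
  also have "\<dots> \<le> (\<Prod>b<k. \<Sum>a<k. (cmod (A a b))\<^sup>2)"
    by (rule hadamard_inequality_partially_orthogonal[of 0]) auto
  also have "\<dots> \<le> (\<Prod>b<k. \<Sum>a<k. (R b)\<^sup>2)"
    using assms by (intro prod_mono conjI sum_nonneg sum_mono power_mono) auto
  also have "\<dots> = (\<Prod>b<k. real k) * (\<Prod>b<k. (R b)\<^sup>2)"
    unfolding prod.distrib[symmetric] by simp
  also have "\<dots> = (sqrt (real k ^ k) * (\<Prod>b<k. R b))\<^sup>2"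
    by (simp add: power_mult_distrib prod_power_distrib[symmetric])
  finally show "(cmod (ldet k A))\<^sup>2 \<le> (sqrt (real k ^ k) * (\<Prod>b<k. R b))\<^sup>2" .
qed (use assms in \<open>auto intro!: mult_nonneg_nonneg prod_nonneg\<close>)

section \<open>Summability\<close>

lemma power_self_le_exp_mult_fact: "real p ^ p \<le> exp (real p) * fact p"
proof -
  have "(\<Sum>n\<in>{p}. real p ^ n /\<^sub>R fact n) \<le> (\<Sum>n. real p ^ n /\<^sub>R fact n)"
    by (rule sum_le_suminf[OF summable_exp_generic]) auto
  then show ?thesis by (simp add: exp_def divide_simps)
qed

lemma summable_power_div_sqrt_fact: "summable (\<lambda>p. x ^ p / sqrt (fact p))" for x :: real
proof (rule summable_ratio_test[where c="1/2" and N="nat \<lceil>4 * x\<^sup>2\<rceil>"])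
  fix p assume "nat \<lceil>4 * x\<^sup>2\<rceil> \<le> p"
  then have "(2 * \<bar>x\<bar>)\<^sup>2 \<le> real (Suc p)" by (simp add: power_mult_distrib nat_le_iff ceiling_le_iff)
  then have "2 * \<bar>x\<bar> \<le> sqrt (real (Suc p))" by (rule real_le_rsqrt)
  then have "\<bar>x\<bar> / sqrt (real (Suc p)) \<le> 1 / 2" by (simp add: field_simps)
  then have "\<bar>x\<bar> / sqrt (real (Suc p)) * (\<bar>x\<bar> ^ p / sqrt (fact p)) \<le> 1 / 2 * (\<bar>x\<bar> ^ p / sqrt (fact p))"
    by (intro mult_right_mono) auto
  then show "norm (x ^ Suc p / sqrt (fact (Suc p))) \<le> 1 / 2 * norm (x ^ p / sqrt (fact p))"
    by (simp add: norm_mult norm_power real_sqrt_mult abs_mult power_abs del: of_nat_Suc)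
qed simp

lemma summable_hadamard_series:
  fixes x :: real
  assumes "0 \<le> x"
  shows "summable (\<lambda>p. x ^ p * sqrt (real p ^ p) / fact p)"
proof (rule summable_comparison_test'[where N=0])
  show "summable (\<lambda>p. (x * sqrt (exp 1)) ^ p / sqrt (fact p))"
    by (rule summable_power_div_sqrt_fact)
  fix p
  have "sqrt (real p ^ p) \<le> sqrt (exp 1 ^ p * fact p)"
    using power_self_le_exp_mult_fact[of p] by (simp add: exp_of_nat_mult[symmetric])
  then have "x ^ p * sqrt (real p ^ p) / fact p \<le> x ^ p * sqrt (exp 1 ^ p * fact p) / fact p"
    using assms by (intro divide_right_mono mult_left_mono) auto
  also have "\<dots> = (x * sqrt (exp 1)) ^ p / sqrt (fact p)"
    by (simp add: real_sqrt_mult real_sqrt_power power_mult_distrib divide_simps)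
  finally show "norm (x ^ p * sqrt (real p ^ p) / fact p) \<le> (x * sqrt (exp 1)) ^ p / sqrt (fact p)"
    using assms by simp
qed

lemma sums_rows_and_antidiagonals:
  fixes t :: "nat \<Rightarrow> nat \<Rightarrow> 'a::banach"
  assumes triangular: "\<And>p q. p < q \<Longrightarrow> t p q = 0"
    and row_bound: "\<And>p. (\<Sum>q\<le>p. norm (t p q)) \<le> b p" and "summable b"
  shows "\<exists>D. (\<lambda>p. \<Sum>q\<le>p. t p q) sums D \<and> (\<lambda>m. \<Sum>q\<le>m. t (m - q) q) sums D"
proof -
  let ?S = "SIGMA p:UNIV. {..p::nat}"
  have "Infinite_Sum.abs_summable_on (\<lambda>(p, q). t p q) ?S"
    unfolding Infinite_Sum.abs_summable_on_Sigma_iff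
  proof (intro conjI ballI)
    have "summable (\<lambda>p. norm (norm (\<Sum>\<^sub>\<infinity>q\<in>{..p}. norm (t p q))))"
      using row_bound by (intro summable_comparison_test'[OF \<open>summable b\<close>, where N=0]) (simp add: sum_nonneg)
    then show "Infinite_Sum.abs_summable_on (\<lambda>p. \<Sum>\<^sub>\<infinity>q\<in>{..p}. norm (case (p, q) of (p, q) \<Rightarrow> t p q)) UNIV"
      by (simp add: norm_summable_imp_summable_on)
  qed auto
  then obtain D where D: "((\<lambda>(p, q). t p q) has_sum D) ?S"
    using Infinite_Sum.abs_summable_summable summable_on_def by blast
  have "((\<lambda>p. \<Sum>q\<le>p. t p q) has_sum D) UNIV"
    by (rule has_sum_SigmaD[OF D]) (auto intro!: has_sum_finiteI)
  moreover have "((\<lambda>(m, q). t (m - q) q) has_sum D) {(m, q). 2 * q \<le> m}"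
    using D by (subst has_sum_reindex_bij_witness[where j="\<lambda>(m, q). (m - q, q)" and i="\<lambda>(p, q). (p + q, q)"
          and T="?S" and h="\<lambda>(p, q). t p q"]) auto
  then have "((\<lambda>(m, q). t (m - q) q) has_sum D) ?S"
    by (subst has_sum_cong_neutral[where T="{(m, q). 2 * q \<le> m}" and g="\<lambda>(m, q). t (m - q) q"])
       (auto intro: triangular)
  then have "((\<lambda>m. \<Sum>q\<le>m. t (m - q) q) has_sum D) UNIV"
    by (rule has_sum_SigmaD) (auto intro!: has_sum_finiteI)
  ultimately show ?thesis by (blast intro: has_sum_imp_sums)
qed

section \<open>Fredholm kernels on a measure space\<close>

definition fredholm_kernel :: "'x measure \<Rightarrow> ('x \<Rightarrow> 'x \<Rightarrow> complex) \<Rightarrow> bool" where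
  "fredholm_kernel M G \<longleftrightarrow> (\<lambda>(x, y). G x y) \<in> borel_measurable (M \<Otimes>\<^sub>M M) \<and>
     (\<exists>h. integrable M h \<and> (\<forall>x\<in>space M. \<forall>y\<in>space M. cmod (G x y) \<le> h y))"

definition kernel_comp :: "'x measure \<Rightarrow> ('x \<Rightarrow> 'x \<Rightarrow> complex) \<Rightarrow> ('x \<Rightarrow> 'x \<Rightarrow> complex) \<Rightarrow> 'x \<Rightarrow> 'x \<Rightarrow> complex"
  where "kernel_comp M G H x y = (\<integral>z. G x z * H z y \<partial>M)"

definition restrict_rows :: "'x set \<Rightarrow> ('x \<Rightarrow> 'y \<Rightarrow> complex) \<Rightarrow> 'x \<Rightarrow> 'y \<Rightarrow> complex" where
  "restrict_rows Y G x y = (if x \<in> Y then G x y else 0)"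

lemma fredholm_kernelI:
  assumes "(\<lambda>(x, y). G x y) \<in> borel_measurable (M \<Otimes>\<^sub>M M)" "integrable M h"
    "\<And>x y. x \<in> space M \<Longrightarrow> y \<in> space M \<Longrightarrow> cmod (G x y) \<le> h y"
  shows "fredholm_kernel M G"
  using assms unfolding fredholm_kernel_def by blast

lemma fredholm_kernel_measurable:
  assumes "fredholm_kernel M G" "f \<in> N \<rightarrow>\<^sub>M M" "g \<in> N \<rightarrow>\<^sub>M M"
  shows "(\<lambda>w. G (f w) (g w)) \<in> borel_measurable N"
proof -
  have "(\<lambda>(x, y). G x y) \<in> borel_measurable (M \<Otimes>\<^sub>M M)"
    using assms(1) unfolding fredholm_kernel_def by blast
  from measurable_compose[OF measurable_Pair[OF assms(2,3)] this] show ?thesis by simp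
qed

lemma fredholm_kernel_bound:
  assumes "fredholm_kernel M G"
  obtains h where "integrable M h" "\<And>y. 0 \<le> h y" "\<And>x y. x \<in> space M \<Longrightarrow> y \<in> space M \<Longrightarrow> cmod (G x y) \<le> h y"
proof -
  obtain h where "integrable M h" "\<forall>x\<in>space M. \<forall>y\<in>space M. cmod (G x y) \<le> h y"
    using assms unfolding fredholm_kernel_def by blast
  then show thesis
    by (intro that[of "\<lambda>y. \<bar>h y\<bar>"]) (auto intro: order_trans[OF _ abs_ge_self])
qed

lemma fredholm_kernels_common_bound:
  assumes "finite S" "\<And>s. s \<in> S \<Longrightarrow> fredholm_kernel M (Gs s)"
  obtains h where "integrable M h" "\<And>y. 0 \<le> h y"
    "\<And>s x y. s \<in> S \<Longrightarrow> x \<in> space M \<Longrightarrow> y \<in> space M \<Longrightarrow> cmod (Gs s x y) \<le> h y"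
proof -
  have "\<exists>h. integrable M h \<and> (\<forall>y. 0 \<le> h y) \<and> (\<forall>x\<in>space M. \<forall>y\<in>space M. cmod (Gs s x y) \<le> h y)"
    if "s \<in> S" for s
    using fredholm_kernel_bound[OF assms(2)[OF that]] by metis
  then obtain g where g: "\<And>s. s \<in> S \<Longrightarrow> integrable M (g s)" "\<And>s y. s \<in> S \<Longrightarrow> 0 \<le> g s y"
    "\<And>s x y. s \<in> S \<Longrightarrow> x \<in> space M \<Longrightarrow> y \<in> space M \<Longrightarrow> cmod (Gs s x y) \<le> g s y"
    by metis
  show ?thesis
  proof
    show "integrable M (\<lambda>y. \<Sum>s\<in>S. g s y)" using g(1) by auto
    show "0 \<le> (\<Sum>s\<in>S. g s y)" for y using g(2) by (simp add: sum_nonneg)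
    fix s x y assume "s \<in> S" "x \<in> space M" "y \<in> space M"
    then have "cmod (Gs s x y) \<le> g s y" by (rule g(3))
    also have "\<dots> \<le> (\<Sum>s\<in>S. g s y)"
      using \<open>s \<in> S\<close> assms(1) g(2) by (intro member_le_sum) auto
    finally show "cmod (Gs s x y) \<le> (\<Sum>s\<in>S. g s y)" .
  qed
qed

lemma fredholm_kernel_add:
  assumes G: "fredholm_kernel M G" and H: "fredholm_kernel M H"
  shows "fredholm_kernel M (\<lambda>x y. G x y + H x y)"
proof -
  obtain g h where bounds: "integrable M g" "integrable M h"
    "\<And>x y. x \<in> space M \<Longrightarrow> y \<in> space M \<Longrightarrow> cmod (G x y) \<le> g y"
    "\<And>x y. x \<in> space M \<Longrightarrow> y \<in> space M \<Longrightarrow> cmod (H x y) \<le> h y"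
    using fredholm_kernel_bound[OF G] fredholm_kernel_bound[OF H] by metis
  show ?thesis
  proof (rule fredholm_kernelI[where h="\<lambda>y. g y + h y"])
    show "(\<lambda>(x, y). G x y + H x y) \<in> borel_measurable (M \<Otimes>\<^sub>M M)"
      using G H unfolding fredholm_kernel_def case_prod_beta by (intro borel_measurable_add) auto
  qed (use bounds in \<open>auto intro: norm_triangle_mono\<close>)
qed

lemma fredholm_kernel_cong:
  assumes "fredholm_kernel M H" and eq: "\<And>x y. x \<in> space M \<Longrightarrow> y \<in> space M \<Longrightarrow> G x y = H x y"
  shows "fredholm_kernel M G"
proof -
  have "(\<lambda>(x, y). G x y) \<in> borel_measurable (M \<Otimes>\<^sub>M M) \<longleftrightarrow> (\<lambda>(x, y). H x y) \<in> borel_measurable (M \<Otimes>\<^sub>M M)"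
    by (rule measurable_cong) (auto simp: space_pair_measure eq)
  then show ?thesis using assms(1) by (simp add: fredholm_kernel_def eq)
qed

lemma fredholm_kernel_scale:
  assumes "fredholm_kernel M G" shows "fredholm_kernel M (\<lambda>x y. z * G x y)"
proof -
  obtain h where h: "integrable M h" "\<And>x y. x \<in> space M \<Longrightarrow> y \<in> space M \<Longrightarrow> cmod (G x y) \<le> h y"
    using fredholm_kernel_bound[OF assms] by metis
  show ?thesis
  proof (rule fredholm_kernelI)
    show "(\<lambda>(x, y). z * G x y) \<in> borel_measurable (M \<Otimes>\<^sub>M M)"
      using assms unfolding fredholm_kernel_def case_prod_beta by (intro borel_measurable_times) auto
    show "integrable M (\<lambda>y. cmod z * h y)" using h(1) by simp
  qed (use h(2) in \<open>simp add: norm_mult mult_left_mono\<close>)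
qed

lemma fredholm_kernel_zero: "fredholm_kernel M (\<lambda>x y. 0)"
  by (rule fredholm_kernelI[where h="\<lambda>_. 0"]) auto

lemma fredholm_kernel_sum:
  assumes "finite S" "\<And>s. s \<in> S \<Longrightarrow> fredholm_kernel M (Gs s)"
  shows "fredholm_kernel M (\<lambda>x y. \<Sum>s\<in>S. Gs s x y)"
  using assms by (induction S rule: finite_induct) (simp_all add: fredholm_kernel_zero fredholm_kernel_add)

lemma fredholm_kernel_if:
  assumes "fredholm_kernel M G" and [measurable]: "Measurable.pred (M \<Otimes>\<^sub>M M) (\<lambda>(x, y). P x y)"
  shows "fredholm_kernel M (\<lambda>x y. if P x y then G x y else 0)"
proof -
  obtain h where h: "integrable M h" "\<And>y. 0 \<le> h y"
    "\<And>x y. x \<in> space M \<Longrightarrow> y \<in> space M \<Longrightarrow> cmod (G x y) \<le> h y"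
    using fredholm_kernel_bound[OF assms(1)] by metis
  have [measurable]: "(\<lambda>(x, y). G x y) \<in> borel_measurable (M \<Otimes>\<^sub>M M)"
    using assms(1) unfolding fredholm_kernel_def by blast
  have "(\<lambda>p. if case_prod P p then case_prod G p else 0) \<in> borel_measurable (M \<Otimes>\<^sub>M M)"
    by measurable
  then have "(\<lambda>(x, y). if P x y then G x y else 0) \<in> borel_measurable (M \<Otimes>\<^sub>M M)"
    by (simp add: case_prod_beta')
  then show ?thesis
    by (rule fredholm_kernelI[OF _ h(1)]) (use h in auto)
qed

lemma fredholm_kernel_restrict_rows:
  assumes "fredholm_kernel M G" "Y \<inter> space M \<in> sets M"
  shows "fredholm_kernel M (restrict_rows Y G)"
  unfolding restrict_rows_def
proof (rule fredholm_kernel_if[OF assms(1)])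
  have "{x \<in> space M. x \<in> Y} \<in> sets M" using assms(2) by (simp add: Int_def conj_commute)
  then have "Measurable.pred M (\<lambda>x. x \<in> Y)" by (simp add: Measurable.pred_def)
  then show "Measurable.pred (M \<Otimes>\<^sub>M M) (\<lambda>(x, y). x \<in> Y)"
    unfolding case_prod_beta by (rule measurable_compose[OF measurable_fst])
qed

lemma integrable_diagonal:
  assumes "fredholm_kernel M G"
  shows "integrable M (\<lambda>z. G z z)"
proof -
  obtain h where h: "integrable M h" "\<And>y. 0 \<le> h y"
    "\<And>x y. x \<in> space M \<Longrightarrow> y \<in> space M \<Longrightarrow> cmod (G x y) \<le> h y"
    using fredholm_kernel_bound[OF assms] by metis
  show ?thesis
  proof (rule Bochner_Integration.integrable_bound[OF h(1)])
    show "(\<lambda>z. G z z) \<in> borel_measurable M" by (intro fredholm_kernel_measurable[OF assms]) auto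
    show "AE z in M. norm (G z z) \<le> norm (h z)" using h by (intro AE_I2) auto
  qed
qed

lemma integrable_kernel_comp:
  assumes G: "fredholm_kernel M G" and H: "fredholm_kernel M H" and "x \<in> space M" "y \<in> space M"
  shows "integrable M (\<lambda>z. G x z * H z y)"
proof -
  obtain g h where bounds: "integrable M g" "\<And>z. 0 \<le> g z" "\<And>y. 0 \<le> h y"
    "\<And>x y. x \<in> space M \<Longrightarrow> y \<in> space M \<Longrightarrow> cmod (G x y) \<le> g y"
    "\<And>x y. x \<in> space M \<Longrightarrow> y \<in> space M \<Longrightarrow> cmod (H x y) \<le> h y"
    using fredholm_kernel_bound[OF G] fredholm_kernel_bound[OF H] by metis
  show ?thesis
  proof (rule Bochner_Integration.integrable_bound)
    show "integrable M (\<lambda>z. g z * h y)" using bounds(1) by simp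
    show "(\<lambda>z. G x z * H z y) \<in> borel_measurable M"
      using assms by (intro borel_measurable_times fredholm_kernel_measurable[of M]) auto
    show "AE z in M. norm (G x z * H z y) \<le> norm (g z * h y)"
      using bounds assms(3,4) by (intro AE_I2) (auto simp: norm_mult intro!: mult_mono)
  qed
qed

lemma integral_norm_le_majorant:
  fixes f :: "'a \<Rightarrow> 'b::{banach, second_countable_topology}"
  assumes "integrable M f" "integrable M g" "\<And>x. x \<in> space M \<Longrightarrow> norm (f x) \<le> g x"
  shows "norm (integral\<^sup>L M f) \<le> integral\<^sup>L M g"
  by (rule order_trans[OF integral_norm_bound integral_mono]) (use assms in auto)

definition fredholm_integral :: "'x measure \<Rightarrow> nat \<Rightarrow> (nat \<Rightarrow> 'x \<Rightarrow> 'x \<Rightarrow> complex) \<Rightarrow> complex" where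
  "fredholm_integral M k Gs = (\<integral>\<xi>. ldet k (\<lambda>a b. Gs a (\<xi> a) (\<xi> b)) \<partial>PiM {..<k} (\<lambda>_. M))"

definition fredholm_coeff :: "'x measure \<Rightarrow> ('x \<Rightarrow> 'x \<Rightarrow> complex) \<Rightarrow> nat \<Rightarrow> complex" where
  "fredholm_coeff M G k = (-1) ^ k / fact k * fredholm_integral M k (\<lambda>_. G)"

lemma fredholm_integral_cong:
  assumes "\<And>\<xi>. \<xi> \<in> {..<k} \<rightarrow>\<^sub>E space M \<Longrightarrow>
     ldet k (\<lambda>a b. Gs a (\<xi> a) (\<xi> b)) = ldet k (\<lambda>a b. Hs a (\<xi> a) (\<xi> b))"
  shows "fredholm_integral M k Gs = fredholm_integral M k Hs"
  unfolding fredholm_integral_def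
  by (intro Bochner_Integration.integral_cong refl assms) (simp add: space_PiM)

lemma fredholm_integral_cong_slots:
  assumes "\<And>a. a < k \<Longrightarrow> Gs a = Hs a"
  shows "fredholm_integral M k Gs = fredholm_integral M k Hs"
  using assms by (intro fredholm_integral_cong ldet_cong) auto

lemma fredholm_integral_zero_slot:
  assumes "a < k" "\<And>x y. Gs a x y = 0"
  shows "fredholm_integral M k Gs = 0"
proof -
  have "ldet k (\<lambda>a b. Gs a (\<xi> a) (\<xi> b)) = 0" for \<xi>
    by (rule ldet_zero_row[OF assms(1)]) (simp add: assms(2))
  then show ?thesis by (simp add: fredholm_integral_def)
qed

lemma fredholm_coeff_cong:
  assumes "\<And>x y. x \<in> space M \<Longrightarrow> y \<in> space M \<Longrightarrow> G x y = H x y"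
  shows "fredholm_coeff M G = fredholm_coeff M H"
  unfolding fredholm_coeff_def
  by (intro ext arg_cong2[where f="(*)"] refl fredholm_integral_cong ldet_cong assms) auto

lemma measurable_ldet_kernels:
  assumes "\<And>a b. a < k \<Longrightarrow> b < k \<Longrightarrow> fredholm_kernel M (Ks a b)"
  shows "(\<lambda>\<xi>. ldet k (\<lambda>a b. Ks a b (\<xi> a) (\<xi> b))) \<in> borel_measurable (PiM {..<k} (\<lambda>_. M))"
  unfolding ldet_def
proof (intro borel_measurable_sum borel_measurable_times borel_measurable_const borel_measurable_prod)
  fix p a assume "p \<in> {p. p permutes {..<k}}" "a \<in> {..<k}"
  then show "(\<lambda>\<xi>. Ks a (p a) (\<xi> a) (\<xi> (p a))) \<in> borel_measurable (PiM {..<k} (\<lambda>_. M))"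
    using assms by (intro fredholm_kernel_measurable[of M] measurable_component_singleton)
      (auto simp: permutes_lessThan_iff)
qed

lemma cmod_fredholm_integrand_le:
  assumes "\<And>a x y. a < k \<Longrightarrow> x \<in> space M \<Longrightarrow> y \<in> space M \<Longrightarrow> cmod (Gs a x y) \<le> h y" "\<And>y. 0 \<le> h y"
    and "\<xi> \<in> space (PiM {..<k} (\<lambda>_. M))"
  shows "cmod (ldet k (\<lambda>a b. Gs a (\<xi> a) (\<xi> b))) \<le> sqrt (real k ^ k) * (\<Prod>b<k. h (\<xi> b))"
  using assms by (intro cmod_ldet_le_hadamard) (auto simp: space_PiM PiE_iff)

context sigma_finite_measure
begin

lemma fredholm_kernel_comp:
  assumes G: "fredholm_kernel M G" and H: "fredholm_kernel M H"
  shows "fredholm_kernel M (kernel_comp M G H)"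
proof -
  obtain g h where bounds: "integrable M g" "integrable M h" "\<And>z. 0 \<le> g z" "\<And>y. 0 \<le> h y"
    "\<And>x y. x \<in> space M \<Longrightarrow> y \<in> space M \<Longrightarrow> cmod (G x y) \<le> g y"
    "\<And>x y. x \<in> space M \<Longrightarrow> y \<in> space M \<Longrightarrow> cmod (H x y) \<le> h y"
    using fredholm_kernel_bound[OF G] fredholm_kernel_bound[OF H] by metis
  show ?thesis
  proof (rule fredholm_kernelI)
    have "(\<lambda>(p, z). G (fst p) z * H z (snd p)) \<in> borel_measurable ((M \<Otimes>\<^sub>M M) \<Otimes>\<^sub>M M)"
      unfolding case_prod_beta
      by (intro borel_measurable_times fredholm_kernel_measurable[OF G] fredholm_kernel_measurable[OF H]) auto
    then have "(\<lambda>p. kernel_comp M G H (fst p) (snd p)) \<in> borel_measurable (M \<Otimes>\<^sub>M M)"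
      unfolding kernel_comp_def by (rule borel_measurable_lebesgue_integral)
    then show "(\<lambda>(x, y). kernel_comp M G H x y) \<in> borel_measurable (M \<Otimes>\<^sub>M M)"
      by (simp add: case_prod_beta')
    show "integrable M (\<lambda>y. (\<integral>z. g z \<partial>M) * h y)" using bounds(2) by simp
    fix x y assume "x \<in> space M" "y \<in> space M"
    then have "cmod (kernel_comp M G H x y) \<le> (\<integral>z. g z * h y \<partial>M)"
      unfolding kernel_comp_def using bounds
      by (intro integral_norm_le_majorant integrable_kernel_comp[OF G H])
         (auto simp: norm_mult intro!: mult_mono)
    then show "cmod (kernel_comp M G H x y) \<le> (\<integral>z. g z \<partial>M) * h y" by simp
  qed
qed

lemma integrable_fredholm_integrand:
  assumes "\<And>a. a < k \<Longrightarrow> fredholm_kernel M (Gs a)"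
  shows "integrable (PiM {..<k} (\<lambda>_. M)) (\<lambda>\<xi>. ldet k (\<lambda>a b. Gs a (\<xi> a) (\<xi> b)))"
proof -
  interpret power: product_sigma_finite "\<lambda>_::nat. M" ..
  obtain h where h: "integrable M h" "\<And>y. 0 \<le> h y"
    "\<And>a x y. a \<in> {..<k} \<Longrightarrow> x \<in> space M \<Longrightarrow> y \<in> space M \<Longrightarrow> cmod (Gs a x y) \<le> h y"
    using fredholm_kernels_common_bound[of "{..<k}" M Gs] assms by auto
  show ?thesis
  proof (rule Bochner_Integration.integrable_bound)
    show "integrable (PiM {..<k} (\<lambda>_. M)) (\<lambda>\<xi>. sqrt (real k ^ k) * (\<Prod>b<k. h (\<xi> b)))"
      using h(1) by (intro integrable_mult_right power.product_integrable_prod) auto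
    show "AE \<xi> in PiM {..<k} (\<lambda>_. M). cmod (ldet k (\<lambda>a b. Gs a (\<xi> a) (\<xi> b)))
      \<le> norm (sqrt (real k ^ k) * (\<Prod>b<k. h (\<xi> b)))"
      using h by (intro AE_I2 order_trans[OF cmod_fredholm_integrand_le[of k M Gs h]]) auto
  qed (rule measurable_ldet_kernels[where Ks="\<lambda>a b. Gs a", OF assms])
qed

lemma cmod_fredholm_integral_le:
  assumes "\<And>a. a < k \<Longrightarrow> fredholm_kernel M (Gs a)"
    and h: "integrable M h" "\<And>y. 0 \<le> h y"
      "\<And>a x y. a < k \<Longrightarrow> x \<in> space M \<Longrightarrow> y \<in> space M \<Longrightarrow> cmod (Gs a x y) \<le> h y"
  shows "cmod (fredholm_integral M k Gs) \<le> sqrt (real k ^ k) * (\<integral>x. h x \<partial>M) ^ k"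
proof -
  interpret power: product_sigma_finite "\<lambda>_::nat. M" ..
  have "cmod (fredholm_integral M k Gs) \<le> (\<integral>\<xi>. sqrt (real k ^ k) * (\<Prod>b<k. h (\<xi> b)) \<partial>PiM {..<k} (\<lambda>_. M))"
    unfolding fredholm_integral_def using assms
    by (intro integral_norm_le_majorant integrable_fredholm_integrand integrable_mult_right
        power.product_integrable_prod cmod_fredholm_integrand_le) auto
  also have "\<dots> = sqrt (real k ^ k) * (\<integral>x. h x \<partial>M) ^ k"
    using h(1) by (simp add: power.product_integral_prod[of "{..<k}" "\<lambda>_. h"])
  finally show ?thesis .
qed

lemma distr_PiM_permute:
  fixes J :: "'i set"
  assumes "\<sigma> permutes J" "finite J"
  shows "distr (PiM J (\<lambda>_. M)) (PiM J (\<lambda>_. M)) (\<lambda>\<xi>. \<lambda>a\<in>J. \<xi> (\<sigma> a)) = PiM J (\<lambda>_. M)"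
proof -
  interpret power: product_sigma_finite "\<lambda>_::'i. M" ..
  let ?N = "PiM J (\<lambda>_. M)" and ?f = "\<lambda>\<xi>. \<lambda>a\<in>J. \<xi> (\<sigma> a)" and ?\<rho> = "Hilbert_Choice.inv \<sigma>"
  have \<rho>: "?\<rho> permutes J" by (rule permutes_inv[OF assms(1)])
  have mem: "\<sigma> a \<in> J \<longleftrightarrow> a \<in> J" "?\<rho> a \<in> J \<longleftrightarrow> a \<in> J" and inverse: "\<sigma> (?\<rho> a) = a" "?\<rho> (\<sigma> a) = a" for a
    using permutes_in_image[OF assms(1)] permutes_in_image[OF \<rho>] permutes_inverses[OF assms(1)] by auto
  have [measurable]: "?f \<in> ?N \<rightarrow>\<^sub>M ?N"
    by (intro measurable_restrict measurable_component_singleton) (simp add: mem)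
  show ?thesis
  proof (rule power.PiM_eqI)
    fix A :: "'i \<Rightarrow> 'a set" assume A: "\<And>i. i \<in> J \<Longrightarrow> A i \<in> sets M"
    have "?f \<xi> \<in> PiE J A \<longleftrightarrow> \<xi> \<in> PiE J (\<lambda>a. A (?\<rho> a))" if "\<xi> \<in> space ?N" for \<xi>
    proof -
      have "?f \<xi> \<in> PiE J A \<longleftrightarrow> (\<forall>a\<in>J. \<xi> (\<sigma> a) \<in> A a)" by (simp add: PiE_iff)
      also have "\<dots> \<longleftrightarrow> (\<forall>b\<in>J. \<xi> b \<in> A (?\<rho> b))" by (metis mem inverse)
      finally show ?thesis using that by (simp add: space_PiM PiE_iff)
    qed
    moreover have "PiE J (\<lambda>a. A (?\<rho> a)) \<subseteq> space ?N"
      unfolding space_PiM using A mem(2) by (intro PiE_mono sets.sets_into_space) simp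
    ultimately have "?f -` (PiE J A) \<inter> space ?N = PiE J (\<lambda>a. A (?\<rho> a))" by auto
    then have "emeasure (distr ?N ?N ?f) (PiE J A) = emeasure ?N (PiE J (\<lambda>a. A (?\<rho> a)))"
      using A assms(2) by (subst emeasure_distr) (auto intro!: sets_PiM_I_finite)
    also have "\<dots> = (\<Prod>a\<in>J. emeasure M (A (?\<rho> a)))"
      using A assms(2) mem by (intro power.emeasure_PiM) auto
    also have "\<dots> = (\<Prod>a\<in>J. emeasure M (A a))"
      by (rule prod.permute[OF \<rho>, where g="\<lambda>a. emeasure M (A a)", unfolded comp_def, symmetric])
    finally show "emeasure (distr ?N ?N ?f) (PiE J A) = (\<Prod>a\<in>J. emeasure M (A a))" .
  qed (use assms(2) in auto)
qed

lemma fredholm_integral_permute: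
  assumes \<sigma>: "\<sigma> permutes {..<k}" and kernels: "\<And>a. a < k \<Longrightarrow> fredholm_kernel M (Gs a)"
  shows "fredholm_integral M k (\<lambda>a. Gs (\<sigma> a)) = fredholm_integral M k Gs"
proof -
  let ?N = "PiM {..<k} (\<lambda>_. M)" and ?f = "\<lambda>\<xi>. \<lambda>a\<in>{..<k}. \<xi> (\<sigma> a)"
  let ?D = "\<lambda>\<xi>. ldet k (\<lambda>a b. Gs (\<sigma> a) (\<xi> a) (\<xi> b))"
  have "ldet k (\<lambda>a b. Gs a (\<xi> a) (\<xi> b)) = ?D (?f \<xi>)" for \<xi>
  proof -
    have "ldet k (\<lambda>a b. Gs a (\<xi> a) (\<xi> b)) = ldet k (\<lambda>a b. Gs (\<sigma> a) (\<xi> (\<sigma> a)) (\<xi> (\<sigma> b)))"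
      by (rule ldet_permute_rows_and_columns[OF \<sigma>, symmetric])
    also have "\<dots> = ?D (?f \<xi>)" by (intro ldet_cong) auto
    finally show ?thesis .
  qed
  then have "fredholm_integral M k Gs = (\<integral>\<xi>. ?D (?f \<xi>) \<partial>?N)"
    by (simp only: fredholm_integral_def)
  also have "\<dots> = (\<integral>\<xi>. ?D \<xi> \<partial>distr ?N ?N ?f)"
  proof (rule integral_distr[symmetric])
    show "?f \<in> ?N \<rightarrow>\<^sub>M ?N"
      using permutes_lessThan_iff[OF \<sigma>] by (intro measurable_restrict measurable_component_singleton) auto
    show "?D \<in> borel_measurable ?N"
      using kernels permutes_lessThan_iff[OF \<sigma>]
      by (intro measurable_ldet_kernels[where Ks="\<lambda>a b. Gs (\<sigma> a)"]) auto
  qed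
  also have "\<dots> = (\<integral>\<xi>. ?D \<xi> \<partial>?N)" by (simp only: distr_PiM_permute[OF \<sigma> finite_lessThan])
  finally show ?thesis by (simp add: fredholm_integral_def)
qed

end

lemma permutes_carrying_subset:
  assumes "finite U" "S \<subseteq> U" "T \<subseteq> U" "card S = card T"
  obtains \<sigma> where "\<sigma> permutes U" "\<And>a. a \<in> U \<Longrightarrow> \<sigma> a \<in> T \<longleftrightarrow> a \<in> S"
proof -
  have finite: "finite S" "finite T" using assms finite_subset by auto
  obtain f where f: "bij_betw f S T"
    using finite_same_card_bij[OF finite assms(4)] by blast
  have "card (U - S) = card (U - T)" using assms finite by (simp add: card_Diff_subset)
  then obtain g where g: "bij_betw g (U - S) (U - T)"
    using finite_same_card_bij[of "U - S" "U - T"] assms(1) by blast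
  define \<sigma> where "\<sigma> a = (if a \<in> S then f a else if a \<in> U then g a else a)" for a
  have "bij_betw \<sigma> S T"
    using f by (rule bij_betw_cong[THEN iffD1, rotated]) (simp add: \<sigma>_def)
  moreover have "bij_betw \<sigma> (U - S) (U - T)"
    using g by (rule bij_betw_cong[THEN iffD1, rotated]) (simp add: \<sigma>_def)
  ultimately have "bij_betw \<sigma> (S \<union> (U - S)) (T \<union> (U - T))"
    by (rule bij_betw_combine) auto
  then have "bij_betw \<sigma> U U" using assms(2,3) by (simp add: Un_absorb1)
  then have "\<sigma> permutes U"
    by (rule bij_imp_permutes) (use assms(2) in \<open>auto simp: \<sigma>_def\<close>)
  moreover have "\<sigma> a \<in> T \<longleftrightarrow> a \<in> S" if "a \<in> U" for a
    using that f g by (auto simp: \<sigma>_def bij_betw_def)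
  ultimately show ?thesis by (rule that)
qed

context sigma_finite_measure
begin

lemma has_bochner_integral_ldet_last_point:
  assumes kernels: "\<And>a. a \<le> k \<Longrightarrow> fredholm_kernel M (Gs a)" and \<xi>: "\<And>a. a < k \<Longrightarrow> \<xi> a \<in> space M"
  shows "has_bochner_integral M (\<lambda>z. ldet (Suc k) (\<lambda>a b. Gs a ((\<xi>(k := z)) a) ((\<xi>(k := z)) b)))
    ((\<integral>z. Gs k z z \<partial>M) * ldet k (\<lambda>a b. Gs a (\<xi> a) (\<xi> b))
     - (\<Sum>c<k. ldet k (\<lambda>a b. (Gs(c := kernel_comp M (Gs c) (Gs k))) a (\<xi> a) (\<xi> b))))"
proof -
  let ?A = "\<lambda>a b. Gs a (\<xi> a) (\<xi> b)"
  have "ldet (Suc k) (\<lambda>a b. Gs a ((\<xi>(k := z)) a) ((\<xi>(k := z)) b))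
      = Gs k z z * ldet k ?A - (\<Sum>c<k. ldet k (?A(c := \<lambda>b. Gs c (\<xi> c) z * Gs k z (\<xi> b))))" for z
  proof -
    have "ldet (Suc k) (\<lambda>a b. Gs a ((\<xi>(k := z)) a) ((\<xi>(k := z)) b))
        = Gs k z z * ldet k ?A - (\<Sum>c<k. Gs c (\<xi> c) z * ldet k (?A(c := \<lambda>b. Gs k z (\<xi> b))))"
      unfolding ldet_bordered
      by (intro arg_cong2[where f="(-)"] arg_cong2[where f="(*)"] sum.cong refl ldet_cong) auto
    then show ?thesis by (simp add: ldet_row_scale)
  qed
  moreover have "ldet k (\<lambda>a b. (Gs(c := kernel_comp M (Gs c) (Gs k))) a (\<xi> a) (\<xi> b))
      = ldet k (?A(c := \<lambda>b. \<integral>z. Gs c (\<xi> c) z * Gs k z (\<xi> b) \<partial>M))" for c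
    by (intro ldet_cong) (auto simp: kernel_comp_def)
  ultimately show ?thesis
    by (simp only:) (intro has_bochner_integral_diff has_bochner_integral_sum has_bochner_integral_mult_left
        has_bochner_integral_ldet_row has_bochner_integral_integrable integrable_diagonal
        integrable_kernel_comp kernels \<xi>, auto)
qed

lemma fredholm_integral_Suc:
  assumes kernels: "\<And>a. a \<le> k \<Longrightarrow> fredholm_kernel M (Gs a)"
  shows "fredholm_integral M (Suc k) Gs = (\<integral>z. Gs k z z \<partial>M) * fredholm_integral M k Gs
    - (\<Sum>a<k. fredholm_integral M k (Gs(a := kernel_comp M (Gs a) (Gs k))))"
proof -
  interpret power: product_sigma_finite "\<lambda>_::nat. M" ..
  let ?N = "PiM {..<k} (\<lambda>_. M)"
  let ?D = "\<lambda>Gs k \<xi>. ldet k (\<lambda>a b. Gs a (\<xi> a) (\<xi> b))"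
  let ?Comp = "\<lambda>a. Gs(a := kernel_comp M (Gs a) (Gs k))"
  have "fredholm_integral M (Suc k) Gs = (\<integral>\<xi>. \<integral>z. ?D Gs (Suc k) (\<xi>(k := z)) \<partial>M \<partial>?N)"
    unfolding fredholm_integral_def lessThan_Suc
    using integrable_fredholm_integrand[of "Suc k" Gs] kernels
    by (intro power.product_integral_insert) (auto simp: lessThan_Suc)
  also have "\<dots> = (\<integral>\<xi>. (\<integral>z. Gs k z z \<partial>M) * ?D Gs k \<xi> - (\<Sum>a<k. ?D (?Comp a) k \<xi>) \<partial>?N)"
    by (intro Bochner_Integration.integral_cong refl has_bochner_integral_integral_eq
        has_bochner_integral_ldet_last_point kernels) (auto simp: space_PiM PiE_iff)
  also have "\<dots> = (\<integral>z. Gs k z z \<partial>M) * fredholm_integral M k Gs - (\<Sum>a<k. fredholm_integral M k (?Comp a))"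
  proof -
    have "integrable ?N (?D (?Comp a) k)" if "a < k" for a
      using that kernels by (intro integrable_fredholm_integrand) (auto intro: fredholm_kernel_comp)
    moreover have "integrable ?N (?D Gs k)"
      using kernels by (intro integrable_fredholm_integrand) auto
    ultimately show ?thesis
      unfolding fredholm_integral_def
      by (intro has_bochner_integral_integral_eq has_bochner_integral_diff has_bochner_integral_sum
          has_bochner_integral_mult_right has_bochner_integral_integrable) auto
  qed
  finally show ?thesis .
qed

lemma fredholm_integral_eq_if_card_eq:
  assumes "fredholm_kernel M G" "fredholm_kernel M H" "S \<subseteq> {..<k}" "T \<subseteq> {..<k}" "card S = card T"
  shows "fredholm_integral M k (\<lambda>a. if a \<in> S then G else H)
    = fredholm_integral M k (\<lambda>a. if a \<in> T then G else H)"
proof -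
  obtain \<sigma> where \<sigma>: "\<sigma> permutes {..<k}" "\<And>a. a \<in> {..<k} \<Longrightarrow> \<sigma> a \<in> T \<longleftrightarrow> a \<in> S"
    using permutes_carrying_subset[OF finite_lessThan assms(3-5)] by blast
  have "fredholm_integral M k (\<lambda>a. if a \<in> S then G else H)
      = fredholm_integral M k (\<lambda>a. if \<sigma> a \<in> T then G else H)"
    using \<sigma>(2) by (intro fredholm_integral_cong_slots) simp
  also have "\<dots> = fredholm_integral M k (\<lambda>a. if a \<in> T then G else H)"
    using assms(1,2)
    by (intro fredholm_integral_permute[OF \<sigma>(1), where Gs="\<lambda>a. if a \<in> T then G else H"]) auto
  finally show ?thesis .
qed

lemma fredholm_integral_add:
  assumes "fredholm_kernel M G" "fredholm_kernel M H"
  shows "fredholm_integral M k (\<lambda>_ x y. G x y + H x y)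
    = (\<Sum>S\<in>Pow {..<k}. fredholm_integral M k (\<lambda>a. if a \<in> S then G else H))"
proof -
  have "ldet k (\<lambda>a b. G (\<xi> a) (\<xi> b) + H (\<xi> a) (\<xi> b))
      = (\<Sum>S\<in>Pow {..<k}. ldet k (\<lambda>a b. (if a \<in> S then G else H) (\<xi> a) (\<xi> b)))" for \<xi>
    unfolding ldet_add by (intro sum.cong refl ldet_cong) auto
  then show ?thesis
    unfolding fredholm_integral_def using assms
    by (simp only:) (intro Bochner_Integration.integral_sum integrable_fredholm_integrand, auto)
qed

lemma fredholm_integral_add_binomial:
  assumes "fredholm_kernel M G" "fredholm_kernel M H"
    and U: "\<And>q. q \<le> k \<Longrightarrow> U q \<subseteq> {..<k} \<and> card (U q) = q"
  shows "fredholm_integral M k (\<lambda>_ x y. G x y + H x y)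
    = (\<Sum>q\<le>k. of_nat (k choose q) * fredholm_integral M k (\<lambda>a. if a \<in> U q then G else H))"
proof -
  have "fredholm_integral M k (\<lambda>_ x y. G x y + H x y)
      = (\<Sum>S\<in>Pow {..<k}. fredholm_integral M k (\<lambda>a. if a \<in> S then G else H))"
    by (rule fredholm_integral_add[OF assms(1,2)])
  also have "\<dots> = (\<Sum>q\<le>k. \<Sum>S\<in>{S \<in> Pow {..<k}. card S = q}. fredholm_integral M k (\<lambda>a. if a \<in> S then G else H))"
    by (rule sum.group[symmetric]) (auto intro: card_mono[of "{..<k}", simplified])
  also have "\<dots> = (\<Sum>q\<le>k. \<Sum>S\<in>{S \<in> Pow {..<k}. card S = q}. fredholm_integral M k (\<lambda>a. if a \<in> U q then G else H))"
    using U by (intro sum.cong refl fredholm_integral_eq_if_card_eq[OF assms(1,2)]) auto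
  also have "\<dots> = (\<Sum>q\<le>k. of_nat (k choose q) * fredholm_integral M k (\<lambda>a. if a \<in> U q then G else H))"
    using n_subsets[of "{..<k}"] by (intro sum.cong refl) (simp add: Pow_def)
  finally show ?thesis .
qed

end

section \<open>Eliminating a part of the space\<close>

lemma kernel_comp_eq_0:
  assumes "\<And>z. G x z * H z y = 0"
  shows "kernel_comp M G H x y = 0"
  by (simp only: kernel_comp_def assms Bochner_Integration.integral_zero)

locale schur_elimination = sigma_finite_measure M
  for M :: "'x measure" +
  fixes G :: "'x \<Rightarrow> 'x \<Rightarrow> complex" and Y :: "'x set"
  assumes kernel: "fredholm_kernel M G" and Y_sets: "Y \<in> sets M"
    and vanishing_block: "x \<in> Y \<Longrightarrow> y \<in> Y \<Longrightarrow> G x y = 0"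
begin

abbreviation remaining_rows :: "'x \<Rightarrow> 'x \<Rightarrow> complex" where
  "remaining_rows \<equiv> restrict_rows (- Y) G"

abbreviation eliminated_rows :: "'x \<Rightarrow> 'x \<Rightarrow> complex" where
  "eliminated_rows \<equiv> restrict_rows Y G"

definition direct :: "'x \<Rightarrow> 'x \<Rightarrow> complex" where
  "direct x y = (if x \<in> Y \<or> y \<in> Y then 0 else G x y)"

definition detour :: "'x \<Rightarrow> 'x \<Rightarrow> complex" where
  "detour = kernel_comp M remaining_rows eliminated_rows"

definition reduced :: "'x \<Rightarrow> 'x \<Rightarrow> complex" where
  "reduced x y = detour x y + direct x y"

lemma fredholm_kernel_remaining_rows: "fredholm_kernel M remaining_rows"
  using Y_sets by (intro fredholm_kernel_restrict_rows[OF kernel]) (simp add: Int_commute flip: Diff_eq)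

lemma fredholm_kernel_eliminated_rows: "fredholm_kernel M eliminated_rows"
  using Y_sets by (intro fredholm_kernel_restrict_rows[OF kernel]) auto

lemma fredholm_kernel_direct: "fredholm_kernel M direct"
proof -
  have [measurable]: "Measurable.pred M (\<lambda>x. x \<in> Y)" using Y_sets by simp
  have "fredholm_kernel M (\<lambda>x y. if x \<notin> Y \<and> y \<notin> Y then G x y else 0)"
    by (rule fredholm_kernel_if[OF kernel]) measurable
  also have "(\<lambda>x y. if x \<notin> Y \<and> y \<notin> Y then G x y else 0) = direct"
    by (simp add: direct_def fun_eq_iff)
  finally show ?thesis .
qed

lemma fredholm_kernel_detour: "fredholm_kernel M detour"
  unfolding detour_def
  by (rule fredholm_kernel_comp[OF fredholm_kernel_remaining_rows fredholm_kernel_eliminated_rows])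

lemma detour_eq_0:
  assumes "x \<in> Y \<or> y \<in> Y" shows "detour x y = 0"
  unfolding detour_def
  by (rule kernel_comp_eq_0) (use assms vanishing_block in \<open>auto simp: restrict_rows_def\<close>)

definition stage :: "nat \<Rightarrow> nat \<Rightarrow> nat \<Rightarrow> 'x \<Rightarrow> 'x \<Rightarrow> complex" where
  "stage p r a = (if a < r then detour else if a < p then remaining_rows else eliminated_rows)"

lemma fredholm_kernel_stage: "fredholm_kernel M (stage p r a)"
  using fredholm_kernel_detour fredholm_kernel_remaining_rows fredholm_kernel_eliminated_rows
  by (simp add: stage_def)

text \<open>Integrating out the last variable pairs its row with one of the \<open>p - r\<close> remaining rows; by
  symmetry each pairing contributes the same.\<close>

lemma fredholm_integral_stage_Suc:
  assumes "r \<le> p"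
  shows "fredholm_integral M (p + Suc q) (stage p r)
    = - (of_nat (p - r) * fredholm_integral M (p + q) (stage p (Suc r)))"
proof -
  let ?last = "stage p r (p + q)"
  let ?paired = "\<lambda>a. (stage p r)(a := kernel_comp M (stage p r a) ?last)"
  have last: "?last = eliminated_rows" using assms by (simp add: stage_def)
  have "?last z z = 0" for z
    using vanishing_block by (simp add: last restrict_rows_def)
  then have "fredholm_integral M (p + Suc q) (stage p r)
      = - (\<Sum>a<p + q. fredholm_integral M (p + q) (?paired a))"
    using fredholm_integral_Suc[of "p + q" "stage p r"] fredholm_kernel_stage by simp
  also have "(\<Sum>a<p + q. fredholm_integral M (p + q) (?paired a))
      = (\<Sum>a\<in>{r..<p}. fredholm_integral M (p + q) (?paired a))"
  proof (intro sum.mono_neutral_right ballI)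
    fix a assume a: "a \<in> {..<p + q} - {r..<p}"
    have "kernel_comp M (stage p r a) ?last x y = 0" for x y
      unfolding last
      by (rule kernel_comp_eq_0) (use a detour_eq_0 vanishing_block in \<open>auto simp: stage_def restrict_rows_def\<close>)
    then show "fredholm_integral M (p + q) (?paired a) = 0"
      using a by (intro fredholm_integral_zero_slot[of a]) auto
  qed auto
  also have "\<dots> = (\<Sum>a\<in>{r..<p}. fredholm_integral M (p + q) (stage p (Suc r)))"
  proof (intro sum.cong refl)
    fix a assume a: "a \<in> {r..<p}"
    let ?swap = "Transposition.transpose a r"
    have "?paired a = (stage p r)(a := detour)"
      using a by (simp add: last) (simp add: stage_def detour_def)
    then have "fredholm_integral M (p + q) (?paired a)
        = fredholm_integral M (p + q) (\<lambda>b. stage p (Suc r) (?swap b))"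
      using a by (intro fredholm_integral_cong_slots) (auto simp: stage_def Transposition.transpose_def)
    also have "\<dots> = fredholm_integral M (p + q) (stage p (Suc r))"
      using a by (intro fredholm_integral_permute permutes_swap_id fredholm_kernel_stage) auto
    finally show "fredholm_integral M (p + q) (?paired a) = fredholm_integral M (p + q) (stage p (Suc r))" .
  qed
  finally show ?thesis by simp
qed

lemma fredholm_integral_stage:
  assumes "r \<le> p"
  shows "fredholm_integral M (p + q) (stage p r)
    = (if q \<le> p - r
       then (-1) ^ q * fact (p - r) / fact (p - r - q) * fredholm_integral M p (stage p (r + q)) else 0)"
  using assms
proof (induction q arbitrary: r)
  case 0
  then show ?case by simp
next
  case (Suc q)
  show ?case
  proof (cases "r = p")
    case True
    then show ?thesis using fredholm_integral_stage_Suc[of r p q] by simp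
  next
    case False
    then have "p - r = Suc (p - Suc r)" using Suc.prems by simp
    then have "(fact (p - r) :: complex) = of_nat (p - r) * fact (p - Suc r)" by (metis fact_Suc)
    then show ?thesis
      using fredholm_integral_stage_Suc[OF Suc.prems, of q] Suc.IH[of "Suc r"] False Suc.prems by auto
  qed
qed

lemma fredholm_integral_stage_self:
  "fredholm_integral M p (stage p q) = fredholm_integral M p (\<lambda>a. if a \<in> {..<q} then detour else direct)"
proof (rule fredholm_integral_cong)
  fix \<xi> :: "nat \<Rightarrow> 'x"
  let ?stage = "\<lambda>a b. stage p q a (\<xi> a) (\<xi> b)"
    and ?final = "\<lambda>a b. (if a \<in> {..<q} then detour else direct) (\<xi> a) (\<xi> b)"
  show "ldet p ?stage = ldet p ?final"
  proof (cases "\<exists>b<p. \<xi> b \<in> Y")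
    case True
    then obtain b where b: "b < p" "\<xi> b \<in> Y" by blast
    have "ldet p ?stage = 0"
      by (rule ldet_zero_row[OF b(1)]) (use b detour_eq_0 in \<open>auto simp: stage_def restrict_rows_def\<close>)
    moreover have "ldet p ?final = 0"
      by (rule ldet_zero_row[OF b(1)]) (use b detour_eq_0 in \<open>auto simp: direct_def\<close>)
    ultimately show ?thesis by simp
  next
    case False
    then show ?thesis by (intro ldet_cong) (auto simp: stage_def restrict_rows_def direct_def)
  qed
qed

definition elimination_coeff :: "nat \<Rightarrow> nat \<Rightarrow> complex" where
  "elimination_coeff p q = (if q \<le> p then (-1) ^ p / (fact q * fact (p - q)) *
     fredholm_integral M p (\<lambda>a. if a \<in> {..<q} then detour else direct) else 0)"

lemma fredholm_coeff_reduced: "fredholm_coeff M reduced p = (\<Sum>q\<le>p. elimination_coeff p q)"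
proof -
  have "fredholm_integral M p (\<lambda>_. reduced)
      = (\<Sum>q\<le>p. of_nat (p choose q) * fredholm_integral M p (\<lambda>a. if a \<in> {..<q} then detour else direct))"
    unfolding reduced_def[abs_def]
    by (rule fredholm_integral_add_binomial[OF fredholm_kernel_detour fredholm_kernel_direct]) auto
  then show ?thesis
    unfolding fredholm_coeff_def
    by (auto simp: sum_distrib_left elimination_coeff_def binomial_fact field_simps intro!: sum.cong)
qed

lemma fredholm_integral_last_rows_eliminated:
  assumes "q \<le> m"
  shows "(-1) ^ m / fact m * (of_nat (m choose q) *
      fredholm_integral M m (\<lambda>a. if a \<in> {m - q..<m} then eliminated_rows else remaining_rows))
    = elimination_coeff (m - q) q"
proof -
  define p where "p = m - q"
  have m: "m = p + q" using assms by (simp add: p_def)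
  have "fredholm_integral M m (\<lambda>a. if a \<in> {m - q..<m} then eliminated_rows else remaining_rows)
      = fredholm_integral M (p + q) (stage p 0)"
    unfolding m by (intro fredholm_integral_cong_slots) (auto simp: stage_def)
  also have "\<dots> = (if q \<le> p then (-1) ^ q * fact p / fact (p - q) *
      fredholm_integral M p (\<lambda>a. if a \<in> {..<q} then detour else direct) else 0)"
    using fredholm_integral_stage[of 0 p q] by (simp add: fredholm_integral_stage_self)
  finally show ?thesis
    by (simp add: m elimination_coeff_def binomial_fact power_add field_simps)
qed

lemma fredholm_coeff_eq_antidiagonal: "fredholm_coeff M G m = (\<Sum>q\<le>m. elimination_coeff (m - q) q)"
proof -
  have "G = (\<lambda>x y. eliminated_rows x y + remaining_rows x y)"
    by (auto simp: restrict_rows_def fun_eq_iff)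
  then have "fredholm_integral M m (\<lambda>_. G)
      = fredholm_integral M m (\<lambda>_ x y. eliminated_rows x y + remaining_rows x y)"
    by simp
  also have "\<dots> = (\<Sum>q\<le>m. of_nat (m choose q) *
      fredholm_integral M m (\<lambda>a. if a \<in> {m - q..<m} then eliminated_rows else remaining_rows))"
    using fredholm_kernel_eliminated_rows fredholm_kernel_remaining_rows
    by (rule fredholm_integral_add_binomial) auto
  finally have expansion: "fredholm_integral M m (\<lambda>_. G) = \<dots>" .
  show ?thesis
    unfolding fredholm_coeff_def expansion sum_distrib_left
    by (intro sum.cong refl fredholm_integral_last_rows_eliminated) simp
qed

lemma elimination_coeff_row_bound:
  obtains x where "0 \<le> x" "\<And>p. (\<Sum>q\<le>p. cmod (elimination_coeff p q)) \<le> x ^ p * sqrt (real p ^ p) / fact p"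
proof -
  obtain h where h: "integrable M h" "\<And>y. 0 \<le> h y"
    "\<And>K x y. K \<in> {detour, direct} \<Longrightarrow> x \<in> space M \<Longrightarrow> y \<in> space M \<Longrightarrow> cmod (K x y) \<le> h y"
    using fredholm_kernels_common_bound[of "{detour, direct}" M "\<lambda>K. K"]
      fredholm_kernel_detour fredholm_kernel_direct by auto
  let ?B = "\<lambda>p. sqrt (real p ^ p) * (\<integral>x. h x \<partial>M) ^ p"
  show ?thesis
  proof
    show "0 \<le> 2 * (\<integral>x. h x \<partial>M)" using h(2) by (simp add: integral_nonneg_AE)
    fix p
    have "cmod (elimination_coeff p q) \<le> real (p choose q) * (?B p / fact p)" if "q \<le> p" for q
    proof -
      have "cmod (fredholm_integral M p (\<lambda>a. if a \<in> {..<q} then detour else direct)) \<le> ?B p"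
        using fredholm_kernel_detour fredholm_kernel_direct h
        by (intro cmod_fredholm_integral_le) auto
      then have "cmod (elimination_coeff p q) \<le> 1 / (fact q * fact (p - q)) * ?B p"
        using that by (simp add: elimination_coeff_def norm_mult norm_divide norm_power divide_right_mono)
      then show ?thesis using that by (simp add: binomial_fact field_simps)
    qed
    then have "(\<Sum>q\<le>p. cmod (elimination_coeff p q)) \<le> (\<Sum>q\<le>p. real (p choose q) * (?B p / fact p))"
      by (intro sum_mono) auto
    also have "\<dots> = 2 ^ p * (?B p / fact p)"
      unfolding sum_distrib_right[symmetric] of_nat_sum[symmetric] choose_row_sum by simp
    finally show "(\<Sum>q\<le>p. cmod (elimination_coeff p q)) \<le> (2 * (\<integral>x. h x \<partial>M)) ^ p * sqrt (real p ^ p) / fact p"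
      by (simp add: power_mult_distrib mult_ac)
  qed
qed

theorem fredholm_series_reduced:
  "\<exists>D. fredholm_coeff M G sums D \<and> fredholm_coeff M reduced sums D"
proof -
  obtain x where "0 \<le> x" and
    bound: "\<And>p. (\<Sum>q\<le>p. cmod (elimination_coeff p q)) \<le> x ^ p * sqrt (real p ^ p) / fact p"
    using elimination_coeff_row_bound by metis
  have "\<exists>D. (\<lambda>p. \<Sum>q\<le>p. elimination_coeff p q) sums D \<and> (\<lambda>m. \<Sum>q\<le>m. elimination_coeff (m - q) q) sums D"
    by (rule sums_rows_and_antidiagonals[OF _ bound summable_hadamard_series[OF \<open>0 \<le> x\<close>]])
       (simp add: elimination_coeff_def)
  then show ?thesis
    unfolding fredholm_coeff_reduced[abs_def] fredholm_coeff_eq_antidiagonal[abs_def] by blast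
qed

end

section \<open>Kernels with a finite index\<close>

definition block_kernel :: "('i \<Rightarrow> 'x \<Rightarrow> 'i \<Rightarrow> 'x \<Rightarrow> complex) \<Rightarrow> 'i \<times> 'x \<Rightarrow> 'i \<times> 'x \<Rightarrow> complex" where
  "block_kernel G p q = G (fst p) (snd p) (fst q) (snd q)"

definition fredholm_blocks :: "'i set \<Rightarrow> 'x measure \<Rightarrow> ('i \<Rightarrow> 'x \<Rightarrow> 'i \<Rightarrow> 'x \<Rightarrow> complex) \<Rightarrow> bool" where
  "fredholm_blocks I M G \<longleftrightarrow> (\<forall>i\<in>I. \<forall>j\<in>I. fredholm_kernel M (\<lambda>x y. G i x j y))"

lemma fredholm_blocks_subset:
  assumes "fredholm_blocks I M G" "J \<subseteq> I" shows "fredholm_blocks J M G"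
  using assms unfolding fredholm_blocks_def by blast

definition zip_points :: "'j set \<Rightarrow> ('j \<Rightarrow> 'i) \<times> ('j \<Rightarrow> 'x) \<Rightarrow> 'j \<Rightarrow> 'i \<times> 'x" where
  "zip_points J p = (\<lambda>a\<in>J. (fst p a, snd p a))"

lemma measurable_zip_points:
  "zip_points J \<in> count_space (J \<rightarrow>\<^sub>E I) \<Otimes>\<^sub>M PiM J (\<lambda>_. M) \<rightarrow>\<^sub>M PiM J (\<lambda>_. count_space I \<Otimes>\<^sub>M M)"
  unfolding zip_points_def
  by (intro measurable_restrict measurable_Pair measurable_compose[OF measurable_fst]
      measurable_compose[OF measurable_snd measurable_component_singleton])
     (auto simp: measurable_count_space_eq1)

definition schur_complement ::
  "'x measure \<Rightarrow> 'i set \<Rightarrow> ('i \<Rightarrow> 'x \<Rightarrow> 'i \<Rightarrow> 'x \<Rightarrow> complex) \<Rightarrow> 'i \<Rightarrow> 'x \<Rightarrow> 'i \<Rightarrow> 'x \<Rightarrow> complex" where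
  "schur_complement M L G i x j y = (if i \<in> L \<or> j \<in> L then 0
     else G i x j y + (\<Sum>l\<in>L. \<integral>z. G i x l z * G l z j y \<partial>M))"

context sigma_finite_measure
begin

lemma sigma_finite_count_space_pair:
  assumes "finite I" shows "sigma_finite_measure (count_space I \<Otimes>\<^sub>M M)"
  by (intro sigma_finite_pair_measure sigma_finite_measure_count_space_finite assms)
     (rule sigma_finite_measure_axioms)

lemma has_bochner_integral_count_space_pair:
  fixes f :: "'i \<Rightarrow> 'a \<Rightarrow> 'b::{banach, second_countable_topology}"
  assumes "finite I" and f: "\<And>i. i \<in> I \<Longrightarrow> integrable M (f i)"
  shows "has_bochner_integral (count_space I \<Otimes>\<^sub>M M) (\<lambda>p. f (fst p) (snd p)) (\<Sum>i\<in>I. \<integral>x. f i x \<partial>M)"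
proof -
  interpret count: sigma_finite_measure "count_space I"
    by (rule sigma_finite_measure_count_space_finite[OF assms(1)])
  interpret pair_sigma_finite "count_space I" M ..
  let ?f = "\<lambda>p. f (fst p) (snd p)"
  have [measurable]: "?f \<in> borel_measurable (count_space I \<Otimes>\<^sub>M M)"
    by (rule measurable_compose_countable'[where I=I and f="\<lambda>i p. f i (snd p)" and g=fst])
       (use assms in \<open>auto intro!: measurable_compose[OF measurable_snd] countable_finite\<close>)
  have integrable: "integrable (count_space I \<Otimes>\<^sub>M M) ?f"
    using assms by (intro Fubini_integrable) (auto simp: AE_count_space integrable_count_space)
  moreover have "integral\<^sup>L (count_space I \<Otimes>\<^sub>M M) ?f = (\<Sum>i\<in>I. \<integral>x. f i x \<partial>M)"
    using integral_fst'[OF integrable] assms(1) by (simp add: lebesgue_integral_count_space_finite)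
  ultimately show ?thesis by (simp add: has_bochner_integral_iff)
qed

lemma fredholm_kernel_block_kernel:
  assumes "finite I" and G: "fredholm_blocks I M G"
  shows "fredholm_kernel (count_space I \<Otimes>\<^sub>M M) (block_kernel G)"
proof -
  let ?N = "count_space I \<Otimes>\<^sub>M M"
  have block: "fredholm_kernel M (\<lambda>x y. G i x j y)" if "i \<in> I" "j \<in> I" for i j
    using G that unfolding fredholm_blocks_def by blast
  obtain h where h: "integrable M h" "\<And>ij x y. ij \<in> I \<times> I \<Longrightarrow> x \<in> space M \<Longrightarrow> y \<in> space M \<Longrightarrow>
      cmod (G (fst ij) x (snd ij) y) \<le> h y"
    by (rule fredholm_kernels_common_bound[of "I \<times> I" M "\<lambda>ij x y. G (fst ij) x (snd ij) y"])
       (use block assms(1) in auto)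
  show ?thesis
  proof (rule fredholm_kernelI)
    have "(\<lambda>w. G i (snd (fst w)) j (snd (snd w))) \<in> borel_measurable (?N \<Otimes>\<^sub>M ?N)" if "i \<in> I" "j \<in> I" for i j
      by (rule fredholm_kernel_measurable[OF block[OF that]]) simp_all
    then have "(\<lambda>w. G i (snd (fst w)) (fst (snd w)) (snd (snd w))) \<in> borel_measurable (?N \<Otimes>\<^sub>M ?N)"
      if "i \<in> I" for i
      using that assms(1)
      by (intro measurable_compose_countable'[where I=I and g="\<lambda>w. fst (snd w)"
            and f="\<lambda>j w. G i (snd (fst w)) j (snd (snd w))"]) (simp_all add: countable_finite)
    then have "(\<lambda>w. G (fst (fst w)) (snd (fst w)) (fst (snd w)) (snd (snd w))) \<in> borel_measurable (?N \<Otimes>\<^sub>M ?N)"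
      using assms(1)
      by (intro measurable_compose_countable'[where I=I and g="\<lambda>w. fst (fst w)"
            and f="\<lambda>i w. G i (snd (fst w)) (fst (snd w)) (snd (snd w))"]) (simp_all add: countable_finite)
    then show "(\<lambda>(p, q). block_kernel G p q) \<in> borel_measurable (?N \<Otimes>\<^sub>M ?N)"
      by (simp add: block_kernel_def case_prod_beta')
    show "integrable ?N (\<lambda>q. h (snd q))"
      using has_bochner_integral_count_space_pair[OF assms(1), of "\<lambda>_. h"] h(1)
      by (simp add: has_bochner_integral_iff)
    show "cmod (block_kernel G p q) \<le> h (snd q)" if "p \<in> space ?N" "q \<in> space ?N" for p q
      using that h(2)[of "(fst p, fst q)"] by (auto simp: block_kernel_def space_pair_measure)
  qed
qed

lemma distr_PiM_zip:
  fixes J :: "'j set"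
  assumes "finite I" "finite J"
  shows "distr (count_space (J \<rightarrow>\<^sub>E I) \<Otimes>\<^sub>M PiM J (\<lambda>_. M)) (PiM J (\<lambda>_. count_space I \<Otimes>\<^sub>M M))
      (zip_points J) = PiM J (\<lambda>_. count_space I \<Otimes>\<^sub>M M)"
proof -
  let ?N = "count_space I \<Otimes>\<^sub>M M" and ?C = "count_space (J \<rightarrow>\<^sub>E I)" and ?P = "PiM J (\<lambda>_. M)"
  let ?zip = "zip_points J"
  interpret N: sigma_finite_measure ?N by (rule sigma_finite_count_space_pair[OF assms(1)])
  interpret power_N: product_sigma_finite "\<lambda>_::'j. ?N" ..
  interpret power: product_sigma_finite "\<lambda>_::'j. M" ..
  interpret P: sigma_finite_measure ?P by (rule power.sigma_finite[OF assms(2)])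
  show ?thesis
  proof (rule power_N.PiM_eqI)
    fix A assume A: "\<And>a. a \<in> J \<Longrightarrow> A a \<in> sets ?N"
    let ?V = "?zip -` PiE J A \<inter> space (?C \<Otimes>\<^sub>M ?P)"
    have slice: "Pair \<iota> -` ?V = PiE J (\<lambda>a. Pair (\<iota> a) -` A a)" if "\<iota> \<in> J \<rightarrow>\<^sub>E I" for \<iota>
      using that A[THEN sets.sets_into_space]
      by (auto simp: space_pair_measure space_PiM PiE_iff zip_points_def)
    have box: "PiE J A \<in> sets (PiM J (\<lambda>_. ?N))" using A assms(2) by (intro sets_PiM_I_finite) auto
    have "emeasure (distr (?C \<Otimes>\<^sub>M ?P) (PiM J (\<lambda>_. ?N)) ?zip) (PiE J A) = emeasure (?C \<Otimes>\<^sub>M ?P) ?V"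
      by (rule emeasure_distr[OF measurable_zip_points box])
    also have "\<dots> = (\<integral>\<^sup>+\<iota>. emeasure ?P (Pair \<iota> -` ?V) \<partial>?C)"
      by (rule P.emeasure_pair_measure_alt[OF measurable_sets[OF measurable_zip_points box]])
    also have "\<dots> = (\<Sum>\<iota>\<in>J \<rightarrow>\<^sub>E I. emeasure ?P (PiE J (\<lambda>a. Pair (\<iota> a) -` A a)))"
      using assms by (simp add: nn_integral_count_space_finite finite_PiE slice del: vimage_Int)
    also have "\<dots> = (\<Sum>\<iota>\<in>J \<rightarrow>\<^sub>E I. \<Prod>a\<in>J. emeasure M (Pair (\<iota> a) -` A a))"
      using A assms(2) by (intro sum.cong refl power.emeasure_PiM sets_Pair1) auto
    also have "\<dots> = (\<Prod>a\<in>J. \<Sum>i\<in>I. emeasure M (Pair i -` A a))"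
      using assms by (intro prod_sum_PiE[symmetric]) auto
    also have "\<dots> = (\<Prod>a\<in>J. emeasure ?N (A a))"
      using A assms(1)
      by (intro prod.cong refl) (simp add: emeasure_pair_measure_alt nn_integral_count_space_finite)
    finally show "emeasure (distr (?C \<Otimes>\<^sub>M ?P) (PiM J (\<lambda>_. ?N)) ?zip) (PiE J A) = (\<Prod>a\<in>J. emeasure ?N (A a))" .
  qed (use assms(2) in auto)
qed

lemma fredholm_term_eq_fredholm_coeff:
  assumes "finite I" and G: "fredholm_blocks I M G"
  shows "fredholm_term I M G = fredholm_coeff (count_space I \<Otimes>\<^sub>M M) (block_kernel G)"
proof
  fix k :: nat
  let ?N = "count_space I \<Otimes>\<^sub>M M" and ?C = "count_space ({..<k} \<rightarrow>\<^sub>E I)" and ?P = "PiM {..<k} (\<lambda>_. M)"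
  let ?zip = "zip_points {..<k}"
  let ?D = "\<lambda>\<zeta>. ldet k (\<lambda>a b. block_kernel G (\<zeta> a) (\<zeta> b))"
  interpret N: sigma_finite_measure ?N by (rule sigma_finite_count_space_pair[OF assms(1)])
  interpret power: product_sigma_finite "\<lambda>_::nat. M" ..
  interpret P: sigma_finite_measure ?P by (rule power.sigma_finite) simp
  interpret C: sigma_finite_measure ?C
    using assms(1) by (intro sigma_finite_measure_count_space_finite finite_PiE) auto
  interpret pair: pair_sigma_finite ?C ?P ..
  have kernel: "fredholm_kernel ?N (block_kernel G)"
    by (rule fredholm_kernel_block_kernel[OF assms])
  have "integrable (PiM {..<k} (\<lambda>_. ?N)) ?D"
    by (intro N.integrable_fredholm_integrand kernel)
  then have D_zip: "integrable (?C \<Otimes>\<^sub>M ?P) (\<lambda>p. ?D (?zip p))"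
    by (intro integrable_distr[OF measurable_zip_points]) (simp add: distr_PiM_zip[OF assms(1)])
  have "fredholm_integral ?N k (\<lambda>_. block_kernel G)
      = integral\<^sup>L (distr (?C \<Otimes>\<^sub>M ?P) (PiM {..<k} (\<lambda>_. ?N)) ?zip) ?D"
    by (simp add: fredholm_integral_def distr_PiM_zip[OF assms(1)])
  also have "\<dots> = (\<integral>p. ?D (?zip p) \<partial>(?C \<Otimes>\<^sub>M ?P))"
    by (intro integral_distr[OF measurable_zip_points] kernel
        measurable_ldet_kernels[where Ks="\<lambda>a b. block_kernel G"])
  also have "\<dots> = (\<Sum>\<iota>\<in>{..<k} \<rightarrow>\<^sub>E I. \<integral>\<xi>. ?D (?zip (\<iota>, \<xi>)) \<partial>?P)"
    using assms(1) pair.integral_fst'[OF D_zip]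
    by (simp add: lebesgue_integral_count_space_finite finite_PiE)
  also have "\<dots> = (\<Sum>\<iota>\<in>{..<k} \<rightarrow>\<^sub>E I. \<integral>\<xi>. ldet k (\<lambda>a b. G (\<iota> a) (\<xi> a) (\<iota> b) (\<xi> b)) \<partial>?P)"
    by (intro sum.cong refl Bochner_Integration.integral_cong ldet_cong)
       (auto simp: block_kernel_def zip_points_def)
  finally show "fredholm_term I M G k = fredholm_coeff ?N (block_kernel G) k"
    by (simp add: fredholm_term_def fredholm_coeff_def)
qed

lemma fredholm_blocks_schur_complement:
  assumes "finite L" "L \<subseteq> I" and G: "fredholm_blocks I M G"
  shows "fredholm_blocks I M (schur_complement M L G)"
  unfolding fredholm_blocks_def
proof (intro ballI)
  fix i j assume ij: "i \<in> I" "j \<in> I"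
  have block: "fredholm_kernel M (\<lambda>x y. G i x j y)" if "i \<in> I" "j \<in> I" for i j
    using G that unfolding fredholm_blocks_def by blast
  have "fredholm_kernel M (\<lambda>x y. \<integral>z. G i x l z * G l z j y \<partial>M)" if "l \<in> L" for l
  proof -
    have "l \<in> I" using that assms(2) by blast
    from fredholm_kernel_comp[OF block[OF ij(1) this] block[OF this ij(2)]]
    show ?thesis unfolding kernel_comp_def .
  qed
  then have "fredholm_kernel M (\<lambda>x y. \<Sum>l\<in>L. \<integral>z. G i x l z * G l z j y \<partial>M)"
    by (rule fredholm_kernel_sum[OF assms(1)])
  then have "fredholm_kernel M (\<lambda>x y. G i x j y + (\<Sum>l\<in>L. \<integral>z. G i x l z * G l z j y \<partial>M))"
    by (rule fredholm_kernel_add[OF block[OF ij]])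
  then show "fredholm_kernel M (\<lambda>x y. schur_complement M L G i x j y)"
    by (cases "i \<in> L \<or> j \<in> L") (auto simp: schur_complement_def fredholm_kernel_zero)
qed

lemma kernel_comp_block_kernel_through:
  assumes "finite I" "L \<subseteq> I" and G: "fredholm_blocks I M G"
    and ij: "i \<in> I - L" "j \<in> I" and xy: "x \<in> space M" "y \<in> space M"
  shows "kernel_comp (count_space I \<Otimes>\<^sub>M M) (restrict_rows (- (L \<times> space M)) (block_kernel G))
      (restrict_rows (L \<times> space M) (block_kernel G)) (i, x) (j, y)
    = (\<Sum>l\<in>L. \<integral>z. G i x l z * G l z j y \<partial>M)"
proof -
  let ?f = "\<lambda>l z. if l \<in> L then G i x l z * G l z j y else 0"
  have "integrable M (?f l)" if "l \<in> I" for l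
    using that integrable_kernel_comp[of M "\<lambda>x z. G i x l z" "\<lambda>z y. G l z j y" x y] G ij xy
    by (cases "l \<in> L") (auto simp: fredholm_blocks_def)
  then have "(\<integral>r. ?f (fst r) (snd r) \<partial>(count_space I \<Otimes>\<^sub>M M)) = (\<Sum>l\<in>I. \<integral>z. ?f l z \<partial>M)"
    by (rule has_bochner_integral_integral_eq[OF has_bochner_integral_count_space_pair[OF assms(1), of ?f]])
  also have "\<dots> = (\<Sum>l\<in>L. \<integral>z. G i x l z * G l z j y \<partial>M)"
    using assms(1,2) by (intro sum.mono_neutral_cong_right) auto
  finally show ?thesis
    unfolding kernel_comp_def using ij(1)
    by (subst Bochner_Integration.integral_cong[OF refl, where g="\<lambda>r. ?f (fst r) (snd r)"])
       (auto simp: restrict_rows_def block_kernel_def space_pair_measure)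
qed

theorem fredholm_series_schur_complement:
  assumes "finite I" "L \<subseteq> I" and G: "fredholm_blocks I M G"
    and vanishing: "\<And>i x j y. i \<in> L \<Longrightarrow> j \<in> L \<Longrightarrow> G i x j y = 0"
  shows "\<exists>D. fredholm_term I M G sums D \<and> fredholm_term I M (schur_complement M L G) sums D"
proof -
  let ?N = "count_space I \<Otimes>\<^sub>M M" and ?S = "schur_complement M L G"
  interpret N: sigma_finite_measure ?N by (rule sigma_finite_count_space_pair[OF assms(1)])
  interpret elimination: schur_elimination ?N "block_kernel G" "L \<times> space M"
  proof
    show "fredholm_kernel ?N (block_kernel G)" by (rule fredholm_kernel_block_kernel[OF assms(1) G])
    show "L \<times> space M \<in> sets ?N" using assms(2) by simp
    show "block_kernel G p q = 0" if "p \<in> L \<times> space M" "q \<in> L \<times> space M" for p q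
      unfolding block_kernel_def using that by (intro vanishing) auto
  qed
  have "elimination.reduced p q = block_kernel ?S p q" if "p \<in> space ?N" "q \<in> space ?N" for p q
  proof -
    obtain i x j y where p: "p = (i, x)" "i \<in> I" "x \<in> space M" and q: "q = (j, y)" "j \<in> I" "y \<in> space M"
      using \<open>p \<in> space ?N\<close> \<open>q \<in> space ?N\<close> by (auto simp: space_pair_measure)
    have "elimination.detour p q = (\<Sum>l\<in>L. \<integral>z. G i x l z * G l z j y \<partial>M)" if "i \<notin> L"
      unfolding elimination.detour_def p(1) q(1)
      using that p q by (intro kernel_comp_block_kernel_through assms(1,2) G) auto
    moreover have "elimination.detour p q = 0" if "i \<in> L \<or> j \<in> L"
      using that p q by (intro elimination.detour_eq_0) auto
    moreover have "elimination.direct p q = (if i \<in> L \<or> j \<in> L then 0 else G i x j y)"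
      using p q by (simp add: elimination.direct_def block_kernel_def)
    ultimately show ?thesis
      by (simp add: elimination.reduced_def block_kernel_def schur_complement_def p(1) q(1))
  qed
  then have "fredholm_coeff ?N elimination.reduced = fredholm_coeff ?N (block_kernel ?S)"
    by (rule fredholm_coeff_cong)
  also have "\<dots> = fredholm_term I M ?S"
    using finite_subset[OF assms(2,1)] assms(2) G
    by (intro fredholm_term_eq_fredholm_coeff[OF assms(1), symmetric] fredholm_blocks_schur_complement)
  finally have "fredholm_coeff ?N elimination.reduced = fredholm_term I M ?S" .
  then show ?thesis
    using elimination.fredholm_series_reduced
    by (simp only: fredholm_term_eq_fredholm_coeff[OF assms(1) G])
qed

end

lemma fredholm_term_restrict_index:
  assumes I: "finite I" and J: "J \<subseteq> I" and row: "\<And>i x j y. i \<in> I - J \<Longrightarrow> G i x j y = 0"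
  shows "fredholm_term I M G k = fredholm_term J M G k"
proof -
  let ?D = "\<lambda>\<iota> \<xi>. ldet k (\<lambda>a b. G (\<iota> a) (\<xi> a) (\<iota> b) (\<xi> b))"
  have "(\<Sum>\<iota>\<in>{..<k} \<rightarrow>\<^sub>E I. integral\<^sup>L (PiM {..<k} (\<lambda>_. M)) (?D \<iota>))
    = (\<Sum>\<iota>\<in>{..<k} \<rightarrow>\<^sub>E J. integral\<^sup>L (PiM {..<k} (\<lambda>_. M)) (?D \<iota>))"
  proof (rule sum.mono_neutral_right)
    show "finite ({..<k} \<rightarrow>\<^sub>E I)" using I by (intro finite_PiE) auto
    show "({..<k} \<rightarrow>\<^sub>E J) \<subseteq> ({..<k} \<rightarrow>\<^sub>E I)" using J by (intro PiE_mono) auto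
    show "\<forall>\<iota>\<in>({..<k} \<rightarrow>\<^sub>E I) - ({..<k} \<rightarrow>\<^sub>E J). integral\<^sup>L (PiM {..<k} (\<lambda>_. M)) (?D \<iota>) = 0"
    proof
      fix \<iota> assume "\<iota> \<in> ({..<k} \<rightarrow>\<^sub>E I) - ({..<k} \<rightarrow>\<^sub>E J)"
      then obtain a where a: "a < k" "\<iota> a \<in> I - J" by (auto simp: PiE_def Pi_def)
      have "?D \<iota> \<xi> = 0" for \<xi>
        by (rule ldet_zero_row[OF a(1)]) (use row[OF a(2)] in auto)
      then show "integral\<^sup>L (PiM {..<k} (\<lambda>_. M)) (?D \<iota>) = 0" by simp
    qed
  qed
  then show ?thesis by (simp add: fredholm_term_def)
qed

lemma fredholm_term_cong:
  assumes "\<And>i x j y. i \<in> I \<Longrightarrow> j \<in> I \<Longrightarrow> G i x j y = H i x j y"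
  shows "fredholm_term I M G k = fredholm_term I M H k"
proof -
  have "ldet k (\<lambda>a b. G (\<iota> a) (\<xi> a) (\<iota> b) (\<xi> b)) = ldet k (\<lambda>a b. H (\<iota> a) (\<xi> a) (\<iota> b) (\<xi> b))"
    if "\<iota> \<in> {..<k} \<rightarrow>\<^sub>E I" for \<iota> \<xi>
    using that assms by (intro ldet_cong) (auto simp: PiE_def Pi_def)
  then show ?thesis by (simp add: fredholm_term_def cong: sum.cong)
qed

lemma fredholm_term_indicator_columns:
  "fredholm_term I M (\<lambda>i x j y. indicator (J i) x * P i x j y * indicator (J j) y) k
   = fredholm_term I M (\<lambda>i x j y. indicator (J i) x * P i x j y) k"
proof -
  have "ldet k (\<lambda>a b. indicator (J (\<iota> a)) (\<xi> a) * P (\<iota> a) (\<xi> a) (\<iota> b) (\<xi> b) * indicator (J (\<iota> b)) (\<xi> b))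
      = ldet k (\<lambda>a b. indicator (J (\<iota> a)) (\<xi> a) * P (\<iota> a) (\<xi> a) (\<iota> b) (\<xi> b))" for \<iota> \<xi>
  proof (cases "\<exists>b<k. \<xi> b \<notin> J (\<iota> b)")
    case True
    then obtain b where b: "b < k" "\<xi> b \<notin> J (\<iota> b)" by blast
    show ?thesis using b by (subst (1 2) ldet_zero_row[OF b(1)]) simp_all
  next
    case False
    then show ?thesis by (intro ldet_cong) auto
  qed
  then show ?thesis by (simp only: fredholm_term_def)
qed

lemma fredholm_term_reindex:
  assumes f: "bij_betw f J I"
  shows "fredholm_term I M G k = fredholm_term J M (\<lambda>i x j y. G (f i) x (f j) y) k"
proof -
  let ?g = "the_inv_into J f"
  let ?Int = "\<lambda>G \<iota>. \<integral>\<xi>. ldet k (\<lambda>a b. G (\<iota> a) (\<xi> a) (\<iota> b) (\<xi> b)) \<partial>PiM {..<k} (\<lambda>_. M)"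
  have g_f: "?g (f i) = i" "f i \<in> I" if "i \<in> J" for i
    using that f by (auto simp: the_inv_into_f_f bij_betw_def)
  have f_g: "f (?g i) = i" "?g i \<in> J" if "i \<in> I" for i
    using that f by (auto simp: f_the_inv_into_f_bij_betw bij_betw_def intro!: the_inv_into_into)
  have "(\<Sum>\<iota>\<in>{..<k} \<rightarrow>\<^sub>E I. ?Int G \<iota>) = (\<Sum>\<iota>\<in>{..<k} \<rightarrow>\<^sub>E J. ?Int (\<lambda>i x j y. G (f i) x (f j) y) \<iota>)"
  proof (rule sum.reindex_bij_witness[where i="\<lambda>\<iota>. \<lambda>a\<in>{..<k}. f (\<iota> a)" and j="\<lambda>\<iota>. \<lambda>a\<in>{..<k}. ?g (\<iota> a)"])
    fix \<iota> assume "\<iota> \<in> {..<k} \<rightarrow>\<^sub>E I"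
    then have \<iota>: "\<iota> a \<in> I" "\<iota> \<in> extensional {..<k}" if "a < k" for a using that by (auto simp: PiE_iff)
    show "(\<lambda>a\<in>{..<k}. f ((\<lambda>a\<in>{..<k}. ?g (\<iota> a)) a)) = \<iota>"
      using \<open>\<iota> \<in> {..<k} \<rightarrow>\<^sub>E I\<close> f_g by (auto simp: fun_eq_iff PiE_iff extensional_def)
    show "(\<lambda>a\<in>{..<k}. ?g (\<iota> a)) \<in> {..<k} \<rightarrow>\<^sub>E J" using \<iota> f_g by auto
    show "?Int (\<lambda>i x j y. G (f i) x (f j) y) (\<lambda>a\<in>{..<k}. ?g (\<iota> a)) = ?Int G \<iota>"
      using \<iota> f_g by (intro Bochner_Integration.integral_cong refl ldet_cong) auto
  next
    fix \<iota> assume "\<iota> \<in> {..<k} \<rightarrow>\<^sub>E J"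
    then show "(\<lambda>a\<in>{..<k}. ?g ((\<lambda>a\<in>{..<k}. f (\<iota> a)) a)) = \<iota>" "(\<lambda>a\<in>{..<k}. f (\<iota> a)) \<in> {..<k} \<rightarrow>\<^sub>E I"
      using g_f by (auto simp: fun_eq_iff PiE_iff extensional_def)
  qed
  then show ?thesis by (simp add: fredholm_term_def)
qed

lemma (in sigma_finite_measure) AE_PiM_pair:
  fixes K :: "'k set"
  assumes "AE p in M \<Otimes>\<^sub>M M. P p" and K: "finite K" "a \<in> K" "b \<in> K" "a \<noteq> b"
  shows "AE \<xi> in PiM K (\<lambda>_. M). P (\<xi> a, \<xi> b)"
proof -
  interpret power: product_sigma_finite "\<lambda>_::'k. M" ..
  interpret pair: pair_sigma_finite M M ..
  let ?L = "K - {a, b}"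
  have K_eq: "insert a (insert b ?L) = K" using K by auto
  obtain N where exceptional: "{p \<in> space (M \<Otimes>\<^sub>M M). \<not> P p} \<subseteq> N"
      and null: "emeasure (M \<Otimes>\<^sub>M M) N = 0" and [measurable]: "N \<in> sets (M \<Otimes>\<^sub>M M)"
    using assms(1) by (rule AE_E)
  let ?f = "\<lambda>\<xi>. indicator N (\<xi> a, \<xi> b) :: ennreal"
  have measurable: "?f \<in> borel_measurable (PiM (insert a (insert b ?L)) (\<lambda>_. M))" by measurable
  have "(\<integral>\<^sup>+\<xi>. ?f \<xi> \<partial>PiM K (\<lambda>_. M))
      = (\<integral>\<^sup>+\<xi>. (\<integral>\<^sup>+x. indicator N (x, \<xi> b) \<partial>M) \<partial>PiM (insert b ?L) (\<lambda>_. M))"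
    using K power.product_nn_integral_insert[OF _ _ measurable] by (simp add: K_eq)
  also have "\<dots> = (\<integral>\<^sup>+\<xi>. (\<integral>\<^sup>+y. (\<integral>\<^sup>+x. indicator N (x, y) \<partial>M) \<partial>M) \<partial>PiM ?L (\<lambda>_. M))"
    using K by (subst power.product_nn_integral_insert) auto
  also have "\<dots> = 0"
    using null by (simp add: pair.nn_integral_snd)
  finally have "AE \<xi> in PiM K (\<lambda>_. M). ?f \<xi> = 0"
    using nn_integral_0_iff_AE[OF measurable[unfolded K_eq]] by (simp add: K_eq)
  then show ?thesis
  proof (rule AE_mp[OF _ AE_I2], intro impI)
    fix \<xi> assume "\<xi> \<in> space (PiM K (\<lambda>_. M))" "?f \<xi> = 0"
    then have "(\<xi> a, \<xi> b) \<in> space (M \<Otimes>\<^sub>M M)" "(\<xi> a, \<xi> b) \<notin> N"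
      using K(2,3) by (auto simp: space_pair_measure space_PiM PiE_iff indicator_eq_0_iff)
    then show "P (\<xi> a, \<xi> b)" using exceptional by blast
  qed
qed

lemma AE_PiM_lborel_distinct_coordinates:
  fixes k :: nat
  shows "AE \<xi> in PiM {..<k} (\<lambda>_. lborel :: 'a::euclidean_space measure). inj_on \<xi> {..<k}"
proof -
  let ?P = "PiM {..<k} (\<lambda>_. lborel :: 'a measure)"
  have ne: "AE p in lborel \<Otimes>\<^sub>M lborel. fst p \<noteq> (snd p :: 'a)"
  proof (rule lborel_pair.AE_pair_measure)
    have "AE y in lborel. fst (x, y) \<noteq> snd (x, y)" for x :: 'a
      using AE_lborel_singleton[of x] by eventually_elim simp
    then show "AE x in lborel. AE y in lborel. fst (x, y) \<noteq> (snd (x, y) :: 'a)" by (rule AE_I2)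
  qed measurable
  have "AE \<xi> in ?P. \<xi> a \<noteq> \<xi> b" if "a < k" "b < k" "a \<noteq> b" for a b
    using lborel.AE_PiM_pair[OF ne, of "{..<k}" a b] that by simp
  then have "AE \<xi> in ?P. \<forall>a<k. \<forall>b<k. a \<noteq> b \<longrightarrow> \<xi> a \<noteq> \<xi> b"
    by (auto simp: AE_all_countable intro!: AE_impI)
  then show ?thesis by eventually_elim (auto simp: inj_on_def)
qed

lemma fredholm_term_cong_off_diagonal:
  fixes G H :: "'i \<Rightarrow> 'x::euclidean_space \<Rightarrow> 'i \<Rightarrow> 'x \<Rightarrow> complex"
  assumes G: "fredholm_blocks I lborel G" and H: "fredholm_blocks I lborel H"
    and off_diagonal: "\<And>i j x y. i \<in> I \<Longrightarrow> j \<in> I \<Longrightarrow> x \<noteq> y \<Longrightarrow> G i x j y = H i x j y"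
    and diagonal: "\<And>i x. i \<in> I \<Longrightarrow> G i x i x = H i x i x"
  shows "fredholm_term I lborel G k = fredholm_term I lborel H k"
proof -
  let ?P = "PiM {..<k} (\<lambda>_. lborel :: 'x measure)"
  let ?D = "\<lambda>K \<iota> \<xi>. ldet k (\<lambda>a b. K (\<iota> a) (\<xi> a) (\<iota> b) (\<xi> b))"
  have "integral\<^sup>L ?P (?D G \<iota>) = integral\<^sup>L ?P (?D H \<iota>)" if \<iota>: "\<iota> \<in> {..<k} \<rightarrow>\<^sub>E I" for \<iota>
  proof (rule integral_cong_AE)
    have integrand: "?D K \<iota> \<in> borel_measurable ?P" if "fredholm_blocks I lborel K" for K
      using that \<iota> by (intro measurable_ldet_kernels[where Ks="\<lambda>a b x y. K (\<iota> a) x (\<iota> b) y"])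
        (auto simp: fredholm_blocks_def PiE_iff)
    show "?D G \<iota> \<in> borel_measurable ?P" "?D H \<iota> \<in> borel_measurable ?P"
      by (rule integrand[OF G], rule integrand[OF H])
    show "AE \<xi> in ?P. ?D G \<iota> \<xi> = ?D H \<iota> \<xi>"
      using AE_PiM_lborel_distinct_coordinates
    proof eventually_elim
      case (elim \<xi>)
      show ?case
      proof (rule ldet_cong)
        fix a b assume ab: "a < k" "b < k"
        then have "\<iota> a \<in> I" "\<iota> b \<in> I" using \<iota> by auto
        moreover have "\<xi> a \<noteq> \<xi> b" if "a \<noteq> b" using elim ab that by (auto dest: inj_onD)
        ultimately show "G (\<iota> a) (\<xi> a) (\<iota> b) (\<xi> b) = H (\<iota> a) (\<xi> a) (\<iota> b) (\<xi> b)"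
          using diagonal off_diagonal by (cases "a = b") auto
      qed
    qed
  qed
  then show ?thesis by (simp add: fredholm_term_def cong: sum.cong)
qed

section \<open>Decay along the contours\<close>

lemma cis_3pi_div_4: "cis (3 * pi / 4) = Complex (- (1 / sqrt 2)) (1 / sqrt 2)"
  and cis_minus_3pi_div_4: "cis (- 3 * pi / 4) = Complex (- (1 / sqrt 2)) (- (1 / sqrt 2))"
proof -
  have "3 * pi / 4 = pi - pi / 4" "sqrt 2 / 2 = 1 / sqrt 2" by (simp_all add: field_simps)
  then have "cos (3 * pi / 4) = - (1 / sqrt 2)" "sin (3 * pi / 4) = 1 / sqrt 2"
    by (simp_all only: cos_pi_minus sin_pi_minus cos_45 sin_45)
  then show "cis (3 * pi / 4) = Complex (- (1 / sqrt 2)) (1 / sqrt 2)"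
    "cis (- 3 * pi / 4) = Complex (- (1 / sqrt 2)) (- (1 / sqrt 2))"
    by (simp_all add: complex_eq_iff)
qed

lemma cis_pi_div_4: "cis (pi / 4) = Complex (1 / sqrt 2) (1 / sqrt 2)"
  and cis_minus_pi_div_4: "cis (- pi / 4) = Complex (1 / sqrt 2) (- (1 / sqrt 2))"
  by (simp_all add: complex_eq_iff cos_45 sin_45 field_simps)

lemma cpt_iR: "cpt c 0 s = \<i> * of_real s"
  by (simp add: cpt_def)

lemma cpt_gamma_L: "cpt c 1 s = Complex (- (c + \<bar>s\<bar> / sqrt 2)) (- s / sqrt 2)"
  unfolding cpt_def bray_def cis_3pi_div_4 cis_minus_3pi_div_4 by (auto simp: complex_eq_iff field_simps)

lemma cpt_gamma_R: "cpt c 2 s = Complex (c + \<bar>s\<bar> / sqrt 2) (- s / sqrt 2)"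
  unfolding cpt_def bray_def cis_pi_div_4 cis_minus_pi_div_4 by (auto simp: complex_eq_iff field_simps)

lemma abs_Re_cpt_gamma:
  assumes "r \<in> {1, 2}" "0 \<le> c" shows "\<bar>Re (cpt c r s)\<bar> = c + \<bar>s\<bar> / sqrt 2"
proof -
  have "\<bar>c + \<bar>s\<bar> / sqrt 2\<bar> = c + \<bar>s\<bar> / sqrt 2" using assms by (intro abs_of_nonneg) simp
  then show ?thesis using assms(1) by (auto simp: cpt_gamma_L cpt_gamma_R simp del: One_nat_def)
qed

lemma abs_Im_cpt_gamma:
  assumes "r \<in> {1, 2}" shows "\<bar>Im (cpt c r s)\<bar> = \<bar>s\<bar> / sqrt 2"
  using assms by (auto simp: cpt_gamma_L cpt_gamma_R abs_div simp del: One_nat_def)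

lemma measurable_cpt [measurable]: "cpt c r \<in> borel_measurable borel"
  unfolding cpt_def[abs_def] bray_def by measurable

lemma measurable_cdz [measurable]: "cdz r \<in> borel_measurable borel"
  unfolding cdz_def[abs_def] bray_dz_def by measurable

lemma norm_cdz [simp]: "cmod (cdz r s) = 1"
  by (simp add: cdz_def bray_dz_def)

lemma cpt_in_iR_set [simp]: "cpt c 0 s \<in> iR_set"
  by (simp add: cpt_iR iR_set_def)

lemma cpt_in_gammaLR_set [simp]: "r \<in> {1, 2} \<Longrightarrow> cpt c r s \<in> gammaLR_set c"
  by (auto simp: gammaLR_set_def)

lemma gammaLR_iR_disjoint:
  assumes "0 < c" shows "gammaLR_set c \<inter> iR_set = {}"
proof -
  have "Re (cpt c r s) \<noteq> 0" if "r \<in> {1, 2}" for r s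
  proof -
    have "0 < c + \<bar>s\<bar> / sqrt 2" using assms by (intro add_pos_nonneg) auto
    then show ?thesis using abs_Re_cpt_gamma[OF that, of c s] assms by auto
  qed
  then show ?thesis by (auto simp: gammaLR_set_def iR_set_def)
qed

lemma cpt_gamma_iR_distance:
  assumes "r \<in> {1, 2}" "0 \<le> c" shows "c \<le> cmod (cpt c r x - cpt c 0 y)"
proof -
  have "c \<le> \<bar>Re (cpt c r x)\<bar>" using abs_Re_cpt_gamma[OF assms] by simp
  also have "\<dots> \<le> cmod (cpt c r x - cpt c 0 y)"
    using abs_Re_le_cmod[of "cpt c r x - cpt c 0 y"] by (simp add: cpt_iR)
  finally show ?thesis .
qed

lemma Theta_shift: "Theta \<tau> i x z = Theta \<tau> i 0 z - of_real x * z"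
  by (simp add: Theta_def)

lemma measurable_Theta [measurable]: "Theta \<tau> i x \<in> borel_measurable borel"
  unfolding Theta_def[abs_def] by measurable

lemma Re_Theta:
  "Re (Theta \<tau> i 0 z) = (((Re z)\<^sup>2 - (Im z)\<^sup>2)\<^sup>2 - 4 * (Re z)\<^sup>2 * (Im z)\<^sup>2) / 4
     - \<tau> i / 2 * ((Re z)\<^sup>2 - (Im z)\<^sup>2)"
proof -
  have z2: "z\<^sup>2 = Complex ((Re z)\<^sup>2 - (Im z)\<^sup>2) (2 * Re z * Im z)"
    by (simp add: complex_eq_iff power2_eq_square)
  have "z ^ 4 = (z\<^sup>2)\<^sup>2" by simp
  then have "Re (z ^ 4) = ((Re z)\<^sup>2 - (Im z)\<^sup>2)\<^sup>2 - 4 * (Re z)\<^sup>2 * (Im z)\<^sup>2"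
    by (simp only: z2) (simp add: power2_eq_square)
  then show ?thesis by (simp add: Theta_def z2)
qed

lemma Re_Theta_iR: "Re (Theta \<tau> j 0 (cpt c 0 s)) = s ^ 4 / 4 + \<tau> j / 2 * s\<^sup>2"
  unfolding Re_Theta by (simp add: cpt_iR)

lemma Re_Theta_gamma:
  fixes s :: real
  assumes "r \<in> {1, 2}" "0 \<le> c"
  defines "u \<equiv> \<bar>s\<bar> / sqrt 2"
  shows "Re (Theta \<tau> i 0 (cpt c r s))
    = c ^ 4 / 4 + c ^ 3 * u - 2 * c * u ^ 3 - u ^ 4 - \<tau> i / 2 * (c\<^sup>2 + 2 * c * u)"
proof -
  have "\<bar>Re (cpt c r s)\<bar> = c + u" "\<bar>Im (cpt c r s)\<bar> = u"
    unfolding u_def by (rule abs_Re_cpt_gamma[OF assms(1,2)], rule abs_Im_cpt_gamma[OF assms(1)])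
  then have "(Re (cpt c r s))\<^sup>2 = (c + u)\<^sup>2" "(Im (cpt c r s))\<^sup>2 = u\<^sup>2" by (metis power2_abs)+
  then show ?thesis
    unfolding Re_Theta by (simp add: field_simps power2_eq_square power3_eq_cube power4_eq_xxxx)
qed

lemma Theta_decay_iR: "\<exists>K. \<forall>s. - Re (Theta \<tau> j 0 (cpt c 0 s)) \<le> K - s\<^sup>2"
proof -
  have "- Re (Theta \<tau> j 0 (cpt c 0 s)) \<le> (1 - \<tau> j / 2)\<^sup>2 - s\<^sup>2" for s
  proof -
    have "(1 - \<tau> j / 2)\<^sup>2 - s\<^sup>2 + Re (Theta \<tau> j 0 (cpt c 0 s)) = (s\<^sup>2 / 2 - (1 - \<tau> j / 2))\<^sup>2"
      unfolding Re_Theta_iR by (simp add: power2_eq_square power4_eq_xxxx field_simps)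
    then show ?thesis using zero_le_power2[of "s\<^sup>2 / 2 - (1 - \<tau> j / 2)"] by linarith
  qed
  then show ?thesis by blast
qed

lemma quartic_upper_bound: "- (u ^ 4) / 2 + 2 * u\<^sup>2 + B * u \<le> 25 / 8 + B\<^sup>2 / 2" for u B :: real
proof -
  have "25 / 8 + B\<^sup>2 / 2 - (- (u ^ 4) / 2 + 2 * u\<^sup>2 + B * u) = (u\<^sup>2 - 5 / 2)\<^sup>2 / 2 + (B - u)\<^sup>2 / 2"
    by (simp add: power2_eq_square power4_eq_xxxx field_simps)
  then show ?thesis using zero_le_power2[of "u\<^sup>2 - 5 / 2"] zero_le_power2[of "B - u"] by linarith
qed

lemma Theta_decay_gamma:
  assumes "r \<in> {1, 2}" "0 \<le> c" "0 \<le> R"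
  shows "\<exists>K. \<forall>s. Re (Theta \<tau> i 0 (cpt c r s)) / 2 + R * cmod (cpt c r s) \<le> K - s\<^sup>2"
proof -
  define B where "B = c ^ 3 / 2 + \<bar>\<tau> i\<bar> * c / 2 + 2 * R"
  define D where "D = c ^ 4 / 8 + \<bar>\<tau> i\<bar> * c\<^sup>2 / 4 + R * c"
  have "Re (Theta \<tau> i 0 (cpt c r s)) / 2 + R * cmod (cpt c r s) \<le> (25 / 8 + B\<^sup>2 / 2 + D) - s\<^sup>2" for s
  proof -
    define u where "u = \<bar>s\<bar> / sqrt 2"
    have u: "0 \<le> u" "s\<^sup>2 = 2 * u\<^sup>2" by (auto simp: u_def power_divide)
    have "- (\<tau> i / 2 * (c\<^sup>2 + 2 * c * u)) \<le> \<bar>\<tau> i\<bar> / 2 * (c\<^sup>2 + 2 * c * u)"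
      unfolding minus_mult_left using u assms by (intro mult_right_mono) auto
    moreover have "0 \<le> 2 * c * u ^ 3" using u assms by simp
    ultimately have Theta_le: "Re (Theta \<tau> i 0 (cpt c r s))
        \<le> c ^ 4 / 4 + c ^ 3 * u - u ^ 4 + \<bar>\<tau> i\<bar> / 2 * (c\<^sup>2 + 2 * c * u)"
      unfolding Re_Theta_gamma[OF assms(1,2)] u_def[symmetric] by linarith
    have "cmod (cpt c r s) \<le> c + 2 * u"
      using cmod_le[of "cpt c r s"] abs_Re_cpt_gamma[OF assms(1,2)] abs_Im_cpt_gamma[OF assms(1)]
      by (simp add: u_def)
    then have norm_le: "R * cmod (cpt c r s) \<le> R * (c + 2 * u)" using assms(3) by (intro mult_left_mono)
    have "Re (Theta \<tau> i 0 (cpt c r s)) / 2 + R * cmod (cpt c r s) + s\<^sup>2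
        \<le> (c ^ 4 / 4 + c ^ 3 * u - u ^ 4 + \<bar>\<tau> i\<bar> / 2 * (c\<^sup>2 + 2 * c * u)) / 2 + R * (c + 2 * u) + 2 * u\<^sup>2"
      unfolding u(2) by (intro add_mono divide_right_mono Theta_le norm_le order_refl) auto
    also have "\<dots> = - (u ^ 4) / 2 + 2 * u\<^sup>2 + B * u + D"
      by (simp add: B_def D_def field_simps)
    also have "\<dots> \<le> 25 / 8 + B\<^sup>2 / 2 + D" using quartic_upper_bound[of u B] by simp
    finally show ?thesis by simp
  qed
  then show ?thesis by blast
qed

section \<open>Gaussian and exponential integrals\<close>

lemma integrable_gaussian:
  assumes "0 < \<alpha>"
  shows "integrable lborel (\<lambda>x::real. exp (- \<alpha> * x\<^sup>2))"
proof -
  define \<sigma> where "\<sigma> = 1 / sqrt (2 * \<alpha>)"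
  have \<sigma>: "0 < \<sigma>" "2 * \<sigma>\<^sup>2 = 1 / \<alpha>" using assms by (simp_all add: \<sigma>_def power_divide)
  have "integrable lborel (\<lambda>x. sqrt (2 * pi * \<sigma>\<^sup>2) * normal_density 0 \<sigma> x)"
    using integrable_normal_density[OF \<sigma>(1)] by simp
  also have "(\<lambda>x. sqrt (2 * pi * \<sigma>\<^sup>2) * normal_density 0 \<sigma> x) = (\<lambda>x. exp (- \<alpha> * x\<^sup>2))"
    using \<sigma> assms by (simp add: normal_density_def fun_eq_iff)
  finally show ?thesis .
qed

lemma integral_std_gaussian_iexp:
  "(\<integral>t. iexp (w * t) * of_real (exp (- (t\<^sup>2 / 2))) \<partial>lborel) = complex_of_real (sqrt (2 * pi) * exp (- w\<^sup>2 / 2))"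
proof -
  have "(\<integral>t. iexp (w * t) * of_real (exp (- (t\<^sup>2 / 2))) \<partial>lborel)
      = (\<integral>t. sqrt (2 * pi) *\<^sub>R (std_normal_density t *\<^sub>R iexp (w * t)) \<partial>lborel)"
    by (intro Bochner_Integration.integral_cong refl) (simp add: normal_density_def scaleR_conv_of_real mult_ac)
  also have "\<dots> = sqrt (2 * pi) *\<^sub>R char std_normal_distribution w"
    by (simp add: char_def integral_density del: scaleR_scaleR)
  finally show ?thesis by (simp add: char_std_normal_distribution scaleR_conv_of_real)
qed

lemma integral_gaussian_iexp:
  assumes "0 < T"
  shows "(\<integral>t. exp (\<i> * of_real (w * t) - of_real (T * t\<^sup>2 / 2)) \<partial>lborel)
    = complex_of_real (sqrt (2 * pi / T) * exp (- w\<^sup>2 / (2 * T)))"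
proof -
  define \<sigma> where "\<sigma> = 1 / sqrt T"
  have \<sigma>: "0 < \<sigma>" "\<sigma>\<^sup>2 = 1 / T" using assms by (simp_all add: \<sigma>_def power_divide)
  have rescaled: "exp (\<i> * of_real (w * (\<sigma> * t)) - of_real (T * (\<sigma> * t)\<^sup>2 / 2))
      = iexp ((w * \<sigma>) * t) * of_real (exp (- (t\<^sup>2 / 2)))" for t
  proof -
    have "T * (\<sigma> * t)\<^sup>2 / 2 = t\<^sup>2 / 2" using \<sigma>(2) assms by (simp add: power_mult_distrib)
    then show ?thesis by (simp only: exp_diff exp_minus mult.assoc divide_inverse of_real_inverse exp_of_real)
  qed
  have "(\<integral>t. exp (\<i> * of_real (w * t) - of_real (T * t\<^sup>2 / 2)) \<partial>lborel)
     = \<sigma> *\<^sub>R (\<integral>t. exp (\<i> * of_real (w * (\<sigma> * t)) - of_real (T * (\<sigma> * t)\<^sup>2 / 2)) \<partial>lborel)"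
    using \<sigma>(1) lborel_integral_real_affine[of \<sigma>
        "\<lambda>t. exp (\<i> * of_real (w * t) - of_real (T * t\<^sup>2 / 2))" 0] by simp
  also have "\<dots> = \<sigma> *\<^sub>R (\<integral>t. iexp ((w * \<sigma>) * t) * of_real (exp (- (t\<^sup>2 / 2))) \<partial>lborel)"
    by (simp only: rescaled)
  also have "(\<integral>t. iexp ((w * \<sigma>) * t) * of_real (exp (- (t\<^sup>2 / 2))) \<partial>lborel)
      = complex_of_real (sqrt (2 * pi) * exp (- (w * \<sigma>)\<^sup>2 / 2))"
    by (rule integral_std_gaussian_iexp)
  finally show ?thesis
    using assms by (simp add: \<sigma>_def scaleR_conv_of_real real_sqrt_divide power_divide)
qed

lemma has_bochner_integral_interval_exp:
  fixes w :: complex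
  assumes "w \<noteq> 0" "\<alpha> \<le> \<beta>"
  shows "has_bochner_integral lborel (\<lambda>z. indicator {\<alpha>..\<beta>} z * exp (of_real z * w))
    ((exp (of_real \<beta> * w) - exp (of_real \<alpha> * w)) / w)"
proof -
  have derivative: "((\<lambda>z. exp (of_real z * w) / w) has_vector_derivative exp (of_real x * w))
      (at x within {\<alpha>..\<beta>})" for x
    by (rule has_vector_derivative_real_field[where f="\<lambda>z. exp (z * w) / w"])
       (use assms(1) in \<open>auto intro!: derivative_eq_intros\<close>)
  have continuous: "continuous_on {\<alpha>..\<beta>} (\<lambda>z. exp (of_real z * w))" by (intro continuous_intros)
  have "(\<lambda>z. indicator {\<alpha>..\<beta>} z * exp (of_real z * w)) = (\<lambda>z. indicator {\<alpha>..\<beta>} z *\<^sub>R exp (of_real z * w))"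
    by (auto simp: indicator_def)
  then show ?thesis
    using has_bochner_integral_FTC_Icc[OF assms(2) derivative continuous] by (simp add: diff_divide_distrib)
qed

lemma sum_pair_differences:
  fixes e :: "nat \<Rightarrow> 'a::comm_ring_1"
  shows "(\<Sum>l\<in>{1..m}. e (2 * l) - e (2 * l - 1)) = - (\<Sum>s\<in>{1..2 * m}. (-1) ^ (s + 1) * e s)"
  by (induction m) simp_all

lemma strict_mono_on_atLeastAtMost_Suc:
  fixes f :: "nat \<Rightarrow> 'a::order"
  assumes "\<And>s. m \<le> s \<Longrightarrow> s < N \<Longrightarrow> f s < f (Suc s)"
  shows "strict_mono_on {m..N} f"
proof (rule strict_mono_onI)
  fix s t assume st: "s \<in> {m..N}" "t \<in> {m..N}" "s < t"
  then have "Suc s \<le> t" by simp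
  then have "t \<le> N \<longrightarrow> f s < f t"
  proof (induction t rule: dec_induct)
    case base
    then show ?case using assms[of s] st by simp
  next
    case (step t)
    then show ?case using assms[of t] st by (auto intro: less_trans)
  qed
  then show "f s < f t" using st by simp
qed

lemma Jset_compact: "compact (Jset a k j)"
  unfolding Jset_def by (intro compact_UN) auto

lemma Jset_borel [measurable]: "Jset a k j \<in> sets borel"
  by (intro borel_closed compact_imp_closed Jset_compact)

lemma Jset_abs_bound: "\<exists>R\<ge>0. \<forall>x\<in>Jset a k j. \<bar>x\<bar> \<le> R"
proof -
  obtain R where "\<forall>x\<in>Jset a k j. \<bar>x\<bar> \<le> R"
    using compact_imp_bounded[OF Jset_compact] unfolding bounded_iff real_norm_def by blast
  then show ?thesis by (intro exI[of _ "max R 0"]) auto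
qed

lemma indicator_Jset:
  assumes "strict_mono_on {1..2 * k j} (a j)"
  shows "(indicator (Jset a k j) x :: 'a::comm_semiring_1)
    = (\<Sum>l\<in>{1..k j}. indicator {a j (2 * l - 1)..a j (2 * l)} x)"
  unfolding Jset_def
proof (rule indicator_UN_disjoint)
  have "{a j (2 * l - 1)..a j (2 * l)} \<inter> {a j (2 * l' - 1)..a j (2 * l')} = {}"
    if "l \<in> {1..k j}" "l' \<in> {1..k j}" "l < l'" for l l'
  proof -
    have "a j (2 * l) < a j (2 * l' - 1)"
      by (rule strict_mono_onD[OF assms]) (use that in auto)
    then show ?thesis by auto
  qed
  then show "disjoint_family_on (\<lambda>l. {a j (2 * l - 1)..a j (2 * l)}) {1..k j}"
    unfolding disjoint_family_on_def by (metis Int_commute linorder_neqE_nat)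
qed simp

lemma integral_Jset_exp:
  fixes w :: complex
  assumes mono: "strict_mono_on {1..2 * k j} (a j)" and w: "w \<noteq> 0"
  shows "(\<integral>z. indicator (Jset a k j) z * exp (of_real z * w) \<partial>lborel)
    = - (\<Sum>s\<in>{1..2 * k j}. (-1) ^ (s + 1) * exp (of_real (a j s) * w)) / w"
proof -
  have "a j (2 * l - 1) \<le> a j (2 * l)" if "l \<in> {1..k j}" for l
    by (rule less_imp_le, rule strict_mono_onD[OF mono]) (use that in auto)
  then have "has_bochner_integral lborel
      (\<lambda>z. \<Sum>l\<in>{1..k j}. indicator {a j (2 * l - 1)..a j (2 * l)} z * exp (of_real z * w))
      (\<Sum>l\<in>{1..k j}. (exp (of_real (a j (2 * l)) * w) - exp (of_real (a j (2 * l - 1)) * w)) / w)"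
    by (intro has_bochner_integral_sum has_bochner_integral_interval_exp[OF w])
  then have "(\<integral>z. indicator (Jset a k j) z * exp (of_real z * w) \<partial>lborel)
      = (\<Sum>l\<in>{1..k j}. exp (of_real (a j (2 * l)) * w) - exp (of_real (a j (2 * l - 1)) * w)) / w"
    by (simp add: indicator_Jset[where a=a and k=k and j=j, OF mono]
        sum_distrib_right sum_divide_distrib has_bochner_integral_integral_eq)
  then show ?thesis
    by (simp only: sum_pair_differences[where e="\<lambda>s. exp (of_real (a j s) * w)"])
qed

section \<open>Block vectors\<close>

lemma boff_mono:
  assumes "1 \<le> m" "m < m'"
  shows "boff k m + 2 * k m \<le> boff k m'"
proof -
  have "(\<Sum>l\<in>{1..<m}. 2 * k l) + 2 * k m = (\<Sum>l\<in>{1..<Suc m}. 2 * k l)" using assms by simp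
  also have "\<dots> \<le> (\<Sum>l\<in>{1..<m'}. 2 * k l)" using assms by (intro sum_mono2) auto
  finally show ?thesis by (simp add: boff_def)
qed

lemma blockvec_nth:
  assumes m: "m \<in> {1..n}" "s \<in> {1..2 * k m}"
  shows "blockvec n k v0 blk (boff k m + s - 1) = blk m s"
proof -
  have position_eq: "boff k m + s - 1 = boff k m' + s' - 1 \<longleftrightarrow> m' = m \<and> s' = s"
    if "m' \<in> {1..n}" "s' \<in> {1..2 * k m'}" for m' s'
  proof
    assume position: "boff k m + s - 1 = boff k m' + s' - 1"
    have "m' = m"
      using boff_mono[of m m' k] boff_mono[of m' m k] m that position by (cases m m' rule: linorder_cases) auto
    then show "m' = m \<and> s' = s" using position m that by auto
  qed simp
  have "blockvec n k v0 blk (boff k m + s - 1)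
    = (\<Sum>m'\<in>{1..n}. \<Sum>s'\<in>{1..2 * k m'}. if boff k m + s - 1 = boff k m' + s' - 1 then blk m' s' else 0)"
    using m by (simp add: blockvec_def boff_def)
  also have "\<dots> = (\<Sum>m'\<in>{1..n}. \<Sum>s'\<in>{1..2 * k m'}. if m' = m \<and> s' = s then blk m' s' else 0)"
    using position_eq by (intro sum.cong refl if_cong) auto
  also have "\<dots> = (\<Sum>m'\<in>{1..n}. if m' = m then blk m s else 0)"
    using m by (intro sum.cong refl) (auto simp: sum.delta)
  also have "\<dots> = blk m s" using m by simp
  finally show ?thesis .
qed

lemma sum_over_blocks:
  fixes F :: "nat \<Rightarrow> 'a::comm_monoid_add"
  shows "(\<Sum>p<vlen n k. F p) = F 0 + (\<Sum>m\<in>{1..n}. \<Sum>s\<in>{1..2 * k m}. F (boff k m + s - 1))"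
proof (induction n)
  case 0
  show ?case by (simp add: vlen_def)
next
  case (Suc n)
  have vlen_Suc: "vlen (Suc n) k = vlen n k + 2 * k (Suc n)" by (simp add: vlen_def)
  have boff_Suc: "boff k (Suc n) = vlen n k" by (simp add: boff_def vlen_def atLeastLessThanSuc_atLeastAtMost)
  have "(\<Sum>p<vlen (Suc n) k. F p) = (\<Sum>p<vlen n k. F p) + (\<Sum>p\<in>{vlen n k..<vlen n k + 2 * k (Suc n)}. F p)"
    unfolding vlen_Suc by (simp add: lessThan_atLeast0 sum.atLeastLessThan_concat)
  also have "(\<Sum>p\<in>{vlen n k..<vlen n k + 2 * k (Suc n)}. F p) = (\<Sum>s\<in>{1..2 * k (Suc n)}. F (vlen n k + s - 1))"
    by (rule sum.reindex_bij_witness[where i="\<lambda>s. vlen n k + s - 1" and j="\<lambda>p. p - vlen n k + 1"]) auto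
  finally show ?case by (simp add: Suc boff_Suc add.assoc)
qed

lemma blockvec_inner:
  "(\<Sum>p<vlen n k. blockvec n k v0 blk p * blockvec n k w0 blk' p)
    = v0 * w0 + (\<Sum>m\<in>{1..n}. \<Sum>s\<in>{1..2 * k m}. blk m s * blk' m s)"
  unfolding sum_over_blocks
proof (intro arg_cong2[where f="(+)"] sum.cong refl)
  show "blockvec n k v0 blk 0 * blockvec n k w0 blk' 0 = v0 * w0" by (simp add: blockvec_def)
qed (simp only: blockvec_nth)

section \<open>The coupled kernel\<close>

locale pearcey_data =
  fixes n :: nat and \<tau> :: "nat \<Rightarrow> real" and k :: "nat \<Rightarrow> nat" and a :: "nat \<Rightarrow> nat \<Rightarrow> real" and c :: real
  assumes tau_step: "\<forall>i\<in>{1..<n}. \<tau> i < \<tau> (i + 1)"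
    and a_step: "\<forall>j\<in>{1..n}. \<forall>s\<in>{1..<2 * k j}. a j s < a j (s + 1)"
    and c_pos: "0 < c"
begin

lemma tau_less_iff:
  assumes "i \<in> {1..n}" "j \<in> {1..n}" shows "\<tau> i < \<tau> j \<longleftrightarrow> i < j"
proof -
  have "strict_mono_on {1..n} \<tau>"
    using tau_step by (intro strict_mono_on_atLeastAtMost_Suc) auto
  then show ?thesis using assms by (rule strict_mono_on_less)
qed

lemma a_strict_mono:
  assumes "j \<in> {1..n}" shows "strict_mono_on {1..2 * k j} (a j)"
  using a_step assms by (intro strict_mono_on_atLeastAtMost_Suc) auto

lemma cpt_iR_neq_gamma: "r \<in> {1, 2} \<Longrightarrow> cpt c 0 x \<noteq> cpt c r y"
  using gammaLR_iR_disjoint[OF c_pos] cpt_in_iR_set[of c x] cpt_in_gammaLR_set[of r c y]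
  by (metis disjoint_iff)

lemma cpt_iR_notin_gamma: "cpt c 0 x \<notin> gammaLR_set c"
  using gammaLR_iR_disjoint[OF c_pos] cpt_in_iR_set[of c x] by (auto simp: disjoint_iff)

lemma cpt_gamma_notin_iR: "r \<in> {1, 2} \<Longrightarrow> cpt c r x \<notin> iR_set"
  using gammaLR_iR_disjoint[OF c_pos] cpt_in_gammaLR_set[of r c x] by (simp add: disjoint_iff)

text \<open>An index \<open>(i, r)\<close> consists of a time \<open>i\<close> and a piece \<open>r\<close>: \<open>0\<close>, \<open>1\<close>, \<open>2\<close> are the contour pieces of \<open>cpt\<close>,
  and \<open>3\<close> is the real line carrying \<open>J\<close>. Kernels include the line element of their column variable.\<close>

definition pieces :: "nat set \<Rightarrow> (nat \<times> nat) set" where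
  "pieces R = {1..n} \<times> R"

definition contour_weight :: "nat \<Rightarrow> nat \<Rightarrow> nat \<Rightarrow> complex \<Rightarrow> complex" where
  "contour_weight i j r \<mu> =
     (if r = 0 then (if i < j then exp (of_real (\<tau> j - \<tau> i) * \<mu>\<^sup>2 / 2) else 0)
      else if i = j then exp (Theta \<tau> j 0 \<mu> / 2) else 0)"

definition coupling :: "nat \<times> nat \<Rightarrow> real \<Rightarrow> nat \<times> nat \<Rightarrow> real \<Rightarrow> complex" where
  "coupling p x q y =
     (let i = fst p; r = snd p; j = fst q; r' = snd q; \<zeta> = cpt c r x; \<mu> = cpt c r' y in
      if r = 0 \<and> r' = 3 then (if i = j then indicator (Jset a k j) y * exp (of_real y * \<zeta>) else 0)
      else if r = 3 \<and> r' \<noteq> 3 then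
        - 1 / (2 * pi * \<i>) * indicator (Jset a k i) x * exp (- of_real x * \<mu>) *
          contour_weight i j r' \<mu> * cdz r' y
      else if r \<in> {1, 2} \<and> r' = 0 then
        1 / (2 * pi * \<i>) * (exp (Theta \<tau> i 0 \<zeta> / 2 - Theta \<tau> j 0 \<mu>) / (\<zeta> - \<mu>)) * cdz 0 y
      else 0)"

lemma coupling_iR_J:
  "coupling (i, 0) x (j, 3) y = (if i = j then indicator (Jset a k j) y * exp (of_real y * cpt c 0 x) else 0)"
  by (simp add: coupling_def)

lemma coupling_J_contour:
  "r \<in> {0, 1, 2} \<Longrightarrow> coupling (i, 3) x (j, r) y = - 1 / (2 * pi * \<i>) * indicator (Jset a k i) x *
     exp (- of_real x * cpt c r y) * contour_weight i j r (cpt c r y) * cdz r y"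
  by (auto simp: coupling_def Let_def)

lemma coupling_gamma_iR:
  "r \<in> {1, 2} \<Longrightarrow> coupling (i, r) x (j, 0) y = 1 / (2 * pi * \<i>) *
     (exp (Theta \<tau> i 0 (cpt c r x) / 2 - Theta \<tau> j 0 (cpt c 0 y)) / (cpt c r x - cpt c 0 y)) * cdz 0 y"
  by (auto simp: coupling_def Let_def)

lemma coupling_eq_0:
  "r = 0 \<and> r' \<noteq> 3 \<or> r = 3 \<and> r' = 3 \<or> r \<in> {1, 2} \<and> r' \<noteq> 0 \<Longrightarrow> coupling (i, r) x (j, r') y = 0"
  by (auto simp: coupling_def Let_def)

lemma fredholm_kernel_iR_J:
  "fredholm_kernel lborel (\<lambda>x y. indicator (Jset a k j) y * exp (of_real y * cpt c 0 x))"
proof (rule fredholm_kernelI)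
  show "integrable lborel (indicator (Jset a k j) :: real \<Rightarrow> real)"
    using emeasure_bounded_finite[OF compact_imp_bounded[OF Jset_compact]]
    by (intro integrable_real_indicator) auto
  show "(\<lambda>(x, y). indicator (Jset a k j) y * exp (of_real y * cpt c 0 x))
      \<in> borel_measurable (lborel \<Otimes>\<^sub>M lborel)"
    by measurable
qed (auto simp: norm_mult cpt_iR indicator_def)

lemma fredholm_kernel_J_iR:
  assumes "\<tau> i < \<tau> j"
  shows "fredholm_kernel lborel (\<lambda>x y. indicator (Jset a k i) x *
    exp (- of_real x * cpt c 0 y) * exp (of_real (\<tau> j - \<tau> i) * (cpt c 0 y)\<^sup>2 / 2) * cdz 0 y)"
    (is "fredholm_kernel lborel ?G")
proof (rule fredholm_kernelI)
  show "(\<lambda>(x, y). ?G x y) \<in> borel_measurable (lborel \<Otimes>\<^sub>M lborel)" by measurable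
  show "integrable lborel (\<lambda>y. exp (- ((\<tau> j - \<tau> i) / 2) * y\<^sup>2))"
    using assms by (intro integrable_gaussian) simp
  show "cmod (?G x y) \<le> exp (- ((\<tau> j - \<tau> i) / 2) * y\<^sup>2)" for x y
    by (simp add: norm_mult cpt_iR power_mult_distrib indicator_def)
qed

lemma fredholm_kernel_J_gamma:
  assumes r: "r \<in> {1, 2}"
  shows "fredholm_kernel lborel (\<lambda>x y. indicator (Jset a k i) x *
    exp (- of_real x * cpt c r y) * exp (Theta \<tau> i 0 (cpt c r y) / 2) * cdz r y)"
    (is "fredholm_kernel lborel ?G")
proof -
  obtain R where R: "0 \<le> R" "\<forall>x\<in>Jset a k i. \<bar>x\<bar> \<le> R" using Jset_abs_bound by blast
  obtain K where K: "\<And>s. Re (Theta \<tau> i 0 (cpt c r s)) / 2 + R * cmod (cpt c r s) \<le> K - s\<^sup>2"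
    using Theta_decay_gamma[OF r less_imp_le[OF c_pos] R(1)] by blast
  show ?thesis
  proof (rule fredholm_kernelI)
    show "(\<lambda>(x, y). ?G x y) \<in> borel_measurable (lborel \<Otimes>\<^sub>M lborel)" by measurable
    show "integrable lborel (\<lambda>y. exp K * exp (- 1 * y\<^sup>2))"
      using integrable_gaussian[of 1] by simp
    fix x y
    show "cmod (?G x y) \<le> exp K * exp (- 1 * y\<^sup>2)"
    proof (cases "x \<in> Jset a k i")
      case True
      have "- (x * Re (cpt c r y)) \<le> \<bar>x\<bar> * \<bar>Re (cpt c r y)\<bar>" by (metis abs_mult abs_ge_minus_self)
      also have "\<dots> \<le> R * cmod (cpt c r y)" using R True by (intro mult_mono abs_Re_le_cmod) auto
      finally have "- (x * Re (cpt c r y)) + Re (Theta \<tau> i 0 (cpt c r y)) / 2 \<le> K - y\<^sup>2"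
        using K[of y] by linarith
      then show ?thesis using True by (simp add: norm_mult flip: exp_add)
    qed simp
  qed
qed

lemma fredholm_kernel_gamma_iR:
  assumes r: "r \<in> {1, 2}"
  shows "fredholm_kernel lborel (\<lambda>x y.
    exp (Theta \<tau> i 0 (cpt c r x) / 2 - Theta \<tau> j 0 (cpt c 0 y)) / (cpt c r x - cpt c 0 y) * cdz 0 y)"
    (is "fredholm_kernel lborel ?G")
proof -
  obtain K where K: "\<And>s. Re (Theta \<tau> i 0 (cpt c r s)) / 2 \<le> K - s\<^sup>2"
    using Theta_decay_gamma[OF r less_imp_le[OF c_pos], of 0 \<tau> i] by auto
  obtain L where L: "\<And>s. - Re (Theta \<tau> j 0 (cpt c 0 s)) \<le> L - s\<^sup>2"
    using Theta_decay_iR by blast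
  show ?thesis
  proof (rule fredholm_kernelI)
    show "(\<lambda>(x, y). ?G x y) \<in> borel_measurable (lborel \<Otimes>\<^sub>M lborel)" by measurable
    show "integrable lborel (\<lambda>y. exp (K + L) / c * exp (- 1 * y\<^sup>2))"
      using integrable_gaussian[of 1] by simp
    fix x y
    have "Re (Theta \<tau> i 0 (cpt c r x)) / 2 - Re (Theta \<tau> j 0 (cpt c 0 y)) \<le> K + L - y\<^sup>2"
      using K[of x] L[of y] zero_le_power2[of x] by linarith
    then have "cmod (?G x y) \<le> exp (K + L - y\<^sup>2) / c"
      using c_pos cpt_gamma_iR_distance[OF r less_imp_le[OF c_pos], of x y]
      by (simp add: norm_mult norm_divide frac_le)
    then show "cmod (?G x y) \<le> exp (K + L) / c * exp (- 1 * y\<^sup>2)"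
      by (simp add: exp_diff exp_minus field_simps)
  qed
qed

lemma fredholm_kernel_coupling_J_row:
  assumes "i \<in> {1..n}" "j \<in> {1..n}" "r \<in> {0, 1, 2}"
  shows "fredholm_kernel lborel (\<lambda>x y. coupling (i, 3) x (j, r) y)"
proof -
  consider (iR) "r = 0" "i < j" | (gamma) "r \<in> {1, 2}" "i = j" | (zero) "r = 0 \<longrightarrow> \<not> i < j" "r \<noteq> 0 \<longrightarrow> i \<noteq> j"
    using assms(3) by (cases "r = 0"; cases "i = j") auto
  then show ?thesis
  proof cases
    case iR
    then have "\<tau> i < \<tau> j" using tau_less_iff assms(1,2) by simp
    note kernel = fredholm_kernel_scale[OF fredholm_kernel_J_iR[OF this], of "- 1 / (2 * pi * \<i>)"]
    show ?thesis
      by (rule fredholm_kernel_cong[OF kernel]) (simp add: iR coupling_J_contour contour_weight_def)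
  next
    case gamma
    note kernel = fredholm_kernel_scale[OF fredholm_kernel_J_gamma[OF gamma(1), of i],
      of "- 1 / (2 * pi * \<i>)"]
    show ?thesis
      by (rule fredholm_kernel_cong[OF kernel])
         (use gamma in \<open>auto simp: coupling_J_contour contour_weight_def\<close>)
  next
    case zero
    then show ?thesis
      by (intro fredholm_kernel_cong[OF fredholm_kernel_zero])
         (simp add: coupling_J_contour[OF assms(3)] contour_weight_def)
  qed
qed

lemma fredholm_blocks_coupling: "fredholm_blocks (pieces {0, 1, 2, 3}) lborel coupling"
  unfolding fredholm_blocks_def
proof (intro ballI)
  fix p q assume "p \<in> pieces {0, 1, 2, 3}" "q \<in> pieces {0, 1, 2, 3}"
  then obtain i r j r' where p: "p = (i, r)" "i \<in> {1..n}" "r \<in> {0, 1, 2, 3}"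
    and q: "q = (j, r')" "j \<in> {1..n}" "r' \<in> {0, 1, 2, 3}"
    by (auto simp: pieces_def)
  consider (iR_J) "r = 0" "r' = 3" | (J_contour) "r = 3" "r' \<in> {0, 1, 2}" | (gamma_iR) "r \<in> {1, 2}" "r' = 0"
    | (zero) "r = 0 \<and> r' \<noteq> 3 \<or> r = 3 \<and> r' = 3 \<or> r \<in> {1, 2} \<and> r' \<noteq> 0"
    using p(3) q(3) by auto
  then show "fredholm_kernel lborel (\<lambda>x y. coupling p x q y)"
  proof cases
    case iR_J
    note kernel = fredholm_kernel_if[OF fredholm_kernel_iR_J[of j], of "\<lambda>x y. i = j"]
    show ?thesis by (rule fredholm_kernel_cong[OF kernel]) (simp_all add: p(1) q(1) iR_J coupling_iR_J)
  next
    case J_contour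
    then show ?thesis using fredholm_kernel_coupling_J_row[OF p(2) q(2), of r'] by (simp only: p(1) q(1))
  next
    case gamma_iR
    note kernel = fredholm_kernel_scale[OF fredholm_kernel_gamma_iR[OF gamma_iR(1), of i j],
      of "1 / (2 * pi * \<i>)"]
    show ?thesis
      by (rule fredholm_kernel_cong[OF kernel])
         (simp add: p(1) q(1) gamma_iR(2) coupling_gamma_iR[OF gamma_iR(1)])
  next
    case zero
    show ?thesis
      by (rule fredholm_kernel_cong[OF fredholm_kernel_zero]) (simp only: p(1) q(1) coupling_eq_0[OF zero])
  qed
qed

lemma sum_pieces: "(\<Sum>l\<in>pieces R. f l) = (\<Sum>m\<in>{1..n}. \<Sum>r\<in>R. f (m, r))"
  by (simp add: pieces_def sum.cartesian_product case_prod_beta)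

abbreviation schur_J :: "nat \<times> nat \<Rightarrow> real \<Rightarrow> nat \<times> nat \<Rightarrow> real \<Rightarrow> complex" where
  "schur_J \<equiv> schur_complement lborel (pieces {3}) coupling"

lemma schur_J_iR_row:
  assumes "i \<in> {1..n}" and r: "r \<in> {0, 1, 2}"
  shows "schur_J (i, 0) x (j, r) y = - 1 / (2 * pi * \<i>) * contour_weight i j r (cpt c r y) * cdz r y *
    (\<integral>z. indicator (Jset a k i) z * exp (of_real z * (cpt c 0 x - cpt c r y)) \<partial>lborel)"
proof -
  let ?C = "- 1 / (2 * pi * \<i>) * contour_weight i j r (cpt c r y) * cdz r y"
  have "schur_J (i, 0) x (j, r) y
      = (\<Sum>m\<in>{1..n}. \<integral>z. coupling (i, 0) x (m, 3) z * coupling (m, 3) z (j, r) y \<partial>lborel)"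
    using r by (auto simp: schur_complement_def sum_pieces coupling_eq_0) (auto simp: pieces_def)
  also have "\<dots> = (\<Sum>m\<in>{i}. \<integral>z. coupling (i, 0) x (m, 3) z * coupling (m, 3) z (j, r) y \<partial>lborel)"
    using assms by (intro sum.mono_neutral_right) (auto simp: coupling_iR_J)
  also have "\<dots> = (\<integral>z. ?C * (indicator (Jset a k i) z * exp (of_real z * (cpt c 0 x - cpt c r y))) \<partial>lborel)"
  proof -
    have "exp (of_real z * cpt c 0 x) * exp (- of_real z * cpt c r y)
        = exp (of_real z * (cpt c 0 x - cpt c r y))" for z
      by (simp add: exp_add[symmetric] algebra_simps)
    then have "coupling (i, 0) x (i, 3) z * coupling (i, 3) z (j, r) y
        = ?C * (indicator (Jset a k i) z * exp (of_real z * (cpt c 0 x - cpt c r y)))" for z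
      unfolding coupling_iR_J coupling_J_contour[OF r] by (cases "z \<in> Jset a k i") (simp_all add: mult_ac)
    then show ?thesis by simp
  qed
  finally show ?thesis by (simp only: Bochner_Integration.integral_mult_right_zero)
qed

lemma schur_J_gamma_row:
  assumes "r \<in> {1, 2}" "r' \<in> {0, 1, 2}"
  shows "schur_J (i, r) x (j, r') y = coupling (i, r) x (j, r') y"
proof -
  have "coupling (i, r) x (m, 3) z = 0" for m z using assms(1) by (intro coupling_eq_0) auto
  then show ?thesis using assms by (auto simp: schur_complement_def sum_pieces) (auto simp: pieces_def)
qed

lemma gP_block_at_contour:
  fixes y :: real
  assumes r: "r \<in> {0, 1, 2}"
  defines "\<mu> \<equiv> cpt c r y"
  shows "(if i < j
      then (-1) ^ (s + 1) * exp (- of_real (a i s) * \<mu> + of_real (\<tau> j - \<tau> i) * \<mu>\<^sup>2 / 2) * indicator iR_set \<mu>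
      else if i = j
      then (-1) ^ (s + 1) * exp (Theta \<tau> j 0 \<mu> / 2 - of_real (a j s) * \<mu>) * indicator (gammaLR_set c) \<mu>
      else 0)
    = (-1) ^ (s + 1) * exp (- of_real (a i s) * \<mu>) * contour_weight i j r \<mu>"
proof (cases "r = 0")
  case True
  have "exp (- of_real (a i s) * \<mu> + of_real (\<tau> j - \<tau> i) * \<mu>\<^sup>2 / 2)
      = exp (- of_real (a i s) * \<mu>) * exp (of_real (\<tau> j - \<tau> i) * \<mu>\<^sup>2 / 2)"
    by (rule exp_add)
  moreover have "indicator iR_set \<mu> = (1 :: complex)" "indicator (gammaLR_set c) \<mu> = (0 :: complex)"
    using True cpt_iR_notin_gamma by (simp_all add: \<mu>_def)
  ultimately show ?thesis
    using True by (simp only: contour_weight_def) simp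
next
  case False
  then have "r \<in> {1, 2}" using r by auto
  then have "indicator iR_set \<mu> = (0 :: complex)" "indicator (gammaLR_set c) \<mu> = (1 :: complex)"
    using cpt_gamma_notin_iR cpt_in_gammaLR_set unfolding \<mu>_def
    by (simp_all only: indicator_simps not_False_eq_True)
  moreover have "exp (Theta \<tau> j 0 \<mu> / 2 - of_real z * \<mu>)
      = exp (- of_real z * \<mu>) * exp (Theta \<tau> j 0 \<mu> / 2)" for z
    by (simp add: exp_add[symmetric])
  ultimately show ?thesis using False by (simp add: contour_weight_def)
qed

lemma KP_at_contour:
  fixes y :: real
  assumes i: "i \<in> {1..n}" and r: "r \<in> {0, 1, 2}"
  defines "\<mu> \<equiv> cpt c r y"
  shows "KP \<tau> a k n c i j \<zeta> \<mu> = 1 / (2 * pi * \<i>) *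
    (exp (Theta \<tau> i 0 \<zeta> / 2) * indicator (gammaLR_set c) \<zeta> * (exp (- Theta \<tau> j 0 \<mu>) * indicator iR_set \<mu>)
     + indicator iR_set \<zeta> * contour_weight i j r \<mu> *
       (\<Sum>s\<in>{1..2 * k i}. (-1) ^ (s + 1) * exp (of_real (a i s) * (\<zeta> - \<mu>)))) / (\<zeta> - \<mu>)"
proof -
  let ?f = "\<lambda>m s. if m = i then exp (of_real (a i s) * \<zeta>) * indicator iR_set \<zeta> else 0"
  let ?g = "\<lambda>m s. if m < j
    then (-1) ^ (s + 1) * exp (- of_real (a m s) * \<mu> + of_real (\<tau> j - \<tau> m) * \<mu>\<^sup>2 / 2) * indicator iR_set \<mu>
    else if m = j
    then (-1) ^ (s + 1) * exp (Theta \<tau> j 0 \<mu> / 2 - of_real (a j s) * \<mu>) * indicator (gammaLR_set c) \<mu>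
    else 0"
  have "(\<Sum>m\<in>{1..n}. \<Sum>s\<in>{1..2 * k m}. ?f m s * ?g m s) = (\<Sum>m\<in>{i}. \<Sum>s\<in>{1..2 * k m}. ?f m s * ?g m s)"
    using i by (intro sum.mono_neutral_right) auto
  also have "\<dots> = (\<Sum>s\<in>{1..2 * k i}. ?f i s * ?g i s)" by simp
  also have "\<dots> = indicator iR_set \<zeta> * contour_weight i j r \<mu> *
      (\<Sum>s\<in>{1..2 * k i}. (-1) ^ (s + 1) * exp (of_real (a i s) * (\<zeta> - \<mu>)))"
  proof -
    have exp_eq: "exp (of_real z * \<zeta>) * exp (- of_real z * \<mu>) = exp (of_real z * (\<zeta> - \<mu>))" for z
      by (simp add: exp_add[symmetric] algebra_simps)
    have "?f i s * ?g i s = indicator iR_set \<zeta> * contour_weight i j r \<mu> *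
        ((-1) ^ (s + 1) * (exp (of_real (a i s) * \<zeta>) * exp (- of_real (a i s) * \<mu>)))" for s
      unfolding \<mu>_def gP_block_at_contour[OF r] by simp
    then show ?thesis by (simp only: exp_eq sum_distrib_left)
  qed
  finally show ?thesis
    unfolding KP_def fP_def gP_def blockvec_inner by simp
qed

lemma KP_param_iR_row:
  assumes i: "i \<in> {1..n}" and r: "r \<in> {0, 1, 2}" and ne: "cpt c 0 x \<noteq> cpt c r y"
  shows "KP_param \<tau> a k n c (i, 0) x (j, r) y = schur_J (i, 0) x (j, r) y"
proof -
  let ?\<zeta> = "cpt c 0 x" and ?\<mu> = "cpt c r y"
  let ?S = "\<Sum>s\<in>{1..2 * k i}. (-1) ^ (s + 1) * exp (of_real (a i s) * (?\<zeta> - ?\<mu>))"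
  have "schur_J (i, 0) x (j, r) y
      = - 1 / (2 * pi * \<i>) * contour_weight i j r ?\<mu> * cdz r y * (- ?S / (?\<zeta> - ?\<mu>))"
    using ne integral_Jset_exp[where a=a and k=k and w="?\<zeta> - ?\<mu>", OF a_strict_mono[OF i]]
    by (simp only: schur_J_iR_row[OF i r] right_minus_eq not_False_eq_True)
  moreover have "KP_param \<tau> a k n c (i, 0) x (j, r) y
      = 1 / (2 * pi * \<i>) * (contour_weight i j r ?\<mu> * ?S) / (?\<zeta> - ?\<mu>) * cdz r y"
    using cpt_iR_notin_gamma[of x]
    by (simp add: KP_param_def KP_at_contour[OF i r] del: sum.cl_ivl_Suc)
  ultimately show ?thesis by simp
qed

lemma KP_param_gamma_row:
  assumes i: "i \<in> {1..n}" and r: "r \<in> {1, 2}" and r': "r' \<in> {0, 1, 2}"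
  shows "KP_param \<tau> a k n c (i, r) x (j, r') y = schur_J (i, r) x (j, r') y"
proof -
  have \<zeta>: "cpt c r x \<notin> iR_set" "cpt c r x \<in> gammaLR_set c"
    using r by (simp_all add: cpt_gamma_notin_iR del: One_nat_def insert_iff)
  show ?thesis
  proof (cases "r' = 0")
    case True
    have "exp (Theta \<tau> i 0 (cpt c r x) / 2) * exp (- Theta \<tau> j 0 (cpt c 0 y))
        = exp (Theta \<tau> i 0 (cpt c r x) / 2 - Theta \<tau> j 0 (cpt c 0 y))"
      by (simp add: exp_add[symmetric])
    then show ?thesis
      unfolding schur_J_gamma_row[OF r r'] unfolding True coupling_gamma_iR[OF r]
      by (simp add: KP_param_def KP_at_contour[OF i insertI1] \<zeta>)
  next
    case False
    then have \<mu>: "cpt c r' y \<notin> iR_set" using r' by (intro cpt_gamma_notin_iR) auto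
    have "coupling (i, r) x (j, r') y = 0" using r False by (intro coupling_eq_0) auto
    then show ?thesis
      unfolding schur_J_gamma_row[OF r r'] by (simp add: KP_param_def KP_at_contour[OF i r'] \<zeta> \<mu>)
  qed
qed

lemma KP_param_eq_schur_J:
  assumes "p \<in> pieces {0, 1, 2}" "q \<in> pieces {0, 1, 2}"
  shows "KP_param \<tau> a k n c p x q y
    = (if cpt c (snd p) x = cpt c (snd q) y then 0 else schur_J p x q y)"
proof -
  obtain i r j r' where p: "p = (i, r)" "i \<in> {1..n}" "r \<in> {0, 1, 2}"
    and q: "q = (j, r')" "j \<in> {1..n}" "r' \<in> {0, 1, 2}"
    using assms by (auto simp: pieces_def)
  show ?thesis
  proof (cases "cpt c r x = cpt c r' y")
    case True
    then show ?thesis by (simp add: KP_param_def KP_def p(1) q(1))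
  next
    case False
    have "KP_param \<tau> a k n c p x q y = schur_J p x q y"
    proof (cases "r = 0")
      case True
      with False show ?thesis by (simp only: p(1) q(1) KP_param_iR_row[OF p(2) q(3)] not_False_eq_True)
    next
      case False
      then have "r \<in> {1, 2}" using p(3) by auto
      then show ?thesis by (simp only: p(1) q(1) KP_param_gamma_row[OF p(2) _ q(3)])
    qed
    then show ?thesis using False by (simp add: p(1) q(1))
  qed
qed

lemma schur_J_eq_0:
  assumes "p \<in> pieces {0, 1, 2}" "q \<in> pieces {0, 1, 2}" "cpt c (snd p) x = cpt c (snd q) y" "x \<noteq> y \<or> p = q"
  shows "schur_J p x q y = 0"
proof -
  obtain i r j r' where p: "p = (i, r)" "i \<in> {1..n}" "r \<in> {0, 1, 2}"
    and q: "q = (j, r')" "j \<in> {1..n}" "r' \<in> {0, 1, 2}"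
    using assms(1,2) by (auto simp: pieces_def)
  have "r = 0 \<longleftrightarrow> r' = 0"
    using assms(3) p(3) q(3) cpt_iR_neq_gamma[of r x y] cpt_iR_neq_gamma[of r' x y] cpt_iR_neq_gamma[of r y x]
    by (auto simp: p(1) q(1))
  then consider (iR) "r = 0" "r' = 0" | (gamma) "r \<in> {1, 2}" "r' \<in> {1, 2}"
    using p(3) q(3) by auto
  then show ?thesis
  proof cases
    case iR
    then have "x = y" using assms(3) by (simp add: p(1) q(1) cpt_iR)
    then have "i = j" using assms(4) by (simp add: p(1) q(1))
    then show ?thesis using iR schur_J_iR_row[OF p(2), of 0 x j y] by (simp add: p(1) q(1) contour_weight_def)
  next
    case gamma
    have "coupling (i, r) x (j, r') y = 0" using gamma by (intro coupling_eq_0) auto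
    then show ?thesis by (simp only: p(1) q(1) schur_J_gamma_row[OF gamma(1) q(3)])
  qed
qed

lemma fredholm_blocks_schur_J: "fredholm_blocks (pieces {0, 1, 2, 3}) lborel schur_J"
  by (intro lborel.fredholm_blocks_schur_complement fredholm_blocks_coupling) (auto simp: pieces_def)

lemma fredholm_term_KP_param:
  "fredholm_term (pieces {0, 1, 2}) lborel (KP_param \<tau> a k n c) N
    = fredholm_term (pieces {0, 1, 2, 3}) lborel schur_J N"
proof -
  have schur: "fredholm_blocks (pieces {0, 1, 2}) lborel schur_J"
    by (rule fredholm_blocks_subset[OF fredholm_blocks_schur_J]) (auto simp: pieces_def)
  have "fredholm_blocks (pieces {0, 1, 2}) lborel (KP_param \<tau> a k n c)"
    unfolding fredholm_blocks_def
  proof (intro ballI)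
    fix p q assume pq: "p \<in> pieces {0, 1, 2}" "q \<in> pieces {0, 1, 2}"
    have "fredholm_kernel lborel (\<lambda>x y. schur_J p x q y)"
      using schur pq unfolding fredholm_blocks_def by blast
    then have "fredholm_kernel lborel (\<lambda>x y. if cpt c (snd p) x \<noteq> cpt c (snd q) y then schur_J p x q y else 0)"
      by (rule fredholm_kernel_if) measurable
    then show "fredholm_kernel lborel (\<lambda>x y. KP_param \<tau> a k n c p x q y)"
      by (rule fredholm_kernel_cong) (simp add: KP_param_eq_schur_J[OF pq])
  qed
  then have "fredholm_term (pieces {0, 1, 2}) lborel (KP_param \<tau> a k n c) N
      = fredholm_term (pieces {0, 1, 2}) lborel schur_J N"
    by (rule fredholm_term_cong_off_diagonal[OF _ schur]) (auto simp: KP_param_eq_schur_J schur_J_eq_0)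
  also have "\<dots> = fredholm_term (pieces {0, 1, 2, 3}) lborel schur_J N"
    by (rule fredholm_term_restrict_index[symmetric]) (auto simp: schur_complement_def pieces_def)
  finally show ?thesis .
qed

abbreviation schur_iR :: "nat \<times> nat \<Rightarrow> real \<Rightarrow> nat \<times> nat \<Rightarrow> real \<Rightarrow> complex" where
  "schur_iR \<equiv> schur_complement lborel (pieces {0}) coupling"

lemma schur_iR_J_column:
  assumes "j \<in> {1..n}" and r: "r \<in> {1, 2, 3}"
  shows "schur_iR (i, r) x (j, 3) y
    = (\<integral>t. coupling (i, r) x (j, 0) t * (indicator (Jset a k j) y * exp (of_real y * cpt c 0 t)) \<partial>lborel)"
proof -
  have "coupling (i, r) x (j, 3) y = 0" using r by (intro coupling_eq_0) auto
  then have "schur_iR (i, r) x (j, 3) y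
      = (\<Sum>m\<in>{1..n}. \<integral>t. coupling (i, r) x (m, 0) t * coupling (m, 0) t (j, 3) y \<partial>lborel)"
    using r by (auto simp: schur_complement_def sum_pieces) (auto simp: pieces_def)
  also have "\<dots> = (\<Sum>m\<in>{j}. \<integral>t. coupling (i, r) x (m, 0) t * coupling (m, 0) t (j, 3) y \<partial>lborel)"
    using assms by (intro sum.mono_neutral_right) (auto simp: coupling_iR_J)
  finally show ?thesis by (simp add: coupling_iR_J)
qed

lemma schur_iR_gamma_column:
  assumes "r \<in> {1, 2, 3}" "r' \<in> {1, 2}"
  shows "schur_iR (i, r) x (j, r') y = coupling (i, r) x (j, r') y"
proof -
  have "coupling (m, 0) z (j, r') y = 0" for m z using assms(2) by (intro coupling_eq_0) auto
  then show ?thesis using assms by (auto simp: schur_complement_def sum_pieces) (auto simp: pieces_def)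
qed

lemma schur_iR_gamma_gamma:
  assumes "p \<in> pieces {1, 2}" "q \<in> pieces {1, 2}"
  shows "schur_iR p x q y = 0"
proof -
  obtain i r j r' where p: "p = (i, r)" "r \<in> {1, 2}" and q: "q = (j, r')" "r' \<in> {1, 2}"
    using assms by (auto simp: pieces_def)
  then have "coupling (i, r) x (j, r') y = 0" by (intro coupling_eq_0) auto
  then show ?thesis using p q schur_iR_gamma_column[of r r' i x j y] by auto
qed

lemma gaussian_normalization:
  assumes "0 < T"
  shows "sqrt (2 * pi / T) / (2 * pi) = 1 / sqrt (2 * pi * T)"
proof -
  have "sqrt (2 * pi / T) * sqrt (2 * pi * T) = sqrt ((2 * pi)\<^sup>2)"
    using assms unfolding real_sqrt_mult[symmetric] by (simp add: power2_eq_square)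
  also have "\<dots> = 2 * pi" by (simp only: real_sqrt_abs) simp
  finally show ?thesis using assms by (simp add: field_simps)
qed

lemma schur_iR_J_J:
  assumes "i \<in> {1..n}" "j \<in> {1..n}"
  shows "schur_iR (i, 3) x (j, 3) y = - (indicator (Jset a k i) x * Qker \<tau> i j x y * indicator (Jset a k j) y)"
proof (cases "i < j")
  case True
  define T where "T = \<tau> j - \<tau> i"
  have T: "0 < T" using tau_less_iff[OF assms] True by (simp add: T_def)
  let ?\<chi> = "indicator (Jset a k i) x * indicator (Jset a k j) y :: complex"
  let ?C = "- 1 / (2 * complex_of_real pi) * ?\<chi>"
  have "coupling (i, 3) x (j, 0) t * (indicator (Jset a k j) y * exp (of_real y * cpt c 0 t))
      = ?C * exp (\<i> * of_real ((y - x) * t) - of_real (T * t\<^sup>2 / 2))" for t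
  proof -
    have "exp (- of_real x * cpt c 0 t) * exp (of_real (\<tau> j - \<tau> i) * (cpt c 0 t)\<^sup>2 / 2)
          * exp (of_real y * cpt c 0 t)
        = exp (\<i> * of_real ((y - x) * t) - of_real (T * t\<^sup>2 / 2))"
      unfolding exp_add[symmetric]
      by (rule arg_cong[where f=exp]) (simp add: cpt_iR power_mult_distrib T_def field_simps)
    then show ?thesis
      using True by (simp add: coupling_J_contour contour_weight_def cdz_def mult_ac)
  qed
  then have "schur_iR (i, 3) x (j, 3) y
      = (\<integral>t. ?C * exp (\<i> * of_real ((y - x) * t) - of_real (T * t\<^sup>2 / 2)) \<partial>lborel)"
    using schur_iR_J_column[OF assms(2), of 3 i x y] by simp
  also have "\<dots> = ?C * of_real (sqrt (2 * pi / T) * exp (- (y - x)\<^sup>2 / (2 * T)))"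
    by (simp only: Bochner_Integration.integral_mult_right_zero integral_gaussian_iexp[OF T])
  also have "\<dots> = - (?\<chi> * of_real (sqrt (2 * pi / T) / (2 * pi) * exp (- (y - x)\<^sup>2 / (2 * T))))"
    by simp
  also have "\<dots> = - (indicator (Jset a k i) x * Qker \<tau> i j x y * indicator (Jset a k j) y)"
    using T unfolding gaussian_normalization[OF T] by (simp add: Qker_def T_def power2_commute mult_ac)
  finally show ?thesis .
next
  case False
  then show ?thesis
    using tau_less_iff[OF assms] schur_iR_J_column[OF assms(2), of 3 i x y]
    by (simp add: coupling_J_contour contour_weight_def Qker_def)
qed

lemma schur_iR_gamma_J:
  assumes r: "r \<in> {1, 2}" and j: "j \<in> {1..n}"
  shows "schur_iR (i, r) s (j, 3) y = 1 / (2 * pi * \<i>) * indicator (Jset a k j) y *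
    (\<integral>t. exp (Theta \<tau> i 0 (cpt c r s) / 2 - Theta \<tau> j y (cpt c 0 t)) /
      (cpt c r s - cpt c 0 t) * cdz 0 t \<partial>lborel)"
proof -
  let ?f = "\<lambda>t. exp (Theta \<tau> i 0 (cpt c r s) / 2 - Theta \<tau> j y (cpt c 0 t)) / (cpt c r s - cpt c 0 t) * cdz 0 t"
  have "exp (Theta \<tau> i 0 (cpt c r s) / 2 - Theta \<tau> j 0 (cpt c 0 t)) * exp (of_real y * cpt c 0 t)
      = exp (Theta \<tau> i 0 (cpt c r s) / 2 - Theta \<tau> j y (cpt c 0 t))" for t
    unfolding exp_add[symmetric] by (rule arg_cong[where f=exp]) (simp add: Theta_shift[of \<tau> j y])
  then have "coupling (i, r) s (j, 0) t * (indicator (Jset a k j) y * exp (of_real y * cpt c 0 t))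
      = 1 / (2 * pi * \<i>) * indicator (Jset a k j) y * ?f t" for t
    by (simp add: coupling_gamma_iR[OF r] mult_ac)
  moreover have "r \<in> {1, 2, 3}" using r by auto
  ultimately have "schur_iR (i, r) s (j, 3) y
      = (\<integral>t. 1 / (2 * pi * \<i>) * indicator (Jset a k j) y * ?f t \<partial>lborel)"
    by (simp only: schur_iR_J_column[OF j])
  then show ?thesis by (simp only: Bochner_Integration.integral_mult_right_zero)
qed

lemma schur_iR_through_gamma:
  assumes r: "r \<in> {1, 2}" and j: "j \<in> {1..n}"
  shows "schur_iR (i, 3) x (i, r) s * schur_iR (i, r) s (j, 3) y
    = indicator (Jset a k i) x * indicator (Jset a k j) y * (1 / (2 * pi * \<i>)\<^sup>2 *
       (iR_integral (\<lambda>\<zeta>. exp (Theta \<tau> i x (cpt c r s) - Theta \<tau> j y \<zeta>) / (\<zeta> - cpt c r s)) * cdz r s))"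
proof -
  let ?\<mu> = "cpt c r s"
  let ?out = "exp (- of_real x * ?\<mu>) * exp (Theta \<tau> i 0 ?\<mu> / 2)"
  let ?in = "\<lambda>t. exp (Theta \<tau> i 0 ?\<mu> / 2 - Theta \<tau> j y (cpt c 0 t)) / (?\<mu> - cpt c 0 t) * cdz 0 t"
  have "schur_iR (i, 3) x (i, r) s = - 1 / (2 * pi * \<i>) * indicator (Jset a k i) x * ?out * cdz r s"
    using r by (subst schur_iR_gamma_column) (auto simp: coupling_J_contour contour_weight_def)
  moreover have "iR_integral (\<lambda>\<zeta>. exp (Theta \<tau> i x ?\<mu> - Theta \<tau> j y \<zeta>) / (\<zeta> - ?\<mu>))
      = (\<integral>t. - ?out * ?in t \<partial>lborel)"
    unfolding iR_integral_def
  proof (rule Bochner_Integration.integral_cong[OF refl])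
    fix t
    have "exp (Theta \<tau> i x ?\<mu> - Theta \<tau> j y (cpt c 0 t))
        = ?out * exp (Theta \<tau> i 0 ?\<mu> / 2 - Theta \<tau> j y (cpt c 0 t))"
      unfolding exp_add[symmetric] by (rule arg_cong[where f=exp]) (simp add: Theta_shift[of \<tau> i x])
    moreover have "cpt 0 0 t = cpt c 0 t" by (simp add: cpt_iR)
    moreover have "cpt c 0 t - ?\<mu> = - (?\<mu> - cpt c 0 t)" by simp
    ultimately show "exp (Theta \<tau> i x ?\<mu> - Theta \<tau> j y (cpt 0 0 t)) / (cpt 0 0 t - ?\<mu>) * cdz 0 t
        = - ?out * ?in t"
      by (simp only:) (simp del: minus_diff_eq)
  qed
  ultimately show ?thesis
    unfolding schur_iR_gamma_J[OF r j]
    by (simp only: Bochner_Integration.integral_mult_right_zero) (simp add: power2_eq_square)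
qed

abbreviation schur_iR_then_gamma :: "nat \<times> nat \<Rightarrow> real \<Rightarrow> nat \<times> nat \<Rightarrow> real \<Rightarrow> complex" where
  "schur_iR_then_gamma \<equiv> schur_complement lborel (pieces {1, 2}) schur_iR"

lemma schur_iR_then_gamma_J_J:
  assumes "i \<in> {1..n}" "j \<in> {1..n}"
  shows "schur_iR_then_gamma (i, 3) x (j, 3) y
    = indicator (Jset a k i) x * Pearcey \<tau> c i j x y * indicator (Jset a k j) y"
proof -
  let ?through = "\<lambda>m r. \<integral>s. schur_iR (i, 3) x (m, r) s * schur_iR (m, r) s (j, 3) y \<partial>lborel"
  have "(\<Sum>m\<in>{1..n}. \<Sum>r\<in>{1, 2}. ?through m r) = (\<Sum>m\<in>{i}. \<Sum>r\<in>{1, 2}. ?through m r)"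
  proof (rule sum.mono_neutral_right)
    have "schur_iR (i, 3) x (m, r) s = 0" if "m \<noteq> i" "r \<in> {1, 2}" for m r s
      using that by (subst schur_iR_gamma_column) (auto simp: coupling_J_contour contour_weight_def)
    then show "\<forall>m\<in>{1..n} - {i}. (\<Sum>r\<in>{1, 2}. ?through m r) = 0" by (intro ballI sum.neutral) simp
  qed (use assms in auto)
  also have "\<dots> = (\<Sum>r\<in>{1, 2}. ?through i r)" by simp
  also have "\<dots> = indicator (Jset a k i) x * indicator (Jset a k j) y * Ptilde \<tau> c i j x y"
    unfolding Ptilde_def gammaLR_integral_def sum_distrib_left
    by (intro sum.cong refl)
       (simp only: schur_iR_through_gamma[OF _ assms(2)] Bochner_Integration.integral_mult_right_zero)
  finally show ?thesis
    using schur_iR_J_J[OF assms, of x y]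
    by (simp add: schur_complement_def[of lborel "pieces {1, 2}"] sum_pieces Pearcey_def algebra_simps
        del: One_nat_def)
       (auto simp: pieces_def)
qed

lemma fredholm_term_Pearcey:
  "fredholm_term {1..n} lborel (\<lambda>i x j y. indicator (Jset a k i) x * Pearcey \<tau> c i j x y) N
    = fredholm_term (pieces {0, 1, 2, 3}) lborel schur_iR_then_gamma N"
proof -
  have "fredholm_term {1..n} lborel (\<lambda>i x j y. indicator (Jset a k i) x * Pearcey \<tau> c i j x y) N
      = fredholm_term {1..n} lborel
          (\<lambda>i x j y. indicator (Jset a k i) x * Pearcey \<tau> c i j x y * indicator (Jset a k j) y) N"
    by (rule fredholm_term_indicator_columns[where P="\<lambda>i x j y. Pearcey \<tau> c i j x y", symmetric])
  also have "\<dots> = fredholm_term {1..n} lborel (\<lambda>i x j y. schur_iR_then_gamma (i, 3) x (j, 3) y) N"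
    by (rule fredholm_term_cong) (rule schur_iR_then_gamma_J_J[symmetric])
  also have "\<dots> = fredholm_term (pieces {3}) lborel schur_iR_then_gamma N"
    by (rule fredholm_term_reindex[symmetric, where f="\<lambda>i. (i, 3)"])
       (auto simp: pieces_def bij_betw_def inj_on_def)
  also have "\<dots> = fredholm_term (pieces {0, 1, 2, 3}) lborel schur_iR_then_gamma N"
    by (rule fredholm_term_restrict_index[symmetric])
       (auto simp: pieces_def schur_complement_def)
  finally show ?thesis .
qed

theorem fredholm_series_Pearcey_eq_KP:
  "\<exists>D. fredholm_term {1..n} lborel (\<lambda>i x j y. indicator (Jset a k i) x * Pearcey \<tau> c i j x y) sums D
     \<and> fredholm_term (pieces {0, 1, 2}) lborel (KP_param \<tau> a k n c) sums D"
proof -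
  let ?I = "pieces {0, 1, 2, 3}"
  have pieces: "finite ?I" "pieces {3} \<subseteq> ?I" "pieces {0} \<subseteq> ?I" "pieces {1, 2} \<subseteq> ?I"
    by (auto simp: pieces_def)
  have J_J: "coupling p x q y = 0" if "p \<in> pieces {3}" "q \<in> pieces {3}" for p q x y
    using that by (auto simp: pieces_def coupling_eq_0)
  have iR_iR: "coupling p x q y = 0" if "p \<in> pieces {0}" "q \<in> pieces {0}" for p q x y
    using that by (auto simp: pieces_def coupling_eq_0)
  have blocks: "fredholm_blocks ?I lborel schur_iR"
    using finite_subset[OF pieces(3,1)] pieces(3) fredholm_blocks_coupling
    by (rule lborel.fredholm_blocks_schur_complement)
  obtain D\<^sub>1 where eliminate_J:
      "fredholm_term ?I lborel coupling sums D\<^sub>1" "fredholm_term ?I lborel schur_J sums D\<^sub>1"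
    using lborel.fredholm_series_schur_complement[OF pieces(1,2) fredholm_blocks_coupling J_J] by blast
  obtain D\<^sub>2 where eliminate_iR:
      "fredholm_term ?I lborel coupling sums D\<^sub>2" "fredholm_term ?I lborel schur_iR sums D\<^sub>2"
    using lborel.fredholm_series_schur_complement[OF pieces(1,3) fredholm_blocks_coupling iR_iR] by blast
  obtain D\<^sub>3 where eliminate_gamma:
      "fredholm_term ?I lborel schur_iR sums D\<^sub>3" "fredholm_term ?I lborel schur_iR_then_gamma sums D\<^sub>3"
    using lborel.fredholm_series_schur_complement[OF pieces(1,4) blocks schur_iR_gamma_gamma] by blast
  have "D\<^sub>1 = D\<^sub>2" "D\<^sub>2 = D\<^sub>3"
    using eliminate_J(1) eliminate_iR eliminate_gamma(1) by (auto dest: sums_unique2)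
  then show ?thesis
    using eliminate_J(2) eliminate_gamma(2)
    unfolding fredholm_term_Pearcey[abs_def] fredholm_term_KP_param[abs_def] by auto
qed

end

theorem theorem3p1:
  fixes n :: nat and \<tau> :: "nat \<Rightarrow> real" and k :: "nat \<Rightarrow> nat"
    and a :: "nat \<Rightarrow> nat \<Rightarrow> real" and c :: real
  assumes "n \<ge> 1"
    and "\<forall>i\<in>{1..<n}. \<tau> i < \<tau> (i + 1)"
    and "\<forall>j\<in>{1..n}. k j \<ge> 1"
    and "\<forall>j\<in>{1..n}. \<forall>s\<in>{1..<2 * k j}. a j s < a j (s + 1)"
    and "c > 0"
  shows "\<exists>D. fredholm_term {1..n} lborel
               (\<lambda>i x j y. indicator (Jset a k i) x * Pearcey \<tau> c i j x y) sums D
           \<and> fredholm_term ({1..n} \<times> {0, 1, 2}) lborel (KP_param \<tau> a k n c) sums D"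
proof -
  interpret pearcey_data n \<tau> k a c
    using assms by unfold_locales
  show ?thesis
    using fredholm_series_Pearcey_eq_KP unfolding pieces_def .
qed

end
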